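(* Let $(L,\mathbb{F})$ be a Lévy process on $(\Omega,\mathscr{F},\mathbb{P};\mathbb{F})$ with finite horizon $T>0$, and assume that $L$ is not monotone, i.e. neither $L$ nor $-L$ is a subordinator. Then minimizing the entropy over $\mathscr{M}_a$ (resp. $\mathscr{M}_a^{\rm loc}$) is equivalent to minimizing it over the broader class $\tilde{\mathscr{M}}_a$ (resp. $\tilde{\mathscr{M}}_a^{\rm loc}$), in the sense that $$\inf_{\mathbb{Q}\in\mathscr{M}_a}I_T(\mathbb{Q},\mathbb{P})=\inf_{\mathbb{Q}\in\tilde{\mathscr{M}}_a}I_T(\mathbb{Q},\mathbb{P})$$ and $$\inf_{\mathbb{Q}\in\mathscr{M}^{\rm loc}_a}I_T(\mathbb{Q},\mathbb{P})=\inf_{\mathbb{Q}\in\tilde{\mathscr{M}}^{\rm loc}_a}I_T(\mathbb{Q},\mathbb{P}).$$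
   Context: Time runs over $[0,T]$, $\mathbb{F}=(\mathscr{F}_t)_{t\in[0,T]}$, and $(L,\mathbb{F})$ is a real-valued Lévy process with respect to $\mathbb{F}$ under $\mathbb{P}$ (càdlàg, $L_0=0$, $\mathbb{F}$-adapted, stationary increments $L_t-L_s$ independent of $\mathscr{F}_s$). Probability measures below are considered on $\mathscr{F}_T$. Relative entropy: $I_T(\mathbb{Q},\mathbb{P})=\mathbb{E}_{\mathbb{P}}\big[\frac{d\mathbb{Q}}{d\mathbb{P}}|_{\mathscr{F}_T}\log\frac{d\mathbb{Q}}{d\mathbb{P}}|_{\mathscr{F}_T}\big]$ if $\mathbb{Q}|_{\mathscr{F}_T}\ll\mathbb{P}|_{\mathscr{F}_T}$, and $+\infty$ otherwise. Classes (all measures $\mathbb{Q}$ satisfy $\mathbb{Q}|_{\mathscr{F}_T}\ll\mathbb{P}|_{\mathscr{F}_T}$): - $\mathscr{M}_a$: $(L,\mathbb{F})$ is a $\mathbb{Q}$-martingale. - $\mathscr{M}^{\rm loc}_a$: $(L,\mathbb{F})$ is a $\mathbb{Q}$-local martingale. - $\tilde{\mathscr{M}}_a$: $\mathbb{E}_{\mathbb{Q}}[L_T]=0$ (in particular $L_T$ is $\mathbb{Q}$-integrable). - $\tilde{\mathscr{M}}^{\rm loc}_a$: there is a sequence $(\tau_k)_{k\ge1}$ of $\mathbb{F}$-stopping times such that $\{\tau_k=T\}\uparrow\Omega$ as $k\to\infty$ and $\mathbb{E}_{\mathbb{Q}}[L_{\tau_k\wedge T}]=0$ (in particular this expectation exists)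 for all $k\ge1$. *)

theory Defs
  imports "HOL-Probability.Probability"
begin

section \<open>Stochastic basis with finite horizon\<close>

text \<open>
  Time is the interval \<open>[0, T]\<close>: families indexed by \<open>real\<close> (filtrations, processes) are only
  ever inspected at times in \<open>{0..T}\<close>. Neither completeness nor right-continuity of the
  filtration is assumed.
\<close>

definition filtration_on :: "'a measure \<Rightarrow> real \<Rightarrow> (real \<Rightarrow> 'a measure) \<Rightarrow> bool" where
  "filtration_on P T F \<longleftrightarrow>
     (\<forall>t\<in>{0..T}. subalgebra P (F t)) \<and>
     (\<forall>s\<in>{0..T}. \<forall>t\<in>{0..T}. s \<le> t \<longrightarrow> sets (F s) \<subseteq> sets (F t))"

definition adapted_on :: "real \<Rightarrow> (real \<Rightarrow> 'a measure) \<Rightarrow> (real \<Rightarrow> 'a \<Rightarrow> real) \<Rightarrow> bool" where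
  "adapted_on T F X \<longleftrightarrow> (\<forall>t\<in>{0..T}. X t \<in> borel_measurable (F t))"

definition cadlag_on :: "real \<Rightarrow> (real \<Rightarrow> real) \<Rightarrow> bool" where
  "cadlag_on T f \<longleftrightarrow>
     (\<forall>t\<in>{0..<T}. (f \<longlongrightarrow> f t) (at_right t)) \<and>
     (\<forall>t\<in>{0<..T}. \<exists>l. (f \<longlongrightarrow> l) (at_left t))"

text \<open>
  The library's \<open>stopping_time\<close> quantifies over all elements of the index type, here only times in
  \<open>{0..T}\<close> matter. A value above \<open>T\<close> plays the role of the value \<open>\<infinity>\<close> (never stopped in \<open>[0, T]\<close>).
\<close>

definition stopping_time_on :: "real \<Rightarrow> (real \<Rightarrow> 'a measure) \<Rightarrow> ('a \<Rightarrow> real) \<Rightarrow> bool" where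
  "stopping_time_on T F \<tau> \<longleftrightarrow>
     (\<forall>\<omega>\<in>space (F T). 0 \<le> \<tau> \<omega>) \<and>
     (\<forall>t\<in>{0..T}. Measurable.pred (F t) (\<lambda>\<omega>. \<tau> \<omega> \<le> t))"

text \<open>Stopping times \<open>\<tau> k\<close> with \<open>{\<tau> k = T} \<up> \<Omega>\<close>; the \<open>\<tau> k\<close> themselves need not be monotone in \<open>k\<close>.\<close>

definition exhausting_stopping_times ::
    "real \<Rightarrow> (real \<Rightarrow> 'a measure) \<Rightarrow> (nat \<Rightarrow> 'a \<Rightarrow> real) \<Rightarrow> bool" where
  "exhausting_stopping_times T F \<tau> \<longleftrightarrow>
     (\<forall>k. stopping_time_on T F (\<tau> k)) \<and>
     incseq (\<lambda>k. {\<omega>\<in>space (F T). \<tau> k \<omega> = T}) \<and>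
     (\<Union>k. {\<omega>\<in>space (F T). \<tau> k \<omega> = T}) = space (F T)"

section \<open>Martingales and local martingales on \<open>[0, T]\<close>\<close>

definition martingale_on ::
    "real \<Rightarrow> (real \<Rightarrow> 'a measure) \<Rightarrow> 'a measure \<Rightarrow> (real \<Rightarrow> 'a \<Rightarrow> real) \<Rightarrow> bool" where
  "martingale_on T F Q X \<longleftrightarrow>
     adapted_on T F X \<and>
     (\<forall>t\<in>{0..T}. integrable Q (X t)) \<and>
     (\<forall>s\<in>{0..T}. \<forall>t\<in>{0..T}. s \<le> t \<longrightarrow>
        (AE \<omega> in Q. real_cond_exp Q (F s) (X t) \<omega> = X s \<omega>))"

definition stopped :: "('a \<Rightarrow> real) \<Rightarrow> (real \<Rightarrow> 'a \<Rightarrow> real) \<Rightarrow> real \<Rightarrow> 'a \<Rightarrow> real" where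
  "stopped \<tau> X t \<omega> = X (min (\<tau> \<omega>) t) \<omega>"

definition local_martingale_on ::
    "real \<Rightarrow> (real \<Rightarrow> 'a measure) \<Rightarrow> 'a measure \<Rightarrow> (real \<Rightarrow> 'a \<Rightarrow> real) \<Rightarrow> bool" where
  "local_martingale_on T F Q X \<longleftrightarrow>
     adapted_on T F X \<and>
     (\<exists>\<tau>. exhausting_stopping_times T F \<tau> \<and>
          (\<forall>\<omega>\<in>space (F T). incseq (\<lambda>k. \<tau> k \<omega>)) \<and>
          (\<forall>k. martingale_on T F Q (\<lambda>t \<omega>. stopped (\<tau> k) X t \<omega> - X 0 \<omega>)))"

section \<open>Levy processes and subordinators\<close>

definition levy_process ::
    "'a measure \<Rightarrow> real \<Rightarrow> (real \<Rightarrow> 'a measure) \<Rightarrow> (real \<Rightarrow> 'a \<Rightarrow> real) \<Rightarrow> bool" where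
  "levy_process P T F L \<longleftrightarrow>
     adapted_on T F L \<and>
     (\<forall>\<omega>\<in>space P. L 0 \<omega> = 0) \<and>
     (\<forall>\<omega>\<in>space P. cadlag_on T (\<lambda>t. L t \<omega>)) \<and>
     (\<forall>s t h. 0 \<le> s \<longrightarrow> s \<le> t \<longrightarrow> 0 \<le> h \<longrightarrow> t + h \<le> T \<longrightarrow>
        distr P borel (\<lambda>\<omega>. L (t + h) \<omega> - L (s + h) \<omega>) = distr P borel (\<lambda>\<omega>. L t \<omega> - L s \<omega>)) \<and>
     (\<forall>s t. 0 \<le> s \<longrightarrow> s \<le> t \<longrightarrow> t \<le> T \<longrightarrow>
        prob_space.indep_set P (sets (F s))
          (sets (vimage_algebra (space P) (\<lambda>\<omega>. L t \<omega> - L s \<omega>) borel)))"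

definition subordinator ::
    "'a measure \<Rightarrow> real \<Rightarrow> (real \<Rightarrow> 'a measure) \<Rightarrow> (real \<Rightarrow> 'a \<Rightarrow> real) \<Rightarrow> bool" where
  "subordinator P T F L \<longleftrightarrow>
     levy_process P T F L \<and> (AE \<omega> in P. mono_on {0..T} (\<lambda>t. L t \<omega>))"

section \<open>Relative entropy\<close>

text \<open>
  \<open>P\<close> and \<open>Q\<close> live on the same sigma-algebra. The library's \<open>KL_divergence\<close> is real-valued, hence
  unusable when the entropy is infinite. Here \<open>E\<^sub>P[Z log Z]\<close> is the extended-real expectation:
  positive part minus negative part; as \<open>z log z \<ge> - 1/e\<close>, the latter is finite for probability
  measures. The convention \<open>0 log 0 = 0\<close> holds because the factor \<open>z\<close> vanishes.
\<close>

definition relative_entropy :: "'a measure \<Rightarrow> 'a measure \<Rightarrow> ereal" where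
  "relative_entropy Q P =
     (if absolutely_continuous P Q
      then (let Z = (\<lambda>\<omega>. enn2real (RN_deriv P Q \<omega>))
            in enn2ereal (\<integral>\<^sup>+\<omega>. ennreal (Z \<omega> * ln (Z \<omega>)) \<partial>P)
             - enn2ereal (\<integral>\<^sup>+\<omega>. ennreal (- (Z \<omega> * ln (Z \<omega>))) \<partial>P))
      else \<infinity>)"

definition entropy_at ::
    "real \<Rightarrow> (real \<Rightarrow> 'a measure) \<Rightarrow> 'a measure \<Rightarrow> 'a measure \<Rightarrow> ereal" where
  "entropy_at T F Q P =
     relative_entropy (restr_to_subalg Q (F T)) (restr_to_subalg P (F T))"

section \<open>Classes of measures\<close>

text \<open>All measures \<open>Q\<close> below are probability measures on \<open>F T\<close>.\<close>

definition ac_measures :: "'a measure \<Rightarrow> real \<Rightarrow> (real \<Rightarrow> 'a measure) \<Rightarrow> 'a measure set" where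
  "ac_measures P T F =
     {Q. prob_space Q \<and> sets Q = sets (F T) \<and>
         absolutely_continuous (restr_to_subalg P (F T)) Q}"

definition M_a ::
    "'a measure \<Rightarrow> real \<Rightarrow> (real \<Rightarrow> 'a measure) \<Rightarrow> (real \<Rightarrow> 'a \<Rightarrow> real) \<Rightarrow> 'a measure set" where
  "M_a P T F L = {Q \<in> ac_measures P T F. martingale_on T F Q L}"

definition M_a_loc ::
    "'a measure \<Rightarrow> real \<Rightarrow> (real \<Rightarrow> 'a measure) \<Rightarrow> (real \<Rightarrow> 'a \<Rightarrow> real) \<Rightarrow> 'a measure set" where
  "M_a_loc P T F L = {Q \<in> ac_measures P T F. local_martingale_on T F Q L}"

text \<open>Bochner integrals are 0 for non-integrable functions, so integrability is stated separately.\<close>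

definition M_a_tilde ::
    "'a measure \<Rightarrow> real \<Rightarrow> (real \<Rightarrow> 'a measure) \<Rightarrow> (real \<Rightarrow> 'a \<Rightarrow> real) \<Rightarrow> 'a measure set" where
  "M_a_tilde P T F L =
     {Q \<in> ac_measures P T F. integrable Q (L T) \<and> integral\<^sup>L Q (L T) = 0}"

definition M_a_tilde_loc ::
    "'a measure \<Rightarrow> real \<Rightarrow> (real \<Rightarrow> 'a measure) \<Rightarrow> (real \<Rightarrow> 'a \<Rightarrow> real) \<Rightarrow> 'a measure set" where
  "M_a_tilde_loc P T F L =
     {Q \<in> ac_measures P T F.
        \<exists>\<tau>. exhausting_stopping_times T F \<tau> \<and>
            (\<forall>k. integrable Q (stopped (\<tau> k) L T) \<and> integral\<^sup>L Q (stopped (\<tau> k) L T) = 0)}"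

end

theory Submission
  imports Defs
begin

text \<open>
  Both infima equal \<open>- ln inf\<^sub>v E[exp (v L\<^sub>T)]\<close>, which is the entropy of the Esscher martingale
  measure whenever that exists. All four classes lie between the martingale measures \<open>M_a\<close> and the local weak
  class \<open>M_a_tilde_loc\<close>, so it is enough to bound the entropy from below on \<open>M_a_tilde_loc\<close> and to
  come arbitrarily close to that bound inside \<open>M_a\<close>.

  Lower bound. If \<open>E[exp (v L\<^sub>T)] = exp (\<kappa> T)\<close> is finite, then independence of increments makes
  \<open>exp (v L\<^sub>t - \<kappa> t)\<close> a martingale, and its expectation at a stopping time \<open>\<tau>\<close> is at most one
  (\<open>stopped_exp_supermartingale\<close>). The Gibbs variational inequality then bounds the entropy of
  \<open>Q\<close> by \<open>E\<^sub>Q[v L\<^sub>\<tau> - \<kappa> \<tau>]\<close> from below. For the stopping times that witness membership in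
  \<open>M_a_tilde_loc\<close> this is \<open>- \<kappa> E\<^sub>Q[\<tau>]\<close>, which tends to \<open>- \<kappa> T\<close> (\<open>entropy_lower_bound\<close>).

  Upper bound. The infimum over \<open>v\<close> need not be a critical point, and exponential moments may
  fail to exist. Large jumps are therefore suppressed first: \<open>P\<close> is conditioned on an event
  \<open>good c\<close> which says that on sufficiently fine dyadic grids no increment exceeds \<open>c\<close>. This event
  is an intersection of independent and identically distributed pieces over dyadic cells, so
  under the conditioned measure the dyadic increments are still independent and identically
  distributed; moreover \<open>L\<^sub>T\<close> has all exponential moments (\<open>cell_law_0_exp_finite\<close>). As \<open>L\<close> is not
  monotone, \<open>v \<mapsto> E[exp (v L\<^sub>T); good c]\<close> is coercive for large \<open>c\<close> and has a minimiser \<open>u\<close>. Tilting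
  by \<open>exp (u L\<^sub>T)\<close> gives centred independent increments on every dyadic grid, hence, by right
  continuity and a second moment bound, a martingale at all times. The entropy of the tilted
  measure is \<open>- ln E[exp (u L\<^sub>T); good c]\<close> (the locale \<open>esscher\<close>).

  Finally \<open>c\<close> tends to infinity. Paths are bounded, so \<open>good c\<close> increases to the whole space and
  the truncated moment generating functions increase to the full one. Their minimisers stay in a
  fixed compact interval, and a common point of the nested sublevel sets shows that the minima
  converge to the infimum of the full moment generating function (\<open>INF_entropy_M_a_le\<close>).
\<close>

section \<open>Factors independent of a filtration\<close>

text \<open>
  On \<open>G\<close> the measure with density \<open>H\<close> is \<open>m\<close> times \<open>M\<close>, so integrands measurable in \<open>G\<close> cannot
  distinguish the two. Independence of increments enters every later computation in this form.
\<close>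

lemma nn_integral_mult_of_subalgebra:
  fixes Y H :: "'a \<Rightarrow> ennreal"
  assumes sub: "subalgebra M G"
    and H: "H \<in> borel_measurable M"
    and Y: "Y \<in> borel_measurable G"
    and cond: "\<And>B. B \<in> sets G \<Longrightarrow> (\<integral>\<^sup>+\<omega>. indicator B \<omega> * H \<omega> \<partial>M) = emeasure M B * m"
  shows "(\<integral>\<^sup>+\<omega>. Y \<omega> * H \<omega> \<partial>M) = (\<integral>\<^sup>+\<omega>. Y \<omega> \<partial>M) * m"
proof -
  let ?N = "density M H"
  have sub': "subalgebra ?N G"
    using sub by (simp add: subalgebra_def)
  have eq: "restr_to_subalg ?N G = scale_measure m (restr_to_subalg M G)"
  proof (rule measure_eqI)
    show "sets (restr_to_subalg ?N G) = sets (scale_measure m (restr_to_subalg M G))"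
      by (simp add: sets_restr_to_subalg[OF sub] sets_restr_to_subalg[OF sub'])
    fix B assume "B \<in> sets (restr_to_subalg ?N G)"
    then have B: "B \<in> sets G" by (simp add: sets_restr_to_subalg[OF sub'])
    then have BM: "B \<in> sets M" using sub by (auto simp: subalgebra_def)
    show "emeasure (restr_to_subalg ?N G) B = emeasure (scale_measure m (restr_to_subalg M G)) B"
      using cond[OF B] BM
      by (simp add: emeasure_restr_to_subalg[OF sub B] emeasure_restr_to_subalg[OF sub' B]
          emeasure_density[OF H] mult.commute)
  qed
  have YM: "Y \<in> borel_measurable M" by (rule measurable_from_subalg[OF sub Y])
  have Yr: "Y \<in> borel_measurable (restr_to_subalg M G)"
    by (rule measurable_in_subalg[OF sub Y])
  have "(\<integral>\<^sup>+\<omega>. Y \<omega> * H \<omega> \<partial>M) = (\<integral>\<^sup>+\<omega>. Y \<omega> \<partial>?N)"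
    using nn_integral_density[OF H YM] by (simp add: mult.commute)
  also have "\<dots> = (\<integral>\<^sup>+\<omega>. Y \<omega> \<partial>(restr_to_subalg ?N G))"
    by (rule nn_integral_subalgebra2[OF sub' Y, symmetric])
  also have "\<dots> = m * (\<integral>\<^sup>+\<omega>. Y \<omega> \<partial>(restr_to_subalg M G))"
    unfolding eq by (rule nn_integral_scale_measure[OF Yr])
  also have "\<dots> = (\<integral>\<^sup>+\<omega>. Y \<omega> \<partial>M) * m"
    by (simp add: nn_integral_subalgebra2[OF sub Y] mult.commute)
  finally show ?thesis .
qed

text \<open>
  The factors are peeled off from the last one backwards, each being independent of the
  \<open>\<sigma>\<close>-algebra at its left endpoint.
\<close>

lemma nn_integral_prod_filtration:
  fixes Y :: "'a \<Rightarrow> ennreal" and H :: "nat \<Rightarrow> 'a \<Rightarrow> ennreal"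
  assumes sub: "\<And>i. i \<le> k \<Longrightarrow> subalgebra M (G i)"
    and mono: "\<And>i. i < k \<Longrightarrow> sets (G i) \<subseteq> sets (G (Suc i))"
    and H: "\<And>i. i < k \<Longrightarrow> H i \<in> borel_measurable (G (Suc i))"
    and cond: "\<And>i B. j \<le> i \<Longrightarrow> i < k \<Longrightarrow> B \<in> sets (G i) \<Longrightarrow>
                 (\<integral>\<^sup>+\<omega>. indicator B \<omega> * H i \<omega> \<partial>M) = emeasure M B * m"
    and Y: "Y \<in> borel_measurable (G j)" and "j \<le> k"
  shows "(\<integral>\<^sup>+\<omega>. Y \<omega> * (\<Prod>i\<in>{j..<k}. H i \<omega>) \<partial>M) = (\<integral>\<^sup>+\<omega>. Y \<omega> \<partial>M) * m ^ (k - j)"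
proof -
  have up: "Z \<in> borel_measurable (G (Suc i))" if "i < k" "Z \<in> borel_measurable (G i)"
    for i and Z :: "'a \<Rightarrow> ennreal"
    using measurable_mono[of borel borel "G i" "G (Suc i)"] sub[of i] sub[of "Suc i"] mono[of i] that
    by (auto simp: subalgebra_def)
  have *: "(\<lambda>\<omega>. Y \<omega> * (\<Prod>i\<in>{j..<l}. H i \<omega>)) \<in> borel_measurable (G l) \<and>
      (\<integral>\<^sup>+\<omega>. Y \<omega> * (\<Prod>i\<in>{j..<l}. H i \<omega>) \<partial>M) = (\<integral>\<^sup>+\<omega>. Y \<omega> \<partial>M) * m ^ (l - j)"
    if "j \<le> l" "l \<le> k" for l
    using that
  proof (induction l rule: dec_induct)
    case base
    then show ?case using Y by simp
  next
    case (step l)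
    let ?Z = "\<lambda>\<omega>. Y \<omega> * (\<Prod>i\<in>{j..<l}. H i \<omega>)"
    have Z: "?Z \<in> borel_measurable (G l)" using step by simp
    have eq: "Y \<omega> * (\<Prod>i\<in>{j..<Suc l}. H i \<omega>) = ?Z \<omega> * H l \<omega>" for \<omega>
      using step by (simp add: mult.assoc)
    have HM: "H l \<in> borel_measurable M"
      using measurable_from_subalg[OF sub[of "Suc l"] H[of l]] step by simp
    have "(\<integral>\<^sup>+\<omega>. ?Z \<omega> * H l \<omega> \<partial>M) = (\<integral>\<^sup>+\<omega>. ?Z \<omega> \<partial>M) * m"
      by (rule nn_integral_mult_of_subalgebra[OF sub[of l] HM Z cond]) (use step in auto)
    also have "\<dots> = (\<integral>\<^sup>+\<omega>. Y \<omega> \<partial>M) * m ^ (Suc l - j)"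
      using step by (simp add: Suc_diff_le mult_ac)
    finally show ?case
      unfolding eq using up[OF _ Z] H[of l] step by (auto intro!: borel_measurable_times)
  qed
  show ?thesis using *[of k] \<open>j \<le> k\<close> by simp
qed

section \<open>Moment generating functions of finite measures on the line\<close>

lemma exp_abs_le_sum: "exp \<bar>x\<bar> \<le> exp x + exp (- x)" for x :: real
  by (cases "x \<ge> 0") auto

lemma abs_le_exp: "\<bar>x\<bar> \<le> exp \<bar>x\<bar>" for x :: real
  using exp_ge_add_one_self[of "\<bar>x\<bar>"] by linarith

lemma abs_exp_minus_one_le: "\<bar>exp y - 1\<bar> \<le> \<bar>y\<bar> * exp \<bar>y\<bar>" for y :: real
proof (cases "y \<ge> 0")
  case True
  have "exp (- y) \<ge> 1 - y" using exp_ge_add_one_self[of "-y"] by simp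
  then have "exp y * exp (- y) \<ge> exp y * (1 - y)" by (intro mult_left_mono) auto
  then show ?thesis using True by (simp add: exp_minus algebra_simps)
next
  case False
  have "1 - exp y \<le> - y" using exp_ge_add_one_self[of y] by linarith
  also have "\<dots> \<le> - y * exp (- y)"
    using mult_left_mono[of 1 "exp (- y)" "- y"] False by simp
  finally have "1 - exp y \<le> - y * exp (- y)" .
  moreover have "exp y \<le> 1" using False by simp
  ultimately show ?thesis using False by (simp add: abs_if)
qed

definition mgf :: "real measure \<Rightarrow> real \<Rightarrow> real" where
  "mgf \<nu> v = (\<integral>x. exp (v * x) \<partial>\<nu>)"

locale finite_exp_moments = finite_measure \<nu> for \<nu> :: "real measure" +
  assumes sets_eq [measurable_cong]: "sets \<nu> = sets borel"
    and exp_moment_finite: "\<And>v. (\<integral>\<^sup>+x. ennreal (exp (v * x)) \<partial>\<nu>) < \<infinity>"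
begin

lemma exp_integrable: "integrable \<nu> (\<lambda>x. exp (v * x))"
  using exp_moment_finite[of v] by (intro integrableI_nonneg) auto

lemma nn_integral_exp_eq: "(\<integral>\<^sup>+x. ennreal (exp (v * x)) \<partial>\<nu>) = ennreal (mgf \<nu> v)"
  unfolding mgf_def by (intro nn_integral_eq_integral exp_integrable) auto

lemma mgf_nonneg: "0 \<le> mgf \<nu> v"
  unfolding mgf_def by simp

text \<open>
  As \<open>exp (2 \<bar>x\<bar>) \<le> exp (2 x) + exp (- 2 x)\<close>, the bound is dominated by exponential moments at
  \<open>v + 2\<close> and \<open>v - 2\<close>. The factor 2 leaves room both for a perturbation of \<open>v\<close> by at most one and for
  the linear factor that appears on differentiating.
\<close>

lemma integrable_exp_bound:
  fixes f :: "real \<Rightarrow> real"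
  assumes "f \<in> borel_measurable borel" and "\<And>x. \<bar>f x\<bar> \<le> exp (v * x) * (C * exp (2 * \<bar>x\<bar>))" and "C \<ge> 0"
  shows "integrable \<nu> f"
proof (rule Bochner_Integration.integrable_bound)
  show "integrable \<nu> (\<lambda>x. C * exp ((v + 2) * x) + C * exp ((v - 2) * x))"
    by (intro Bochner_Integration.integrable_add integrable_mult_right exp_integrable)
  show "f \<in> borel_measurable \<nu>" using assms by simp
  have "\<bar>f x\<bar> \<le> C * exp ((v + 2) * x) + C * exp ((v - 2) * x)" for x
  proof -
    have "\<bar>f x\<bar> \<le> C * (exp (v * x) * exp (\<bar>2 * x\<bar>))"
      using assms(2)[of x] by (simp add: abs_mult mult_ac)
    also have "\<dots> \<le> C * (exp (v * x) * (exp (2 * x) + exp (- (2 * x))))"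
      by (intro mult_left_mono exp_abs_le_sum assms) auto
    also have "\<dots> = C * exp ((v + 2) * x) + C * exp ((v - 2) * x)"
      by (simp add: distrib_left mult_exp_exp algebra_simps)
    finally show ?thesis .
  qed
  then show "AE x in \<nu>. norm (f x) \<le> norm (C * exp ((v + 2) * x) + C * exp ((v - 2) * x))"
    by (intro AE_I2) (metis abs_ge_self order_trans real_norm_def)
qed

lemma mult_exp_integrable: "integrable \<nu> (\<lambda>x. x * exp (v * x))"
proof (rule integrable_exp_bound[where v = v and C = 1])
  fix x :: real
  have "\<bar>x\<bar> \<le> exp (2 * \<bar>x\<bar>)" using abs_le_exp[of x] by (smt (verit) exp_le_cancel_iff)
  then show "\<bar>x * exp (v * x)\<bar> \<le> exp (v * x) * (1 * exp (2 * \<bar>x\<bar>))"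
    by (simp add: abs_mult mult.commute mult_left_mono)
qed auto

lemma DERIV_mgf: "(mgf \<nu> has_real_derivative (\<integral>x. x * exp (v * x) \<partial>\<nu>)) (at v)"
proof -
  have quot: "\<bar>(exp (h * x) - 1) / h\<bar> \<le> exp (2 * \<bar>x\<bar>)" if "h \<noteq> 0" "\<bar>h\<bar> \<le> 1" for h x :: real
  proof -
    have "\<bar>(exp (h * x) - 1) / h\<bar> \<le> (\<bar>h * x\<bar> * exp \<bar>h * x\<bar>) / \<bar>h\<bar>"
      unfolding abs_divide by (intro divide_right_mono abs_exp_minus_one_le) auto
    also have "\<dots> = \<bar>x\<bar> * exp \<bar>h * x\<bar>" using that by (simp add: abs_mult)
    also have "\<dots> \<le> exp \<bar>x\<bar> * exp \<bar>x\<bar>"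
      using that mult_right_mono[of "\<bar>h\<bar>" 1 "\<bar>x\<bar>"]
      by (intro mult_mono abs_le_exp) (auto simp: abs_mult)
    finally show ?thesis by (simp add: mult_exp_exp)
  qed
  have "((\<lambda>h. \<integral>x. exp (v * x) * ((exp (h * x) - 1) / h) \<partial>\<nu>) \<longlongrightarrow> (\<integral>x. x * exp (v * x) \<partial>\<nu>)) (at 0)"
  proof -
    have "((\<lambda>h. \<integral>x. exp (v * x) * ((exp (h * x) - 1) / h) \<partial>\<nu>) \<longlongrightarrow> (\<integral>x. x * exp (v * x) \<partial>\<nu>))
        (at 0 within {-1..1})"
      unfolding tendsto_at_iff_sequentially comp_def
    proof (intro allI impI)
      fix X :: "nat \<Rightarrow> real" assume X: "\<forall>i. X i \<in> {-1..1} - {0}" "X \<longlonglongrightarrow> 0"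
      show "(\<lambda>i. \<integral>x. exp (v * x) * ((exp (X i * x) - 1) / X i) \<partial>\<nu>) \<longlonglongrightarrow> (\<integral>x. x * exp (v * x) \<partial>\<nu>)"
      proof (rule integral_dominated_convergence[where w = "\<lambda>x. exp (v * x) * exp (2 * \<bar>x\<bar>)"])
        show "integrable \<nu> (\<lambda>x. exp (v * x) * exp (2 * \<bar>x\<bar>))"
          by (rule integrable_exp_bound[where v = v and C = 1]) auto
        fix i
        have "X i \<noteq> 0" "\<bar>X i\<bar> \<le> 1" using X(1)[rule_format, of i] by (auto simp: abs_le_iff)
        then have "exp (v * x) * \<bar>(exp (X i * x) - 1) / X i\<bar> \<le> exp (v * x) * exp (2 * \<bar>x\<bar>)" for x
          by (rule mult_left_mono[OF quot exp_ge_zero])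
        then show "AE x in \<nu>. norm (exp (v * x) * ((exp (X i * x) - 1) / X i)) \<le> exp (v * x) * exp (2 * \<bar>x\<bar>)"
          by (simp add: abs_mult)
      next
        show "AE x in \<nu>. (\<lambda>i. exp (v * x) * ((exp (X i * x) - 1) / X i)) \<longlonglongrightarrow> x * exp (v * x)"
        proof (rule AE_I2)
          fix x
          have "((\<lambda>h. exp (h * x)) has_real_derivative x) (at 0)"
            by (auto intro!: derivative_eq_intros)
          then have "((\<lambda>h. (exp (h * x) - 1) / h) \<longlongrightarrow> x) (at 0)"
            by (simp add: DERIV_def)
          then have "(\<lambda>i. (exp (X i * x) - 1) / X i) \<longlonglongrightarrow> x"
            using X by (auto simp: tendsto_at_iff_sequentially comp_def)
          then have "(\<lambda>i. exp (v * x) * ((exp (X i * x) - 1) / X i)) \<longlonglongrightarrow> exp (v * x) * x"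
            by (rule tendsto_mult_left)
          then show "(\<lambda>i. exp (v * x) * ((exp (X i * x) - 1) / X i)) \<longlonglongrightarrow> x * exp (v * x)"
            by (simp add: mult.commute)
        qed
      qed auto
    qed
    moreover have "at 0 within {-1..1} = (at 0 :: real filter)"
      by (rule at_within_interior) simp
    ultimately show ?thesis by simp
  qed
  moreover have "(\<integral>x. exp (v * x) * ((exp (h * x) - 1) / h) \<partial>\<nu>) = (mgf \<nu> (v + h) - mgf \<nu> v) / h" for h
  proof -
    have "(mgf \<nu> (v + h) - mgf \<nu> v) / h = (\<integral>x. (exp ((v + h) * x) - exp (v * x)) / h \<partial>\<nu>)"
      unfolding mgf_def
      by (simp only: integral_divide_zero Bochner_Integration.integral_diff[OF exp_integrable exp_integrable])
    also have "\<dots> = (\<integral>x. exp (v * x) * ((exp (h * x) - 1) / h) \<partial>\<nu>)"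
      by (intro Bochner_Integration.integral_cong) (auto simp: exp_add algebra_simps diff_divide_distrib)
    finally show ?thesis by (rule sym)
  qed
  ultimately show ?thesis unfolding DERIV_def by (simp only:)
qed

lemma continuous_mgf: "isCont (mgf \<nu>) v"
  using DERIV_mgf DERIV_isCont by blast

text \<open>
  The first order condition: at a minimum of the moment generating function the exponentially
  tilted measure is centred. This is the source of the martingale property.
\<close>

lemma mgf_minimum_mean_zero:
  assumes "\<And>v. mgf \<nu> u \<le> mgf \<nu> v"
  shows "(\<integral>x. x * exp (u * x) \<partial>\<nu>) = 0"
  by (rule DERIV_local_min[OF DERIV_mgf, where d = 1]) (auto intro: assms)

lemma mgf_positive:
  assumes "emeasure \<nu> S > 0"
  shows "mgf \<nu> v > 0"
proof (rule ccontr)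
  assume "\<not> mgf \<nu> v > 0"
  then have "mgf \<nu> v = 0" using mgf_nonneg[of v] by simp
  then have "(\<integral>x. exp (v * x) \<partial>\<nu>) = 0" unfolding mgf_def .
  then have "AE x in \<nu>. exp (v * x) = 0"
    using integral_nonneg_eq_0_iff_AE[OF exp_integrable] by simp
  then have "AE x in \<nu>. False" by simp
  then have "emeasure \<nu> (space \<nu>) = 0" by (simp add: AE_iff_measurable[OF _ refl])
  then show False using assms emeasure_space[of \<nu> S] by simp
qed

text \<open>
  On each side of zero some set \<open>{x. s x > d}\<close> with \<open>d > 0\<close> carries mass, and \<open>exp y \<ge> 1 + y\<close> turns this
  into linear growth in \<open>\<bar>v\<bar>\<close>.
\<close>

lemma mgf_coercive:
  assumes pos: "emeasure \<nu> {0<..} > 0" and neg: "emeasure \<nu> {..<0} > 0"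
  shows "\<exists>R>0. \<forall>v. \<bar>v\<bar> > R \<longrightarrow> mgf \<nu> v > K"
proof -
  let ?I = "\<lambda>s v. \<integral>x. exp (v * (s * x)) \<partial>\<nu>"
  have half: "\<exists>R>0. \<forall>v>R. ?I s v > K"
    if p: "emeasure \<nu> {x. s * x > 0} > 0" and s: "s = 1 \<or> s = -1" for s :: real
  proof -
    have m: "{x. s * x > d} \<in> sets \<nu>" for d by measurable
    have "(\<Union>n. {x. s * x > 1 / real (Suc n)}) = {x. s * x > 0}"
    proof (intro equalityI subsetI)
      fix x assume "x \<in> (\<Union>n. {x. s * x > 1 / real (Suc n)})"
      then obtain n where "s * x > 1 / real (Suc n)" by auto
      moreover have "1 / real (Suc n) > 0" by simp
      ultimately show "x \<in> {x. s * x > 0}" by (metis mem_Collect_eq order.strict_trans)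
    next
      fix x assume "x \<in> {x. s * x > 0}"
      then show "x \<in> (\<Union>n. {x. s * x > 1 / real (Suc n)})"
        using reals_Archimedean[of "s * x"] by (auto simp: inverse_eq_divide simp del: of_nat_Suc)
    qed
    moreover have "(\<Union>n. {x. s * x > 1 / real (Suc n)}) \<in> null_sets \<nu>"
      if "\<And>n. emeasure \<nu> {x. s * x > 1 / real (Suc n)} = 0"
      using that m by (intro null_sets_UN null_setsI) auto
    ultimately have "\<exists>n. emeasure \<nu> {x. s * x > 1 / real (Suc n)} \<noteq> 0"
      using p by (metis null_setsD1 order_less_irrefl)
    then obtain n where n: "emeasure \<nu> {x. s * x > 1 / real (Suc n)} \<noteq> 0" by blast
    define d where "d = 1 / real (Suc n)"
    let ?A = "{x. s * x > d}"
    have d: "d > 0" by (simp add: d_def)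
    have a: "measure \<nu> ?A > 0" using n by (simp add: d_def emeasure_eq_measure zero_less_measure_iff)
    have lower: "?I s v \<ge> v * d * measure \<nu> ?A" if "v > 0" for v
    proof -
      have "v * d * measure \<nu> ?A = (\<integral>x. v * d * indicator ?A x \<partial>\<nu>)"
        using m by (simp add: sets_eq_imp_space_eq[OF sets_eq])
      also have "\<dots> \<le> ?I s v"
      proof (rule integral_mono)
        show "integrable \<nu> (\<lambda>x. v * d * indicator ?A x)"
          using m by (auto intro!: integrable_mult_right integrable_real_indicator simp: emeasure_eq_measure)
        show "integrable \<nu> (\<lambda>x. exp (v * (s * x)))"
          using exp_integrable[of "v * s"] by (simp add: mult.assoc)
        fix x
        have "v * d \<le> exp (v * (s * x))" if "s * x > d"
        proof -
          have "v * d \<le> v * (s * x)" using that \<open>v > 0\<close> by simp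
          then show ?thesis using exp_ge_add_one_self[of "v * (s * x)"] by linarith
        qed
        then show "v * d * indicator ?A x \<le> exp (v * (s * x))"
          by (auto simp: indicator_def)
      qed
      finally show ?thesis .
    qed
    define c where "c = d * measure \<nu> ?A"
    have c: "c > 0" using a d by (simp add: c_def)
    have "\<forall>v > max 1 (K / c). ?I s v > K"
    proof (intro allI impI)
      fix v assume v: "v > max 1 (K / c)"
      then have "K < v * c" using c by (simp add: divide_less_eq)
      also have "v * c \<le> ?I s v" using lower[of v] v by (simp add: c_def mult.assoc)
      finally show "?I s v > K" .
    qed
    then show ?thesis by (intro exI[of _ "max 1 (K / c)"]) auto
  qed
  have "{x::real. 1 * x > 0} = {0<..}" "{x::real. - 1 * x > 0} = {..<0}" by auto
  then obtain R1 R2 where R: "R1 > 0" "\<And>v. v > R1 \<Longrightarrow> mgf \<nu> v > K" "R2 > 0" "\<And>v. v > R2 \<Longrightarrow> mgf \<nu> (- v) > K"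
    using half[of 1] half[of "-1"] pos neg by (auto simp: mgf_def)
  have "mgf \<nu> v > K" if "\<bar>v\<bar> > max R1 R2" for v
    using that R(2)[of v] R(4)[of "- v"] by (cases "v \<ge> 0") auto
  then show ?thesis using R by (intro exI[of _ "max R1 R2"]) auto
qed

end

section \<open>Dyadic increments of a Levy process\<close>

locale levy_basis = prob_space P for P :: "'a measure" +
  fixes T :: real and F :: "real \<Rightarrow> 'a measure" and L :: "real \<Rightarrow> 'a \<Rightarrow> real"
  assumes T_pos: "0 < T" and filtration: "filtration_on P T F" and levy: "levy_process P T F L"
begin

lemma subalg: "t \<in> {0..T} \<Longrightarrow> subalgebra P (F t)"
  using filtration by (auto simp: filtration_on_def)

lemma space_F: "t \<in> {0..T} \<Longrightarrow> space (F t) = space P"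
  using subalg by (auto simp: subalgebra_def)

lemma sets_F_mono: "0 \<le> s \<Longrightarrow> s \<le> t \<Longrightarrow> t \<le> T \<Longrightarrow> sets (F s) \<subseteq> sets (F t)"
  using filtration by (auto simp: filtration_on_def)

lemma sets_F_P: "t \<in> {0..T} \<Longrightarrow> B \<in> sets (F t) \<Longrightarrow> B \<in> sets P"
  using subalg[of t] by (auto simp: subalgebra_def)

lemma measurable_F_mono: "f \<in> measurable (F s) N \<Longrightarrow> 0 \<le> s \<Longrightarrow> s \<le> t \<Longrightarrow> t \<le> T \<Longrightarrow> f \<in> measurable (F t) N"
  using measurable_mono[of N N "F s" "F t"] sets_F_mono[of s t] space_F[of s] space_F[of t] by auto

lemma measurable_F_P: "t \<in> {0..T} \<Longrightarrow> f \<in> measurable (F t) N \<Longrightarrow> f \<in> measurable P N"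
  using measurable_from_subalg[OF subalg] by auto

lemma L_measurable_F: "0 \<le> s \<Longrightarrow> s \<le> t \<Longrightarrow> t \<le> T \<Longrightarrow> L s \<in> borel_measurable (F t)"
  using levy by (intro measurable_F_mono[where s = s and t = t]) (auto simp: levy_process_def adapted_on_def)

lemma L_measurable: "t \<in> {0..T} \<Longrightarrow> L t \<in> borel_measurable P"
  using L_measurable_F[of t t] measurable_F_P by auto

lemma L_0: "\<omega> \<in> space P \<Longrightarrow> L 0 \<omega> = 0"
  using levy by (auto simp: levy_process_def)

lemma L_cadlag: "\<omega> \<in> space P \<Longrightarrow> cadlag_on T (\<lambda>t. L t \<omega>)"
  using levy by (auto simp: levy_process_def)

definition grid :: "nat \<Rightarrow> nat \<Rightarrow> real" where
  "grid n k = T * real k / 2 ^ n"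

definition incr :: "nat \<Rightarrow> nat \<Rightarrow> 'a \<Rightarrow> real" where
  "incr n k \<omega> = L (grid n (Suc k)) \<omega> - L (grid n k) \<omega>"

lemma grid_0 [simp]: "grid n 0 = 0"
  by (simp add: grid_def)

lemma grid_top [simp]: "grid n (2 ^ n) = T"
  by (simp add: grid_def)

lemma grid_nonneg [simp]: "0 \<le> grid n k"
  using T_pos by (simp add: grid_def)

lemma grid_mono: "k \<le> l \<Longrightarrow> grid n k \<le> grid n l"
  using T_pos by (simp add: grid_def divide_right_mono)

lemma grid_le_T: "k \<le> 2 ^ n \<Longrightarrow> grid n k \<le> T"
  using grid_mono[of k "2 ^ n" n] by simp

lemma grid_in: "k \<le> 2 ^ n \<Longrightarrow> grid n k \<in> {0..T}"
  using grid_le_T by simp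

lemma grid_refine: "n \<le> m \<Longrightarrow> grid n k = grid m (k * 2 ^ (m - n))"
  by (simp add: grid_def field_simps flip: power_add)

lemma incr_refine:
  assumes "n \<le> m"
  shows "incr n k \<omega> = (\<Sum>q<2 ^ (m - n). incr m (k * 2 ^ (m - n) + q) \<omega>)"
proof -
  let ?d = "2 ^ (m - n)"
  have "(\<Sum>q<?d. incr m (k * ?d + q) \<omega>) = L (grid m (k * ?d + ?d)) \<omega> - L (grid m (k * ?d)) \<omega>"
    unfolding incr_def using sum_lessThan_telescope[of "\<lambda>q. L (grid m (k * ?d + q)) \<omega>" ?d] by simp
  then show ?thesis
    using grid_refine[OF assms, of k] grid_refine[OF assms, of "Suc k"]
    by (simp add: incr_def add.commute)
qed

lemma sum_incr: "\<omega> \<in> space P \<Longrightarrow> (\<Sum>i<k. incr n i \<omega>) = L (grid n k) \<omega>"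
  unfolding incr_def using sum_lessThan_telescope[of "\<lambda>i. L (grid n i) \<omega>" k] L_0 by simp

lemma incr_measurable_F: "k < 2 ^ n \<Longrightarrow> incr n k \<in> borel_measurable (F (grid n (Suc k)))"
  unfolding incr_def
  by (intro borel_measurable_diff L_measurable_F) (auto intro!: grid_mono grid_le_T)

lemma incr_measurable: "k < 2 ^ n \<Longrightarrow> incr n k \<in> borel_measurable P"
  using measurable_F_P[OF grid_in incr_measurable_F] by auto

definition incr_law :: "nat \<Rightarrow> real measure" where
  "incr_law n = distr P borel (incr n 0)"

lemma prob_space_incr_law: "prob_space (incr_law n)"
  unfolding incr_law_def by (intro prob_space_distr incr_measurable) simp

lemma sets_incr_law [measurable_cong, simp]: "sets (incr_law n) = sets borel"
  by (simp add: incr_law_def)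

lemma distr_incr:
  assumes "k < 2 ^ n"
  shows "distr P borel (incr n k) = incr_law n"
proof -
  have *: "grid n (Suc k) = grid n 1 + grid n k"
    by (simp add: grid_def field_simps)
  have stat: "distr P borel (\<lambda>\<omega>. L (t + h) \<omega> - L (s + h) \<omega>) = distr P borel (\<lambda>\<omega>. L t \<omega> - L s \<omega>)"
    if "0 \<le> s" "s \<le> t" "0 \<le> h" "t + h \<le> T" for s t h
    using levy that unfolding levy_process_def by blast
  have "distr P borel (\<lambda>\<omega>. L (grid n 1 + grid n k) \<omega> - L (0 + grid n k) \<omega>)
      = distr P borel (\<lambda>\<omega>. L (grid n 1) \<omega> - L 0 \<omega>)"
    using grid_le_T[of "Suc k" n] assms unfolding * by (intro stat) auto
  then show ?thesis unfolding incr_law_def incr_def * by simp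
qed

lemma incr_indep:
  assumes k: "k < 2 ^ n" and B: "B \<in> sets (F (grid n k))" and S: "S \<in> sets borel"
  shows "emeasure P {\<omega>\<in>B. incr n k \<omega> \<in> S} = emeasure P B * emeasure (incr_law n) S"
proof -
  have m: "incr n k \<in> borel_measurable P" using incr_measurable[OF k] .
  have "indep_set (sets (F (grid n k))) (sets (vimage_algebra (space P) (incr n k) borel))"
    using levy grid_mono[of k "Suc k" n] grid_le_T[of "Suc k" n] k
    unfolding levy_process_def incr_def[abs_def] by auto
  moreover have "incr n k -` S \<inter> space P \<in> sets (vimage_algebra (space P) (incr n k) borel)"
    using S by (rule in_vimage_algebra)
  ultimately have "prob (B \<inter> (incr n k -` S \<inter> space P)) = prob B * prob (incr n k -` S \<inter> space P)"
    using B by (intro indep_setD)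
  moreover have "B \<inter> (incr n k -` S \<inter> space P) = {\<omega>\<in>B. incr n k \<omega> \<in> S}"
    using sets.sets_into_space[OF sets_F_P[OF grid_in B]] k by auto
  moreover have "emeasure (incr_law n) S = emeasure P (incr n k -` S \<inter> space P)"
    using emeasure_distr[OF m S] distr_incr[OF k] by simp
  ultimately show ?thesis
    by (simp add: emeasure_eq_measure ennreal_mult)
qed

lemma incr_box:
  assumes "j + K \<le> 2 ^ n" and B: "B \<in> sets (F (grid n j))" and A: "\<And>r. A r \<in> sets borel"
  shows "emeasure P {\<omega>\<in>B. \<forall>r<K. incr n (j + r) \<omega> \<in> A r} = emeasure P B * (\<Prod>r<K. emeasure (incr_law n) (A r))
       \<and> {\<omega>\<in>B. \<forall>r<K. incr n (j + r) \<omega> \<in> A r} \<in> sets (F (grid n (j + K)))"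
  using assms(1)
proof (induction K)
  case 0
  then show ?case using B by simp
next
  case (Suc K)
  let ?C = "{\<omega>\<in>B. \<forall>r<K. incr n (j + r) \<omega> \<in> A r}"
  have k: "j + K < 2 ^ n" using Suc.prems by simp
  have IH: "emeasure P ?C = emeasure P B * (\<Prod>r<K. emeasure (incr_law n) (A r))"
      "?C \<in> sets (F (grid n (j + K)))"
    using conjunct1[OF Suc.IH] conjunct2[OF Suc.IH] k by (auto simp only: less_imp_le)
  note C = IH(2)
  have eq: "{\<omega>\<in>B. \<forall>r<Suc K. incr n (j + r) \<omega> \<in> A r} = {\<omega>\<in>?C. incr n (j + K) \<omega> \<in> A K}"
    by (auto simp: less_Suc_eq)
  have CS: "?C \<in> sets (F (grid n (Suc (j + K))))"
  proof (rule subsetD[OF _ C])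
    show "sets (F (grid n (j + K))) \<subseteq> sets (F (grid n (Suc (j + K))))"
      using k by (intro sets_F_mono grid_mono grid_le_T) auto
  qed
  have mem: "?C \<inter> (incr n (j + K) -` A K \<inter> space (F (grid n (Suc (j + K))))) \<in> sets (F (grid n (Suc (j + K))))"
    by (intro sets.Int CS measurable_sets[OF incr_measurable_F[OF k] A])
  have set_eq: "?C \<inter> (incr n (j + K) -` A K \<inter> space (F (grid n (Suc (j + K))))) = {\<omega>\<in>?C. incr n (j + K) \<omega> \<in> A K}"
    using sets.sets_into_space[OF CS] by blast
  have "{\<omega>\<in>?C. incr n (j + K) \<omega> \<in> A K} \<in> sets (F (grid n (Suc (j + K))))"
    by (rule subst[OF set_eq, where P = "\<lambda>X. X \<in> sets (F (grid n (Suc (j + K))))"], rule mem)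
  then have "{\<omega>\<in>B. \<forall>r<Suc K. incr n (j + r) \<omega> \<in> A r} \<in> sets (F (grid n (j + Suc K)))"
    by (simp only: eq add_Suc_right)
  moreover have "emeasure P {\<omega>\<in>?C. incr n (j + K) \<omega> \<in> A K} = emeasure P ?C * emeasure (incr_law n) (A K)"
    by (rule incr_indep[OF k C A])
  then have "emeasure P {\<omega>\<in>B. \<forall>r<Suc K. incr n (j + r) \<omega> \<in> A r} = emeasure P B * (\<Prod>r<Suc K. emeasure (incr_law n) (A r))"
    by (simp only: eq IH(1) prod.lessThan_Suc mult.assoc)
  ultimately show ?case by (intro conjI)
qed

definition incr_vec :: "nat \<Rightarrow> nat \<Rightarrow> nat \<Rightarrow> 'a \<Rightarrow> nat \<Rightarrow> real" where
  "incr_vec n j K \<omega> = (\<lambda>r\<in>{..<K}. incr n (j + r) \<omega>)"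

lemma incr_vec_measurable: "j + K \<le> 2 ^ n \<Longrightarrow> incr_vec n j K \<in> measurable P (Pi\<^sub>M {..<K} (\<lambda>_. borel))"
  unfolding incr_vec_def[abs_def] by (intro measurable_restrict incr_measurable) auto

text \<open>
  Given any event \<open>B\<close> of positive probability from the past, consecutive increments are independent
  with their common law; a probability measure on the product space is determined by its values on
  boxes, which \<open>incr_box\<close> provides.
\<close>

lemma incr_vec_law:
  assumes jK: "j + K \<le> 2 ^ n" and B: "B \<in> sets (F (grid n j))"
    and S: "S \<in> sets (Pi\<^sub>M {..<K} (\<lambda>_. borel))"
  shows "emeasure P {\<omega>\<in>B. incr_vec n j K \<omega> \<in> S} = emeasure P B * emeasure (Pi\<^sub>M {..<K} (\<lambda>_. incr_law n)) S"
proof (cases "emeasure P B = 0")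
  case True
  have "emeasure P {\<omega>\<in>B. incr_vec n j K \<omega> \<in> S} \<le> emeasure P B"
    using sets_F_P[OF grid_in B] jK by (intro emeasure_mono) auto
  then show ?thesis using True by simp
next
  case False
  have BP: "B \<in> sets P" using sets_F_P[OF grid_in B] jK by simp
  interpret product_sigma_finite "\<lambda>_. incr_law n"
    by (intro product_sigma_finite.intro prob_space_imp_sigma_finite prob_space_incr_law)
  let ?U = "uniform_measure P B"
  have cancel: "emeasure P B * x / emeasure P B = x" for x
    using False by (subst mult.commute, intro ennreal_mult_divide_eq) (auto simp: emeasure_eq_measure)
  have v: "incr_vec n j K \<in> measurable ?U (Pi\<^sub>M {..<K} (\<lambda>_. borel))"
    using incr_vec_measurable[OF jK] by simp
  have pre: "B \<inter> (incr_vec n j K -` X \<inter> space P) = {\<omega>\<in>B. incr_vec n j K \<omega> \<in> X}" for X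
    using sets.sets_into_space[OF BP] by auto
  have em: "emeasure (distr ?U (Pi\<^sub>M {..<K} (\<lambda>_. borel)) (incr_vec n j K)) X
      = emeasure P {\<omega>\<in>B. incr_vec n j K \<omega> \<in> X} / emeasure P B"
    if "X \<in> sets (Pi\<^sub>M {..<K} (\<lambda>_. borel))" for X
    using that measurable_sets[OF incr_vec_measurable[OF jK] that] BP
    by (simp add: emeasure_distr[OF v] emeasure_uniform_measure pre)
  have "distr ?U (Pi\<^sub>M {..<K} (\<lambda>_. borel)) (incr_vec n j K) = Pi\<^sub>M {..<K} (\<lambda>_. incr_law n)"
  proof (rule PiM_eqI)
    fix A :: "nat \<Rightarrow> real set" assume "\<And>i. i \<in> {..<K} \<Longrightarrow> A i \<in> sets (incr_law n)"
    then have A: "A i \<in> sets borel" if "i < K" for i using that by simp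
    define A' where "A' i = (if i < K then A i else {})" for i
    have A': "A' i \<in> sets borel" for i using A by (simp add: A'_def)
    have PiA: "Pi\<^sub>E {..<K} A \<in> sets (Pi\<^sub>M {..<K} (\<lambda>_. borel))"
      using A by (intro sets_PiM_I_finite) auto
    have "{\<omega>\<in>B. incr_vec n j K \<omega> \<in> Pi\<^sub>E {..<K} A} = {\<omega>\<in>B. \<forall>r<K. incr n (j + r) \<omega> \<in> A' r}"
      by (auto simp: incr_vec_def A'_def PiE_iff)
    then have "emeasure P {\<omega>\<in>B. incr_vec n j K \<omega> \<in> Pi\<^sub>E {..<K} A}
        = emeasure P B * (\<Prod>r<K. emeasure (incr_law n) (A' r))"
      by (simp only: incr_box[OF jK B A', THEN conjunct1])
    also have "(\<Prod>r<K. emeasure (incr_law n) (A' r)) = (\<Prod>r<K. emeasure (incr_law n) (A r))"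
      by (simp add: A'_def)
    finally show "emeasure (distr ?U (Pi\<^sub>M {..<K} (\<lambda>_. borel)) (incr_vec n j K)) (Pi\<^sub>E {..<K} A)
        = (\<Prod>i\<in>{..<K}. emeasure (incr_law n) (A i))"
      by (simp add: em[OF PiA] cancel)
  qed (auto intro!: sets_PiM_cong)
  then have "emeasure P {\<omega>\<in>B. incr_vec n j K \<omega> \<in> S} / emeasure P B = emeasure (Pi\<^sub>M {..<K} (\<lambda>_. incr_law n)) S"
    using em[OF S] by simp
  then show ?thesis
    using cancel[of "emeasure P {\<omega>\<in>B. incr_vec n j K \<omega> \<in> S}"]
    by (simp only: ennreal_times_divide[symmetric])
qed

end

section \<open>Truncating the jumps\<close>

context levy_basis
begin

text \<open>
  A substitute for the event that \<open>L\<close> has no jump larger than \<open>c\<close> in cell \<open>i\<close> of level \<open>n\<close>: on all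
  sufficiently fine dyadic grids, the increments inside that cell are bounded by \<open>c\<close>. Since it only
  asks for something to hold eventually, the event for the whole interval is exactly the
  intersection of the events for its cells, as \<open>good_whole_eq\<close> shows.
\<close>

definition good :: "real \<Rightarrow> nat \<Rightarrow> nat \<Rightarrow> 'a set" where
  "good c n i = {\<omega>\<in>space P. \<exists>a. \<forall>N\<ge>n+a. \<forall>r<2 ^ (N - n). \<bar>incr N (i * 2 ^ (N - n) + r) \<omega>\<bar> \<le> c}"

text \<open>
  The same restriction for the levels from \<open>n + a\<close> to \<open>n + a + b\<close> only. It depends on finitely many
  increments, and \<open>good\<close> arises from it by letting \<open>b\<close> and then \<open>a\<close> tend to infinity.
\<close>

definition window :: "real \<Rightarrow> nat \<Rightarrow> nat \<Rightarrow> nat \<Rightarrow> nat \<Rightarrow> 'a set" where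
  "window c n i a b = {\<omega>\<in>space P. \<forall>N\<in>{n+a..n+a+b}. \<forall>r\<in>{..<2 ^ (N - n)}. \<bar>incr N (i * 2 ^ (N - n) + r) \<omega>\<bar> \<le> c}"

lemma good_eq_window: "good c n i = (\<Union>a. \<Inter>b. window c n i a b)"
proof -
  have "(\<forall>N\<ge>n+a. Q N) \<longleftrightarrow> (\<forall>b. \<forall>N\<in>{n+a..n+a+b}. Q N)" for a and Q :: "nat \<Rightarrow> bool"
    by (metis atLeastAtMost_iff le_add_diff_inverse order_refl)
  then show ?thesis by (simp add: good_def window_def set_eq_iff Ball_def[of "{..<_}"])
qed

lemma cell_index_less:
  assumes "i < 2 ^ n" "n \<le> N" "r < 2 ^ (N - n)"
  shows "i * 2 ^ (N - n) + r < (2::nat) ^ N"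
proof -
  have "i * 2 ^ (N - n) + r < Suc i * 2 ^ (N - n)" using assms by simp
  also have "\<dots> \<le> 2 ^ n * 2 ^ (N - n)" using assms by (intro mult_right_mono) auto
  also have "\<dots> = 2 ^ N" using assms by (simp flip: power_add)
  finally show ?thesis .
qed

lemma incr_cell_measurable_F:
  assumes "i < 2 ^ n" "n \<le> N" "r < 2 ^ (N - n)"
  shows "incr N (i * 2 ^ (N - n) + r) \<in> borel_measurable (F (grid n (Suc i)))"
proof (rule measurable_F_mono)
  show "incr N (i * 2 ^ (N - n) + r) \<in> borel_measurable (F (grid N (Suc (i * 2 ^ (N - n) + r))))"
    by (rule incr_measurable_F[OF cell_index_less[OF assms]])
  have "Suc (i * 2 ^ (N - n) + r) \<le> Suc i * 2 ^ (N - n)" using assms by simp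
  then show "grid N (Suc (i * 2 ^ (N - n) + r)) \<le> grid n (Suc i)"
    unfolding grid_refine[OF \<open>n \<le> N\<close>, of "Suc i"] by (rule grid_mono)
qed (use assms grid_le_T[of "Suc i" n] in auto)

lemma window_sets: "i < 2 ^ n \<Longrightarrow> window c n i a b \<in> sets (F (grid n (Suc i)))"
proof -
  assume i: "i < 2 ^ n"
  have sp: "space P = space (F (grid n (Suc i)))" using space_F[OF grid_in[of "Suc i" n]] i by simp
  show ?thesis unfolding window_def sp
  proof (intro sets.sets_Collect_finite_All finite_atLeastAtMost finite_lessThan)
    fix N r assume *: "N \<in> {n + a..n + a + b}" "r \<in> {..<(2::nat) ^ (N - n)}"
    have [measurable]: "incr N (i * 2 ^ (N - n) + r) \<in> borel_measurable (F (grid n (Suc i)))"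
      using * i by (intro incr_cell_measurable_F) auto
    show "{\<omega>\<in>space (F (grid n (Suc i))). \<bar>incr N (i * 2 ^ (N - n) + r) \<omega>\<bar> \<le> c} \<in> sets (F (grid n (Suc i)))"
      by measurable
  qed
qed

lemma good_sets_F: "i < 2 ^ n \<Longrightarrow> good c n i \<in> sets (F (grid n (Suc i)))"
  unfolding good_eq_window by (intro sets.countable_UN sets.countable_INT image_subsetI window_sets) auto

lemma good_sets: "i < 2 ^ n \<Longrightarrow> good c n i \<in> sets P"
  using good_sets_F sets_F_P[OF grid_in] by (metis Suc_leI)

text \<open>
  Window and increment are the same function of the vector of increments at the finest level
  \<open>N1\<close>, whatever the cell, and by \<open>incr_vec_law\<close> the law of that vector neither depends on the cell
  nor on the past.
\<close>

lemma window_law: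
  assumes i: "i < 2 ^ n" and B: "B \<in> sets (F (grid n i))" and S: "S \<in> sets borel"
  shows "prob {\<omega>\<in>B \<inter> window c n i a b. incr n i \<omega> \<in> S} = prob B * prob {\<omega>\<in>window c n 0 a b. incr n 0 \<omega> \<in> S}"
proof -
  define N1 where "N1 = n + a + b"
  define K :: nat where "K = 2 ^ (N1 - n)"
  let ?M = "Pi\<^sub>M {..<K} (\<lambda>_. borel :: real measure)"
  define V where "V = {v\<in>space ?M. (\<Sum>q<K. v q) \<in> S \<and>
     (\<forall>N\<in>{n+a..N1}. \<forall>r\<in>{..<2 ^ (N - n)}. \<bar>\<Sum>q<2 ^ (N1 - N). v (r * 2 ^ (N1 - N) + q)\<bar> \<le> c)}"
  have n1: "n \<le> N1" by (simp add: N1_def)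
  have idx: "r * 2 ^ (N1 - N) + q < K" if "N \<in> {n+a..N1}" "r < 2 ^ (N - n)" "q < 2 ^ (N1 - N)" for N r q
  proof -
    have "N1 - n - (N - n) = N1 - N" "N - n \<le> N1 - n" using that by auto
    then show ?thesis using cell_index_less[of r "N - n" "N1 - n" q] that by (simp add: K_def)
  qed
  have V: "V \<in> sets ?M"
  proof -
    have "(\<lambda>v. \<Sum>q<K. v q) -` S \<inter> space ?M \<in> sets ?M"
      using S by (intro measurable_sets[of _ _ borel] borel_measurable_sum measurable_component_singleton) auto
    then have 1: "{v\<in>space ?M. (\<Sum>q<K. v q) \<in> S} \<in> sets ?M"
      by (simp add: vimage_def Int_def conj_commute)
    have 2: "{v\<in>space ?M. \<forall>N\<in>{n+a..N1}. \<forall>r\<in>{..<2 ^ (N - n)}. \<bar>\<Sum>q<2 ^ (N1 - N). v (r * 2 ^ (N1 - N) + q)\<bar> \<le> c} \<in> sets ?M"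
    proof (intro sets.sets_Collect_finite_All finite_atLeastAtMost finite_lessThan)
      fix N r assume *: "N \<in> {n+a..N1}" "r \<in> {..<(2::nat) ^ (N - n)}"
      have [measurable]: "(\<lambda>v. \<Sum>q<2 ^ (N1 - N). v (r * 2 ^ (N1 - N) + q)) \<in> borel_measurable ?M"
        using * by (intro borel_measurable_sum measurable_component_singleton) (auto intro!: idx)
      show "{v\<in>space ?M. \<bar>\<Sum>q<2 ^ (N1 - N). v (r * 2 ^ (N1 - N) + q)\<bar> \<le> c} \<in> sets ?M"
        by measurable
    qed
    show ?thesis unfolding V_def by (intro sets.sets_Collect_conj 1 2)
  qed
  have iff: "(incr_vec N1 (k * K) K \<omega> \<in> V) \<longleftrightarrow> (\<omega> \<in> window c n k a b \<and> incr n k \<omega> \<in> S)"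
    if "\<omega> \<in> space P" "k < 2 ^ n" for \<omega> k
  proof -
    have 1: "(\<Sum>q<K. incr_vec N1 (k * K) K \<omega> q) = incr n k \<omega>"
      using incr_refine[OF n1, of k \<omega>] by (simp add: incr_vec_def K_def)
    have 2: "(\<Sum>q<2 ^ (N1 - N). incr_vec N1 (k * K) K \<omega> (r * 2 ^ (N1 - N) + q)) = incr N (k * 2 ^ (N - n) + r) \<omega>"
      if "N \<in> {n+a..N1}" "r \<in> {..<2 ^ (N - n)}" for N r
    proof -
      have "k * K = k * 2 ^ (N - n) * 2 ^ (N1 - N)"
        using that by (simp add: K_def mult.assoc flip: power_add)
      then have e: "k * K + (r * 2 ^ (N1 - N) + q) = (k * 2 ^ (N - n) + r) * 2 ^ (N1 - N) + q" for q
        by (simp add: distrib_right)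
      have "(\<Sum>q<2 ^ (N1 - N). incr_vec N1 (k * K) K \<omega> (r * 2 ^ (N1 - N) + q))
          = (\<Sum>q<2 ^ (N1 - N). incr N1 ((k * 2 ^ (N - n) + r) * 2 ^ (N1 - N) + q) \<omega>)"
        using that idx by (intro sum.cong refl) (simp add: incr_vec_def e)
      also have "\<dots> = incr N (k * 2 ^ (N - n) + r) \<omega>"
        using incr_refine[of N N1 "k * 2 ^ (N - n) + r" \<omega>] that by simp
      finally show ?thesis .
    qed
    have sp: "incr_vec N1 (k * K) K \<omega> \<in> space ?M" by (simp add: incr_vec_def space_PiM)
    show ?thesis
      using that 2 sp by (simp add: V_def window_def 1 N1_def[symmetric] conj_commute)
  qed
  have KK: "k * K + K \<le> 2 ^ N1" if "k < 2 ^ n" for k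
    using cell_index_less[OF that n1, of "K - 1"] by (simp add: K_def)
  have gr: "grid n k = grid N1 (k * K)" for k
    using grid_refine[OF n1] by (simp add: K_def)
  have main: "emeasure P {\<omega>\<in>B'. incr_vec N1 (k * K) K \<omega> \<in> V}
      = emeasure P B' * emeasure (Pi\<^sub>M {..<K} (\<lambda>_. incr_law N1)) V"
    if "k < 2 ^ n" "B' \<in> sets (F (grid n k))" for k B'
    using incr_vec_law[OF KK[OF that(1)] _ V] that(2) by (simp add: gr)
  have "{\<omega>\<in>B \<inter> window c n i a b. incr n i \<omega> \<in> S} = {\<omega>\<in>B. incr_vec N1 (i * K) K \<omega> \<in> V}"
    using iff[OF _ i] sets.sets_into_space[OF sets_F_P[OF grid_in B]] i by auto
  moreover have "{\<omega>\<in>window c n 0 a b. incr n 0 \<omega> \<in> S} = {\<omega>\<in>space P. incr_vec N1 (0 * K) K \<omega> \<in> V}"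
    using iff[of _ 0] by (auto simp: window_def)
  moreover have "space P \<in> sets (F (grid n 0))"
    using sets.top[of "F 0"] space_F[of 0] T_pos by simp
  ultimately have "emeasure P {\<omega>\<in>B \<inter> window c n i a b. incr n i \<omega> \<in> S}
      = emeasure P B * emeasure P {\<omega>\<in>window c n 0 a b. incr n 0 \<omega> \<in> S}"
    using main[OF i B] main[of 0 "space P"] emeasure_space_1 by simp
  then show ?thesis by (simp add: emeasure_eq_measure ennreal_mult[symmetric])
qed

lemma good_law:
  assumes i: "i < 2 ^ n" and B: "B \<in> sets (F (grid n i))" and S: "S \<in> sets borel"
  shows "prob {\<omega>\<in>B \<inter> good c n i. incr n i \<omega> \<in> S} = prob B * prob {\<omega>\<in>good c n 0. incr n 0 \<omega> \<in> S}"
proof -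
  let ?p = "\<lambda>a b. prob {\<omega>\<in>window c n 0 a b. incr n 0 \<omega> \<in> S}"
  have BP: "B \<in> sets P" using sets_F_P[OF grid_in B] i by simp
  have lim: "(\<lambda>a. lim (\<lambda>b. prob {\<omega>\<in>C \<inter> window c n k a b. incr n k \<omega> \<in> S})) \<longlonglongrightarrow> prob {\<omega>\<in>C \<inter> good c n k. incr n k \<omega> \<in> S}
      \<and> (\<forall>a. convergent (\<lambda>b. prob {\<omega>\<in>C \<inter> window c n k a b. incr n k \<omega> \<in> S}))"
    if k: "k < 2 ^ n" and C: "C \<in> sets P" for k C
  proof -
    let ?E = "\<lambda>a b. {\<omega>\<in>C \<inter> window c n k a b. incr n k \<omega> \<in> S}"
    have E: "?E a b \<in> sets P" for a b
    proof -
      have "window c n k a b \<in> sets P" using window_sets[OF k] sets_F_P[OF grid_in] k by (metis Suc_leI)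
      then have "(C \<inter> window c n k a b) \<inter> (incr n k -` S \<inter> space P) \<in> sets P"
        using measurable_sets[OF incr_measurable[OF k] S] C by auto
      moreover have "(C \<inter> window c n k a b) \<inter> (incr n k -` S \<inter> space P) = ?E a b"
        using sets.sets_into_space[OF C] by auto
      ultimately show ?thesis by simp
    qed
    have 1: "(\<lambda>b. prob (?E a b)) \<longlonglongrightarrow> prob (\<Inter>b. ?E a b)" for a
      by (rule finite_Lim_measure_decseq) (use E in \<open>auto simp: decseq_def window_def\<close>)
    have 2: "(\<lambda>a. prob (\<Inter>b. ?E a b)) \<longlonglongrightarrow> prob (\<Union>a. \<Inter>b. ?E a b)"
    proof (rule finite_Lim_measure_incseq)
      show "range (\<lambda>a. \<Inter>b. ?E a b) \<subseteq> events" using E by auto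
      have "window c n k a (a' - a + b) \<subseteq> window c n k a' b" if "a \<le> a'" for a a' b
        using that by (auto simp: window_def)
      then show "incseq (\<lambda>a. \<Inter>b. ?E a b)" unfolding incseq_def by blast
    qed
    have 3: "(\<Union>a. \<Inter>b. ?E a b) = {\<omega>\<in>C \<inter> good c n k. incr n k \<omega> \<in> S}"
      by (auto simp: good_eq_window)
    have 4: "lim (\<lambda>b. prob (?E a b)) = prob (\<Inter>b. ?E a b)" for a by (rule limI[OF 1])
    show ?thesis using 2 convergentI[OF 1] by (simp only: 3 4 simp_thms)
  qed
  have w: "space P \<inter> window c n 0 a b = window c n 0 a b" for a b
    unfolding window_def by blast
  have g: "space P \<inter> good c n 0 = good c n 0"
    unfolding good_def by blast
  have l0: "(\<lambda>a. lim (?p a)) \<longlonglongrightarrow> prob {\<omega>\<in>good c n 0. incr n 0 \<omega> \<in> S}"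
    and conv: "convergent (?p a)" for a
    using conjunct1[OF lim[of 0 "space P", OF _ sets.top]] conjunct2[OF lim[of 0 "space P", OF _ sets.top]]
    unfolding w g by simp_all
  have "lim (\<lambda>b. prob {\<omega>\<in>B \<inter> window c n i a b. incr n i \<omega> \<in> S})
      = prob B * lim (?p a)" for a
    unfolding window_law[OF i B S]
    by (rule limI[OF tendsto_mult_left]) (use conv[of a] in \<open>simp only: convergent_LIMSEQ_iff\<close>)
  then have "(\<lambda>a. prob B * lim (?p a))
      \<longlonglongrightarrow> prob {\<omega>\<in>B \<inter> good c n i. incr n i \<omega> \<in> S}"
    using conjunct1[OF lim[OF i BP]] by (simp only:)
  moreover have "(\<lambda>a. prob B * lim (?p a))
      \<longlonglongrightarrow> prob B * prob {\<omega>\<in>good c n 0. incr n 0 \<omega> \<in> S}"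
    by (rule tendsto_mult_left[OF l0])
  ultimately show ?thesis by (rule LIMSEQ_unique)
qed

lemma nn_integral_law_transfer:
  fixes h :: "real \<Rightarrow> ennreal"
  assumes B: "B \<in> events" and G: "G \<in> events" and X: "X \<in> borel_measurable P"
    and eq: "\<And>S. S \<in> sets borel \<Longrightarrow> emeasure P {\<omega>\<in>B \<inter> G. X \<omega> \<in> S} = b * emeasure \<nu> S"
    and \<nu>: "sets \<nu> = sets borel" and h: "h \<in> borel_measurable borel"
  shows "(\<integral>\<^sup>+\<omega>. indicator B \<omega> * (indicator G \<omega> * h (X \<omega>)) \<partial>P) = b * (\<integral>\<^sup>+x. h x \<partial>\<nu>)"
proof -
  let ?N = "density P (indicator (B \<inter> G))"
  have "distr ?N borel X = scale_measure b \<nu>"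
  proof (rule measure_eqI)
    fix S assume "S \<in> sets (distr ?N borel X)"
    then have S: "S \<in> sets borel" by simp
    have "emeasure ?N (X -` S \<inter> space P) = emeasure P ((B \<inter> G) \<inter> (X -` S \<inter> space P))"
      using B G measurable_sets[OF X S] by (intro emeasure_restricted) auto
    also have "(B \<inter> G) \<inter> (X -` S \<inter> space P) = {\<omega>\<in>B \<inter> G. X \<omega> \<in> S}"
      using sets.sets_into_space[OF B] by auto
    finally show "emeasure (distr ?N borel X) S = emeasure (scale_measure b \<nu>) S"
      using S X eq[OF S] by (simp add: emeasure_distr)
  qed (simp add: \<nu>)
  then have "(\<integral>\<^sup>+x. h x \<partial>(distr ?N borel X)) = b * (\<integral>\<^sup>+x. h x \<partial>\<nu>)"
    using h by (simp add: nn_integral_scale_measure measurable_cong_sets[OF \<nu> refl])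
  moreover have "(\<integral>\<^sup>+x. h x \<partial>(distr ?N borel X))
      = (\<integral>\<^sup>+\<omega>. indicator (B \<inter> G) \<omega> * h (X \<omega>) \<partial>P)"
    using h X B G by (subst nn_integral_distr) (auto intro!: nn_integral_density)
  ultimately show ?thesis by (simp add: indicator_inter_arith mult.assoc)
qed

definition cell_law :: "real \<Rightarrow> nat \<Rightarrow> real measure" where
  "cell_law c n = distr (density P (indicator (good c n 0))) borel (incr n 0)"

lemma sets_cell_law [measurable_cong, simp]: "sets (cell_law c n) = sets borel"
  by (simp add: cell_law_def)

lemma emeasure_cell_law:
  assumes "S \<in> sets borel"
  shows "emeasure (cell_law c n) S = emeasure P {\<omega>\<in>good c n 0. incr n 0 \<omega> \<in> S}"
proof -
  have g: "good c n 0 \<in> events" by (rule good_sets) simp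
  have X: "incr n 0 \<in> borel_measurable P" by (rule incr_measurable) simp
  have "emeasure (density P (indicator (good c n 0))) (incr n 0 -` S \<inter> space P) = emeasure P (good c n 0 \<inter> (incr n 0 -` S \<inter> space P))"
    using g measurable_sets[OF X assms] by (intro emeasure_restricted) auto
  also have "good c n 0 \<inter> (incr n 0 -` S \<inter> space P) = {\<omega>\<in>good c n 0. incr n 0 \<omega> \<in> S}"
    using sets.sets_into_space[OF g] by auto
  finally show ?thesis unfolding cell_law_def using assms X by (simp add: emeasure_distr)
qed

lemma nn_integral_cell:
  assumes i: "i < 2 ^ n" and B: "B \<in> sets (F (grid n i))" and h: "h \<in> borel_measurable borel"
  shows "(\<integral>\<^sup>+\<omega>. indicator B \<omega> * (indicator (good c n i) \<omega> * h (incr n i \<omega>)) \<partial>P)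
       = emeasure P B * (\<integral>\<^sup>+x. h x \<partial>cell_law c n)"
proof (rule nn_integral_law_transfer)
  fix S :: "real set" assume S: "S \<in> sets borel"
  show "emeasure P {\<omega>\<in>B \<inter> good c n i. incr n i \<omega> \<in> S} = emeasure P B * emeasure (cell_law c n) S"
    unfolding emeasure_cell_law[OF S]
    by (simp only: emeasure_eq_measure good_law[OF i B S] ennreal_mult measure_nonneg)
qed (use sets_F_P[OF grid_in B] good_sets incr_measurable h i in auto)

lemma nn_integral_incr:
  assumes i: "i < 2 ^ n" and B: "B \<in> sets (F (grid n i))" and h: "h \<in> borel_measurable borel"
  shows "(\<integral>\<^sup>+\<omega>. indicator B \<omega> * h (incr n i \<omega>) \<partial>P) = emeasure P B * (\<integral>\<^sup>+x. h x \<partial>incr_law n)"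
proof -
  have BP: "B \<in> events" using sets_F_P[OF grid_in B] i by simp
  then have "B \<inter> space P = B" using sets.sets_into_space by auto
  then have "(\<integral>\<^sup>+\<omega>. indicator B \<omega> * (indicator (space P) \<omega> * h (incr n i \<omega>)) \<partial>P) = emeasure P B * (\<integral>\<^sup>+x. h x \<partial>incr_law n)"
    using BP incr_measurable[OF i] h by (intro nn_integral_law_transfer) (auto simp: incr_indep[OF i B])
  moreover have "(\<integral>\<^sup>+\<omega>. indicator B \<omega> * (indicator (space P) \<omega> * h (incr n i \<omega>)) \<partial>P) = (\<integral>\<^sup>+\<omega>. indicator B \<omega> * h (incr n i \<omega>) \<partial>P)"
    by (intro nn_integral_cong) simp
  ultimately show ?thesis by simp
qed

lemma good_whole_eq: "good c 0 0 = (\<Inter>i<2 ^ n. good c n i)"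
proof (intro equalityI subsetI)
  fix \<omega> assume "\<omega> \<in> good c 0 0"
  then obtain a where a: "\<omega> \<in> space P" "\<And>N r. N \<ge> a \<Longrightarrow> r < 2 ^ N \<Longrightarrow> \<bar>incr N r \<omega>\<bar> \<le> c"
    by (auto simp: good_def)
  have "\<omega> \<in> good c n i" if i: "i < 2 ^ n" for i
    unfolding good_def mem_Collect_eq
    using a(1) by (intro conjI exI[of _ a] allI impI a(2) cell_index_less i) auto
  then show "\<omega> \<in> (\<Inter>i<2 ^ n. good c n i)" by blast
next
  fix \<omega> assume *: "\<omega> \<in> (\<Inter>i<2 ^ n. good c n i)"
  then have "\<omega> \<in> good c n 0" by simp
  then have sp: "\<omega> \<in> space P" by (simp add: good_def)
  have "\<forall>i\<in>{..<2^n}. \<exists>a. \<forall>N\<ge>n + a. \<forall>r<2 ^ (N - n). \<bar>incr N (i * 2 ^ (N - n) + r) \<omega>\<bar> \<le> c"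
    using * by (simp add: good_def)
  then obtain f where f: "\<And>i N r. i < 2 ^ n \<Longrightarrow> N \<ge> n + f i \<Longrightarrow> r < 2 ^ (N - n) \<Longrightarrow> \<bar>incr N (i * 2 ^ (N - n) + r) \<omega>\<bar> \<le> c"
    unfolding bchoice_iff by auto
  define A where "A = n + Max (f ` {..<2 ^ n})"
  have fA: "n + f i \<le> A" if "i < 2 ^ n" for i using that by (simp add: A_def)
  have "\<bar>incr N r \<omega>\<bar> \<le> c" if N: "N \<ge> A" and r: "r < 2 ^ N" for N r
  proof -
    have nN: "n \<le> N" using N by (simp add: A_def)
    let ?d = "2 ^ (N - n) :: nat"
    have "2 ^ N = 2 ^ n * ?d" using nN by (simp flip: power_add)
    then have "r div ?d < 2 ^ n" using r by (simp add: less_mult_imp_div_less)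
    then have "\<bar>incr N (r div ?d * ?d + r mod ?d) \<omega>\<bar> \<le> c"
      using fA N by (intro f) (auto intro: order_trans)
    then show ?thesis by (simp only: div_mult_mod_eq)
  qed
  then show "\<omega> \<in> good c 0 0" using sp unfolding good_def by (intro CollectI conjI exI[of _ A]) auto
qed

end

section \<open>Exponential moments after truncation\<close>

text \<open>
  Squaring doubles the distance to 1 up to a relative error of the size of that distance. Along
  successive square roots tending to 1 the distances are summable, so the product of all relative
  errors is bounded. Applied to the characteristic functions of increments over dyadic cells this
  gives the rate \<open>1 - \<phi>\<^sub>n = O(2\<^sup>-\<^sup>n)\<close> without choosing a branch of the complex logarithm.
\<close>

lemma square_roots_approach_one_geometrically:
  fixes z :: "nat \<Rightarrow> complex"
  assumes lim: "z \<longlonglongrightarrow> 1" and sq: "\<And>n. z (Suc n) ^ 2 = z n"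
  shows "\<exists>K N. K \<ge> 0 \<and> (\<forall>n\<ge>N. 2 ^ n * cmod (1 - z n) \<le> K)"
proof -
  define e where "e n = cmod (1 - z n)" for n
  have e0: "e n \<ge> 0" for n by (simp add: e_def)
  obtain N where N: "\<And>n. n \<ge> N \<Longrightarrow> e n \<le> 1 / 2"
  proof -
    obtain N where "\<forall>n\<ge>N. cmod (z n - 1) < 1 / 2" using LIMSEQ_D[OF lim, of "1/2"] by auto
    then show ?thesis using that[of N] by (force simp: e_def norm_minus_commute)
  qed
  have step: "e n \<ge> e (Suc n) * (2 - e (Suc n))" for n
  proof -
    have "1 - z n = (1 - z (Suc n)) * (1 + z (Suc n))"
      using sq[of n] by (simp add: power2_eq_square algebra_simps)
    then have "e n = e (Suc n) * cmod (1 + z (Suc n))" by (simp add: e_def norm_mult)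
    moreover have "cmod (1 + z (Suc n)) \<ge> 2 - e (Suc n)"
      using norm_triangle_ineq2[of 2 "1 - z (Suc n)"] by (simp add: e_def)
    ultimately show ?thesis using e0[of "Suc n"] by (simp add: mult_left_mono)
  qed
  have geo: "e (N + k) \<le> (2 / 3) ^ k / 2" for k
  proof (induction k)
    case (Suc k)
    have "e (Suc (N + k)) * (3 / 2) \<le> e (Suc (N + k)) * (2 - e (Suc (N + k)))"
      using N[of "Suc (N + k)"] e0 by (intro mult_left_mono) auto
    then show ?case using step[of "N + k"] Suc by simp
  qed (use N[of N] in simp)
  \<comment> \<open>The exponent dominates the partial sums of \<open>e (N + i) \<le> (2 / 3) ^ i / 2\<close>.\<close>
  have "2 ^ (N + k) * e (N + k) \<le> 2 ^ N * e N * exp (3 / 2 - 3 / 2 * (2 / 3) ^ k)" for k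
  proof (induction k)
    case (Suc k)
    let ?x = "e (Suc (N + k))"
    have x: "0 \<le> ?x" "?x \<le> 1 / 2" using N[of "Suc (N + k)"] e0 by auto
    have "2 * ?x \<le> (1 + ?x) * (?x * (2 - ?x))"
    proof -
      have "?x * (?x * (1 - ?x)) \<ge> 0" using x by auto
      then show ?thesis by (simp add: algebra_simps)
    qed
    also have "\<dots> \<le> (1 + ?x) * e (N + k)" using step[of "N + k"] x by (intro mult_left_mono) auto
    also have "\<dots> \<le> exp ?x * e (N + k)" by (intro mult_right_mono exp_ge_add_one_self e0)
    finally have "2 ^ (N + k) * (2 * ?x) \<le> exp ?x * (2 ^ (N + k) * e (N + k))"
      using mult_left_mono[of "2 * ?x" "exp ?x * e (N + k)" "2 ^ (N + k)"] by (simp add: mult_ac)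
    also have "\<dots> \<le> exp ?x * (2 ^ N * e N * exp (3 / 2 - 3 / 2 * (2 / 3) ^ k))"
      by (intro mult_left_mono Suc) auto
    also have "\<dots> = 2 ^ N * e N * exp (?x + (3 / 2 - 3 / 2 * (2 / 3) ^ k))" by (simp only: exp_add mult_ac)
    also have "\<dots> \<le> 2 ^ N * e N * exp (3 / 2 - 3 / 2 * (2 / 3) ^ (Suc k))"
    proof -
      have "?x \<le> (2 / 3) ^ k / 3" using geo[of "Suc k"] by simp
      moreover have "(2 / 3 :: real) ^ k \<ge> 0" by simp
      ultimately have "?x + (3 / 2 - 3 / 2 * (2 / 3) ^ k) \<le> 3 / 2 - 3 / 2 * (2 / 3) ^ Suc k"
        unfolding power_Suc by linarith
      then show ?thesis by (intro mult_left_mono mult_nonneg_nonneg e0) simp_all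
    qed
    finally show ?case by (simp add: mult_ac)
  qed simp
  also have "2 ^ N * e N * exp (3 / 2 - 3 / 2 * (2 / 3) ^ k) \<le> 2 ^ N * e N * exp (3 / 2)" for k
    using e0[of N] by (intro mult_left_mono) auto
  finally have bound: "2 ^ (N + k) * e (N + k) \<le> 2 ^ N * e N * exp (3 / 2)" for k .
  have "2 ^ n * cmod (1 - z n) \<le> 2 ^ N * e N * exp (3 / 2)" if "n \<ge> N" for n
    using bound[of "n - N"] that by (simp add: e_def)
  then show ?thesis using e0[of N] by (intro exI[of _ "2 ^ N * e N * exp (3 / 2)"] exI[of _ N]) auto
qed

text \<open>
  A trigonometric polynomial that dominates \<open>exp (a y)\<close> for \<open>\<bar>y\<bar> \<le> 1\<close> and is nonnegative everywhere.
  Its integral is controlled by a characteristic function, which always exists. The constant \<open>b\<close> is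
  large enough for two purposes: since \<open>1 - cos y \<ge> y\<^sup>2 / 4\<close> for \<open>\<bar>y\<bar> \<le> 1\<close>, it absorbs the second
  order errors of \<open>exp\<close> and \<open>sin\<close>; and since \<open>b \<ge> a\<^sup>2 / 2\<close>, the polynomial is at least
  \<open>(1 + a sin y / 2)\<^sup>2\<close>.
\<close>

lemma exp_le_trig_majorant:
  fixes a :: real
  defines "b \<equiv> 4 * (\<bar>a\<bar> + a\<^sup>2 * exp \<bar>a\<bar>)"
  shows "\<bar>y\<bar> \<le> 1 \<Longrightarrow> exp (a * y) \<le> 1 + a * sin y + b * (1 - cos y)"
    and "0 \<le> 1 + a * sin y + b * (1 - cos y)"
proof -
  have sin2: "\<bar>sin x - x\<bar> \<le> x\<^sup>2 / 2" for x :: real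
    using Maclaurin_sin_bound[of x 2] by (simp add: sin_coeff_def numeral_2_eq_2 power2_eq_square)
  show "exp (a * y) \<le> 1 + a * sin y + b * (1 - cos y)" if y: "\<bar>y\<bar> \<le> 1"
  proof -
    have cos: "1 - cos y \<ge> y\<^sup>2 / 4"
    proof -
      let ?z = "\<bar>y\<bar> / 2"
      have "?z * (3 / 4) \<le> ?z - ?z\<^sup>2 / 2"
        using y mult_right_mono[of "\<bar>y\<bar>" 1 "\<bar>y\<bar>"] by (simp add: power2_eq_square field_simps)
      also have "\<dots> \<le> sin ?z" using sin2[of ?z] by linarith
      finally have "(?z * (3 / 4))\<^sup>2 \<le> (sin ?z)\<^sup>2" by (intro power_mono) auto
      moreover have "1 - cos \<bar>y\<bar> = 2 * (sin ?z)\<^sup>2"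
        using cos_double_sin[of ?z] by simp
      ultimately have "2 * (?z * (3 / 4))\<^sup>2 \<le> 1 - cos y" by simp
      moreover have "2 * (?z * (3 / 4))\<^sup>2 = y\<^sup>2 * (9 / 32)" by (simp add: power2_eq_square)
      moreover have "y\<^sup>2 / 4 \<le> y\<^sup>2 * (9 / 32)" by simp
      ultimately show ?thesis by linarith
    qed
    let ?t = "a * y"
    have "exp ?t * exp (- ?t) \<ge> exp ?t * (1 - ?t)"
      using exp_ge_add_one_self[of "- ?t"] by (intro mult_left_mono) auto
    then have "exp ?t - 1 - ?t \<le> ?t * (exp ?t - 1)" by (simp add: exp_minus algebra_simps)
    also have "\<dots> \<le> \<bar>?t\<bar> * \<bar>exp ?t - 1\<bar>" by (metis abs_ge_self abs_mult)
    also have "\<dots> \<le> \<bar>?t\<bar> * (\<bar>?t\<bar> * exp \<bar>?t\<bar>)" by (intro mult_left_mono abs_exp_minus_one_le) auto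
    also have "\<dots> = a\<^sup>2 * y\<^sup>2 * exp (\<bar>a\<bar> * \<bar>y\<bar>)"
    proof -
      have "\<bar>?t\<bar> * \<bar>?t\<bar> = a\<^sup>2 * y\<^sup>2" by (simp add: power_mult_distrib flip: power2_eq_square)
      then show ?thesis by (simp add: abs_mult mult.assoc[symmetric])
    qed
    also have "\<dots> \<le> a\<^sup>2 * y\<^sup>2 * exp \<bar>a\<bar>"
      using mult_left_mono[OF y, of "\<bar>a\<bar>"] by (intro mult_left_mono) auto
    finally have 1: "exp ?t \<le> 1 + a * y + a\<^sup>2 * exp \<bar>a\<bar> * y\<^sup>2" by (simp add: mult_ac)
    have "a * (y - sin y) \<le> \<bar>a\<bar> * \<bar>sin y - y\<bar>"
      by (metis abs_ge_self abs_minus_commute abs_mult)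
    also have "\<dots> \<le> \<bar>a\<bar> * (y\<^sup>2 / 2)" by (intro mult_left_mono sin2) auto
    also have "\<dots> \<le> \<bar>a\<bar> * y\<^sup>2" by (intro mult_left_mono) auto
    finally have "a * y \<le> a * sin y + \<bar>a\<bar> * y\<^sup>2" by (simp add: right_diff_distrib)
    with 1 have "exp ?t \<le> 1 + a * sin y + b * (y\<^sup>2 / 4)"
      by (simp add: b_def algebra_simps)
    also have "\<dots> \<le> 1 + a * sin y + b * (1 - cos y)"
      using cos by (intro add_left_mono mult_left_mono) (auto simp: b_def)
    finally show ?thesis .
  qed
  show "0 \<le> 1 + a * sin y + b * (1 - cos y)"
  proof -
    have "(sin y)\<^sup>2 = (1 - cos y) * (1 + cos y)"
      using sin_cos_squared_add[of y] by (simp add: power2_eq_square algebra_simps)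
    also have "\<dots> \<le> (1 - cos y) * 2" by (intro mult_left_mono) auto
    finally have s: "(sin y)\<^sup>2 / 2 \<le> 1 - cos y" by simp
    have "a\<^sup>2 / 2 \<le> b"
    proof -
      have "a\<^sup>2 * 1 \<le> a\<^sup>2 * exp \<bar>a\<bar>" by (intro mult_left_mono) auto
      then show ?thesis by (simp add: b_def) (smt (verit) zero_le_power2)
    qed
    then have "a\<^sup>2 / 2 * ((sin y)\<^sup>2 / 2) \<le> b * (1 - cos y)"
      using s by (intro mult_mono) (auto simp: b_def)
    moreover have "(1 + a * sin y / 2)\<^sup>2 = 1 + a * sin y + a\<^sup>2 / 2 * ((sin y)\<^sup>2 / 2)"
      by (simp add: power2_eq_square field_simps)
    ultimately show ?thesis using zero_le_power2[of "1 + a * sin y / 2"] by linarith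
  qed
qed

context levy_basis
begin

lemma L_right_tendsto:
  assumes \<omega>: "\<omega> \<in> space P" and t: "0 \<le> t" "t < T"
    and s: "\<And>n. t \<le> s n" "s \<longlonglongrightarrow> t"
  shows "(\<lambda>n. L (s n) \<omega>) \<longlonglongrightarrow> L t \<omega>"
proof -
  have "((\<lambda>r. L r \<omega>) \<longlongrightarrow> L t \<omega>) (at_right t)"
    using L_cadlag[OF \<omega>] t by (auto simp: cadlag_on_def)
  moreover have "at_right t = at t within {t..}"
    by (auto simp: at_within_def intro!: arg_cong2[where f = inf] arg_cong[where f = principal])
  ultimately have "continuous (at t within {t..}) (\<lambda>r. L r \<omega>)"
    by (simp add: continuous_within)
  then show ?thesis using s by (auto simp: continuous_within_sequentially comp_def)
qed

lemma grid_one_tendsto: "(\<lambda>n. grid n 1) \<longlonglongrightarrow> 0"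
proof -
  have "(\<lambda>n. T * (1 / 2) ^ n) \<longlonglongrightarrow> T * 0"
    by (intro tendsto_mult_left LIMSEQ_power_zero) auto
  moreover have "grid n 1 = T * (1 / 2) ^ n" for n by (simp add: grid_def power_divide)
  ultimately show ?thesis by simp
qed

lemma incr_0_eq: "\<omega> \<in> space P \<Longrightarrow> incr n 0 \<omega> = L (grid n 1) \<omega>"
  using L_0 by (simp add: incr_def)

lemma char_incr_law_tendsto: "(\<lambda>n. char (incr_law n) \<theta>) \<longlonglongrightarrow> 1"
proof -
  have m: "incr n 0 \<in> borel_measurable P" for n by (rule incr_measurable) simp
  have eq: "char (incr_law n) \<theta> = (CLINT \<omega>|P. iexp (\<theta> * incr n 0 \<omega>))" for n
    unfolding char_def incr_law_def using m by (subst integral_distr) auto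
  have "(\<lambda>n. CLINT \<omega>|P. iexp (\<theta> * incr n 0 \<omega>)) \<longlonglongrightarrow> (CLINT \<omega>|P. 1)"
  proof (rule integral_dominated_convergence[where w = "\<lambda>_. 1"])
    show "AE \<omega> in P. (\<lambda>n. iexp (\<theta> * incr n 0 \<omega>)) \<longlonglongrightarrow> 1"
    proof (rule AE_I2)
      fix \<omega> assume \<omega>: "\<omega> \<in> space P"
      have "(\<lambda>n. incr n 0 \<omega>) \<longlonglongrightarrow> 0"
        using L_right_tendsto[OF \<omega>, of 0 "\<lambda>n. grid n 1"] T_pos grid_one_tendsto \<omega>
        by (simp add: incr_0_eq L_0)
      then have "(\<lambda>n. iexp (\<theta> * incr n 0 \<omega>)) \<longlonglongrightarrow> iexp (\<theta> * 0)"
        by (intro tendsto_intros)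
      then show "(\<lambda>n. iexp (\<theta> * incr n 0 \<omega>)) \<longlonglongrightarrow> 1" by simp
    qed
  qed (use m in auto)
  then show ?thesis by (simp add: eq prob_space)
qed

lemma char_incr_law_square: "char (incr_law (Suc n)) \<theta> ^ 2 = char (incr_law n) \<theta>"
proof -
  let ?X = "incr (Suc n) 0" and ?Y = "incr (Suc n) 1"
  have lt: "(0::nat) < 2 ^ Suc n" "(1::nat) < 2 ^ Suc n" using one_less_power[of "2::nat" "Suc n"] by auto
  have mX: "?X \<in> borel_measurable P" and mY: "?Y \<in> borel_measurable P"
    using incr_measurable lt by blast+
  have sig: "sigma_sets (space P) {X -` A \<inter> space P |A. A \<in> sets borel} = {X -` A \<inter> space P |A. A \<in> sets borel}"
    for X :: "'a \<Rightarrow> real"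
    using sets_vimage_algebra2[of X "space P" borel] by (simp add: sets_vimage_algebra)
  have "indep_var borel ?X borel ?Y"
    unfolding indep_var_eq sig
  proof (intro conjI mX mY indep_setI)
    fix a b assume "a \<in> {?X -` A \<inter> space P |A. A \<in> sets borel}" "b \<in> {?Y -` A \<inter> space P |A. A \<in> sets borel}"
    then obtain A B where A: "A \<in> sets borel" "a = ?X -` A \<inter> space P" and B: "B \<in> sets borel" "b = ?Y -` B \<inter> space P"
      by blast
    have "a \<in> sets (F (grid (Suc n) 1))"
      using measurable_sets[OF incr_measurable_F[OF lt(1)] A(1)] space_F[OF grid_in[of 1 "Suc n"]] A(2) by simp
    then have "emeasure P {\<omega>\<in>a. ?Y \<omega> \<in> B} = emeasure P a * emeasure (incr_law (Suc n)) B"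
      using incr_indep[OF lt(2)] B(1) by simp
    moreover have "{\<omega>\<in>a. ?Y \<omega> \<in> B} = a \<inter> b" using A B by auto
    moreover have "emeasure (incr_law (Suc n)) B = emeasure P b"
      using emeasure_distr[OF mY B(1)] distr_incr[OF lt(2)] B(2) by simp
    ultimately show "prob (a \<inter> b) = prob a * prob b"
      by (simp add: emeasure_eq_measure flip: ennreal_mult)
  qed (use measurable_sets[OF mX] measurable_sets[OF mY] in auto)
  then have "char (distr P borel (\<lambda>\<omega>. ?X \<omega> + ?Y \<omega>)) \<theta> = char (distr P borel ?X) \<theta> * char (distr P borel ?Y) \<theta>"
    by (rule char_distr_add)
  moreover have "(\<lambda>\<omega>. ?X \<omega> + ?Y \<omega>) = incr n 0"
    using incr_refine[of n "Suc n" 0] by (auto simp: fun_eq_iff numeral_2_eq_2 lessThan_Suc)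
  ultimately show ?thesis
    using distr_incr[OF lt(1)] distr_incr[OF lt(2)] by (simp add: incr_law_def[of n] power2_eq_square)
qed

text \<open>
  The majorant is used at the frequency \<open>1 / c\<close>, so that the truncation \<open>\<bar>x\<bar> \<le> c\<close> becomes \<open>\<bar>y\<bar> \<le> 1\<close>.
  Its mean differs from 1 by a multiple of \<open>\<bar>1 - \<phi>\<^sub>n\<bar>\<close>, which is \<open>O(2\<^sup>-\<^sup>n)\<close>.
\<close>

lemma truncated_exp_incr_bound:
  assumes c: "c > 0"
  shows "\<exists>K N. K \<ge> 0 \<and> (\<forall>n\<ge>N. (\<integral>\<^sup>+x. ennreal (exp (u * x)) * indicator {x. \<bar>x\<bar> \<le> c} x \<partial>incr_law n) \<le> ennreal (1 + K / 2 ^ n))"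
proof -
  let ?J = "\<lambda>n. \<integral>\<^sup>+x. ennreal (exp (u * x)) * indicator {x. \<bar>x\<bar> \<le> c} x \<partial>incr_law n"
  define \<theta> where "\<theta> = 1 / c"
  define a where "a = u * c"
  define b where "b = 4 * (\<bar>a\<bar> + a\<^sup>2 * exp \<bar>a\<bar>)"
  obtain K N where K: "K \<ge> 0" and N: "\<And>n. n \<ge> N \<Longrightarrow> 2 ^ n * cmod (1 - char (incr_law n) \<theta>) \<le> K"
    using square_roots_approach_one_geometrically[OF char_incr_law_tendsto char_incr_law_square] by metis
  have b0: "b \<ge> 0" by (simp add: b_def)
  have "?J n \<le> ennreal (1 + (\<bar>a\<bar> + b) * K / 2 ^ n)"
    if n: "n \<ge> N" for n
  proof -
    interpret \<mu>: prob_space "incr_law n" by (rule prob_space_incr_law)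
    let ?g = "\<lambda>x. 1 + a * sin (\<theta> * x) + b * (1 - cos (\<theta> * x))"
    have ic: "integrable (incr_law n) (\<lambda>x. cos (\<theta> * x))" and isin: "integrable (incr_law n) (\<lambda>x. sin (\<theta> * x))"
      by (auto intro!: \<mu>.integrable_const_bound[where B = 1])
    have ie: "integrable (incr_law n) (\<lambda>x. iexp (\<theta> * x))"
      by (auto intro!: \<mu>.integrable_const_bound[where B = 1])
    have re: "Re (char (incr_law n) \<theta>) = (\<integral>x. cos (\<theta> * x) \<partial>incr_law n)"
      unfolding char_def using integral_Re[OF ie] by (simp add: Re_exp)
    have im: "Im (char (incr_law n) \<theta>) = (\<integral>x. sin (\<theta> * x) \<partial>incr_law n)"
      unfolding char_def using integral_Im[OF ie] by (simp add: Im_exp)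
    have ig: "integrable (incr_law n) ?g" using ic isin by simp
    have "?J n \<le> (\<integral>\<^sup>+x. ennreal (?g x) \<partial>incr_law n)"
    proof (rule nn_integral_mono)
      fix x
      have ax: "a * (\<theta> * x) = u * x" using c by (simp add: a_def \<theta>_def)
      show "ennreal (exp (u * x)) * indicator {x. \<bar>x\<bar> \<le> c} x \<le> ennreal (?g x)"
      proof (cases "\<bar>x\<bar> \<le> c")
        case True
        then have "\<bar>\<theta> * x\<bar> \<le> 1" using c by (simp add: \<theta>_def abs_mult)
        then have "exp (u * x) \<le> ?g x"
          using exp_le_trig_majorant(1)[of "\<theta> * x" a] unfolding b_def ax by simp
        then show ?thesis using True by (simp add: ennreal_leI)
      qed (simp add: indicator_def)
    qed
    also have "\<dots> = ennreal (\<integral>x. ?g x \<partial>incr_law n)"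
      using exp_le_trig_majorant(2)[of a] by (intro nn_integral_eq_integral ig) (simp add: b_def)
    finally have 1: "?J n \<le> ennreal (\<integral>x. ?g x \<partial>incr_law n)" .
    have "(\<integral>x. ?g x \<partial>incr_law n) = 1 + a * Im (char (incr_law n) \<theta>) + b * Re (1 - char (incr_law n) \<theta>)"
      using ic isin by (simp add: re im \<mu>.prob_space)
    also have "\<dots> \<le> 1 + (\<bar>a\<bar> + b) * cmod (1 - char (incr_law n) \<theta>)"
    proof -
      have "a * Im (char (incr_law n) \<theta>) \<le> \<bar>a\<bar> * \<bar>Im (1 - char (incr_law n) \<theta>)\<bar>"
        by (simp flip: abs_mult)
      also have "\<dots> \<le> \<bar>a\<bar> * cmod (1 - char (incr_law n) \<theta>)"
        by (intro mult_left_mono abs_Im_le_cmod) auto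
      finally have "a * Im (char (incr_law n) \<theta>) \<le> \<bar>a\<bar> * cmod (1 - char (incr_law n) \<theta>)" .
      moreover have "b * Re (1 - char (incr_law n) \<theta>) \<le> b * cmod (1 - char (incr_law n) \<theta>)"
        using b0 by (intro mult_left_mono complex_Re_le_cmod)
      ultimately show ?thesis by (simp add: algebra_simps)
    qed
    also have "\<dots> \<le> 1 + (\<bar>a\<bar> + b) * (K / 2 ^ n)"
      using N[OF n] b0 by (intro add_left_mono mult_left_mono) (auto simp: field_simps)
    finally have "(\<integral>x. ?g x \<partial>incr_law n) \<le> 1 + (\<bar>a\<bar> + b) * K / 2 ^ n" by simp
    with 1 show ?thesis using ennreal_leI order_trans by blast
  qed
  then show ?thesis using K b0 by (intro exI[of _ "(\<bar>a\<bar> + b) * K"] exI[of _ N]) auto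
qed

lemma nn_integral_grid_prod:
  assumes h: "h \<in> borel_measurable borel" and Y: "Y \<in> borel_measurable (F (grid n j))" and "j \<le> k" "k \<le> 2 ^ n"
  shows "(\<integral>\<^sup>+\<omega>. Y \<omega> * (\<Prod>i\<in>{j..<k}. h (incr n i \<omega>)) \<partial>P) = (\<integral>\<^sup>+\<omega>. Y \<omega> \<partial>P) * (\<integral>\<^sup>+x. h x \<partial>incr_law n) ^ (k - j)"
proof (rule nn_integral_prod_filtration[where G = "\<lambda>i. F (grid n i)"])
  fix i assume "i < k"
  then have i: "i < 2 ^ n" using assms by simp
  show "sets (F (grid n i)) \<subseteq> sets (F (grid n (Suc i)))"
    using i by (intro sets_F_mono grid_mono grid_le_T) auto
  show "(\<lambda>\<omega>. h (incr n i \<omega>)) \<in> borel_measurable (F (grid n (Suc i)))"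
    using incr_measurable_F[OF i] h by simp
  show "(\<integral>\<^sup>+\<omega>. indicator B \<omega> * h (incr n i \<omega>) \<partial>P) = emeasure P B * (\<integral>\<^sup>+x. h x \<partial>incr_law n)"
    if "B \<in> sets (F (grid n i))" for B
    by (rule nn_integral_incr[OF i that h])
next
  show "subalgebra P (F (grid n i))" if "i \<le> k" for i
    using that assms by (intro subalg grid_in) auto
qed (use assms in auto)

lemma nn_integral_cell_prod:
  assumes h: "h \<in> borel_measurable borel" and Y: "Y \<in> borel_measurable (F (grid n j))" and "j \<le> k" "k \<le> 2 ^ n"
  shows "(\<integral>\<^sup>+\<omega>. Y \<omega> * (\<Prod>i\<in>{j..<k}. indicator (good c n i) \<omega> * h (incr n i \<omega>)) \<partial>P)
       = (\<integral>\<^sup>+\<omega>. Y \<omega> \<partial>P) * (\<integral>\<^sup>+x. h x \<partial>cell_law c n) ^ (k - j)"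
proof (rule nn_integral_prod_filtration[where G = "\<lambda>i. F (grid n i)"])
  fix i assume "i < k"
  then have i: "i < 2 ^ n" using assms by simp
  show "sets (F (grid n i)) \<subseteq> sets (F (grid n (Suc i)))"
    using i by (intro sets_F_mono grid_mono grid_le_T) auto
  have [measurable]: "incr n i \<in> borel_measurable (F (grid n (Suc i)))" "good c n i \<in> sets (F (grid n (Suc i)))"
    using incr_measurable_F[OF i] good_sets_F[OF i] by auto
  show "(\<lambda>\<omega>. indicator (good c n i) \<omega> * h (incr n i \<omega>)) \<in> borel_measurable (F (grid n (Suc i)))"
    using h by measurable
  show "(\<integral>\<^sup>+\<omega>. indicator B \<omega> * (indicator (good c n i) \<omega> * h (incr n i \<omega>)) \<partial>P) = emeasure P B * (\<integral>\<^sup>+x. h x \<partial>cell_law c n)"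
    if "B \<in> sets (F (grid n i))" for B
    by (rule nn_integral_cell[OF i that h])
next
  show "subalgebra P (F (grid n i))" if "i \<le> k" for i
    using that assms by (intro subalg grid_in) auto
qed (use assms in auto)

lemma incr_whole: "\<omega> \<in> space P \<Longrightarrow> incr 0 0 \<omega> = L T \<omega>"
  using incr_0_eq[of \<omega> 0] grid_top[of 0] by simp

lemma nn_integral_cell_law:
  assumes h: "h \<in> borel_measurable borel"
  shows "(\<integral>\<^sup>+x. h x \<partial>cell_law c 0) = (\<integral>\<^sup>+\<omega>. indicator (good c 0 0) \<omega> * h (L T \<omega>) \<partial>P)"
proof -
  have "space P \<in> sets (F (grid 0 0))" using sets.top[of "F 0"] space_F[of 0] T_pos by simp
  from nn_integral_cell[OF _ this h, of c]
  have "(\<integral>\<^sup>+x. h x \<partial>cell_law c 0) = (\<integral>\<^sup>+\<omega>. indicator (space P) \<omega> * (indicator (good c 0 0) \<omega> * h (incr 0 0 \<omega>)) \<partial>P)"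
    by (simp add: emeasure_space_1)
  also have "\<dots> = (\<integral>\<^sup>+\<omega>. indicator (good c 0 0) \<omega> * h (L T \<omega>) \<partial>P)"
    by (intro nn_integral_cong) (simp add: incr_whole)
  finally show ?thesis .
qed

lemma prod_ennreal_exp_incr:
  assumes "\<omega> \<in> space P"
  shows "(\<Prod>i<k. ennreal (exp (v * incr n i \<omega>))) = ennreal (exp (v * L (grid n k) \<omega>))"
proof -
  have "(\<Prod>i<k. ennreal (exp (v * incr n i \<omega>))) = ennreal (\<Prod>i<k. exp (v * incr n i \<omega>))"
    by (intro prod_ennreal) simp
  also have "(\<Prod>i<k. exp (v * incr n i \<omega>)) = exp (\<Sum>i<k. v * incr n i \<omega>)"
    by (rule exp_sum[symmetric]) simp
  also have "(\<Sum>i<k. v * incr n i \<omega>) = v * L (grid n k) \<omega>"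
    unfolding sum_distrib_left[symmetric] sum_incr[OF assms] ..
  finally show ?thesis .
qed

lemma cell_law_exp_power:
  "(\<integral>\<^sup>+x. ennreal (exp (v * x)) \<partial>cell_law c n) ^ (2 ^ n) = (\<integral>\<^sup>+x. ennreal (exp (v * x)) \<partial>cell_law c 0)"
proof -
  have "(\<integral>\<^sup>+\<omega>. 1 * (\<Prod>i\<in>{0..<2 ^ n}. indicator (good c n i) \<omega> * ennreal (exp (v * incr n i \<omega>))) \<partial>P)
       = (\<integral>\<^sup>+\<omega>. 1 \<partial>P) * (\<integral>\<^sup>+x. ennreal (exp (v * x)) \<partial>cell_law c n) ^ (2 ^ n - 0)"
    by (rule nn_integral_cell_prod) auto
  moreover have "(\<integral>\<^sup>+\<omega>. 1 * (\<Prod>i\<in>{0..<2 ^ n}. indicator (good c n i) \<omega> * ennreal (exp (v * incr n i \<omega>))) \<partial>P)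
      = (\<integral>\<^sup>+\<omega>. indicator (good c 0 0) \<omega> * ennreal (exp (v * L T \<omega>)) \<partial>P)"
  proof (rule nn_integral_cong)
    fix \<omega> assume \<omega>: "\<omega> \<in> space P"
    have "(\<Prod>i<2 ^ n. indicator (good c n i) \<omega> :: ennreal) = indicator (good c 0 0) \<omega>"
      unfolding good_whole_eq[of c n] by (auto simp: indicator_def prod_eq_1_iff)
    then show "1 * (\<Prod>i\<in>{0..<2 ^ n}. indicator (good c n i) \<omega> * ennreal (exp (v * incr n i \<omega>)))
        = indicator (good c 0 0) \<omega> * ennreal (exp (v * L T \<omega>))"
      using prod_ennreal_exp_incr[OF \<omega>, of v n "2 ^ n"] by (simp add: prod.distrib atLeast0LessThan)
  qed
  ultimately show ?thesis by (simp add: nn_integral_cell_law emeasure_space_1)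
qed

lemma incr_law_exp_power:
  "(\<integral>\<^sup>+x. ennreal (exp (v * x)) \<partial>incr_law n) ^ (2 ^ n) = (\<integral>\<^sup>+\<omega>. ennreal (exp (v * L T \<omega>)) \<partial>P)"
proof -
  have "(\<integral>\<^sup>+\<omega>. 1 * (\<Prod>i\<in>{0..<2 ^ n}. ennreal (exp (v * incr n i \<omega>))) \<partial>P)
       = (\<integral>\<^sup>+\<omega>. 1 \<partial>P) * (\<integral>\<^sup>+x. ennreal (exp (v * x)) \<partial>incr_law n) ^ (2 ^ n - 0)"
    by (rule nn_integral_grid_prod) auto
  moreover have "(\<integral>\<^sup>+\<omega>. 1 * (\<Prod>i\<in>{0..<2 ^ n}. ennreal (exp (v * incr n i \<omega>))) \<partial>P)
      = (\<integral>\<^sup>+\<omega>. ennreal (exp (v * L T \<omega>)) \<partial>P)"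
    using prod_ennreal_exp_incr[of _ v n "2 ^ n"] by (intro nn_integral_cong) (simp add: atLeast0LessThan)
  ultimately show ?thesis by (simp add: emeasure_space_1)
qed

text \<open>
  On the good event \<open>exp (v L\<^sub>T)\<close> is, for all large \<open>n\<close>, the product over the cells of level \<open>n\<close> of the
  exponentials of truncated increments. By independence such a product has mean at most
  \<open>(1 + K / 2\<^sup>n)\<close> to the power \<open>2\<^sup>n\<close>, hence at most \<open>exp K\<close>, and Fatou's lemma concludes.
\<close>

lemma cell_law_0_exp_finite:
  assumes c: "c > 0"
  shows "(\<integral>\<^sup>+x. ennreal (exp (v * x)) \<partial>cell_law c 0) < \<infinity>"
proof -
  obtain K N where K: "K \<ge> 0"
    and N: "\<And>n. n \<ge> N \<Longrightarrow> (\<integral>\<^sup>+x. ennreal (exp (v * x)) * indicator {x. \<bar>x\<bar> \<le> c} x \<partial>incr_law n) \<le> ennreal (1 + K / 2 ^ n)"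
    using truncated_exp_incr_bound[OF c] by metis
  let ?h = "\<lambda>x. ennreal (exp (v * x)) * indicator {x. \<bar>x\<bar> \<le> c} x"
  let ?W = "\<lambda>n \<omega>. \<Prod>i\<in>{0..<2 ^ n}. ?h (incr n i \<omega>)"
  have W: "(\<integral>\<^sup>+\<omega>. ?W n \<omega> \<partial>P) \<le> ennreal (exp K)" if "n \<ge> N" for n
  proof -
    have "(\<integral>\<^sup>+\<omega>. 1 * ?W n \<omega> \<partial>P) = (\<integral>\<^sup>+\<omega>. 1 \<partial>P) * (\<integral>\<^sup>+x. ?h x \<partial>incr_law n) ^ (2 ^ n - 0)"
      by (rule nn_integral_grid_prod) auto
    also have "\<dots> = (\<integral>\<^sup>+x. ?h x \<partial>incr_law n) ^ (2 ^ n)" by (simp add: emeasure_space_1)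
    also have "\<dots> \<le> ennreal (1 + K / 2 ^ n) ^ (2 ^ n)" by (intro power_mono N that) simp
    also have "\<dots> = ennreal ((1 + K / 2 ^ n) ^ (2 ^ n))" using K by (intro ennreal_power) simp
    also have "\<dots> \<le> ennreal (exp K)"
    proof (rule ennreal_leI)
      have "(1 + K / 2 ^ n) ^ (2 ^ n) \<le> exp (K / 2 ^ n) ^ (2 ^ n)"
        using K by (intro power_mono exp_ge_add_one_self) simp
      also have "\<dots> = exp (2 ^ n * (K / 2 ^ n))" by (subst exp_of_nat_mult[symmetric]) simp
      finally show "(1 + K / 2 ^ n) ^ (2 ^ n) \<le> exp K" by simp
    qed
    finally show ?thesis by simp
  qed
  have mW: "?W n \<in> borel_measurable P" for n
  proof (intro borel_measurable_prod_ennreal)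
    fix i assume "i \<in> {0..<(2::nat) ^ n}"
    then have [measurable]: "incr n i \<in> borel_measurable P" by (intro incr_measurable) simp
    show "(\<lambda>\<omega>. ?h (incr n i \<omega>)) \<in> borel_measurable P" by measurable
  qed
  have "(\<integral>\<^sup>+x. ennreal (exp (v * x)) \<partial>cell_law c 0) = (\<integral>\<^sup>+\<omega>. indicator (good c 0 0) \<omega> * ennreal (exp (v * L T \<omega>)) \<partial>P)"
    by (rule nn_integral_cell_law) simp
  also have "\<dots> \<le> (\<integral>\<^sup>+\<omega>. liminf (\<lambda>n. ?W n \<omega>) \<partial>P)"
  proof (rule nn_integral_mono)
    fix \<omega> assume \<omega>: "\<omega> \<in> space P"
    show "indicator (good c 0 0) \<omega> * ennreal (exp (v * L T \<omega>)) \<le> liminf (\<lambda>n. ?W n \<omega>)"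
    proof (cases "\<omega> \<in> good c 0 0")
      case True
      then obtain a where a: "\<And>n r. n \<ge> a \<Longrightarrow> r < 2 ^ n \<Longrightarrow> \<bar>incr n r \<omega>\<bar> \<le> c"
        by (auto simp: good_def)
      have "?W n \<omega> = ennreal (exp (v * L T \<omega>))" if "n \<ge> a" for n
        using prod_ennreal_exp_incr[OF \<omega>, of v n "2 ^ n"] a[OF that]
        by (simp add: atLeast0LessThan indicator_def)
      then have "eventually (\<lambda>n. ennreal (exp (v * L T \<omega>)) \<le> ?W n \<omega>) sequentially"
        unfolding eventually_sequentially by (intro exI[of _ a]) simp
      then have "ennreal (exp (v * L T \<omega>)) \<le> liminf (\<lambda>n. ?W n \<omega>)"
        by (rule Liminf_bounded)
      then show ?thesis using True by simp
    qed simp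
  qed
  also have "\<dots> \<le> liminf (\<lambda>n. \<integral>\<^sup>+\<omega>. ?W n \<omega> \<partial>P)"
    by (intro nn_integral_liminf mW)
  also have "\<dots> \<le> limsup (\<lambda>n. \<integral>\<^sup>+\<omega>. ?W n \<omega> \<partial>P)"
    by (rule Liminf_le_Limsup) simp
  also have "\<dots> \<le> ennreal (exp K)"
    using W by (intro Limsup_bounded) (auto simp: eventually_sequentially)
  finally show ?thesis by (simp add: order_le_less_trans)
qed

lemma cell_law_exp_moments:
  assumes c: "c > 0"
  shows "finite_exp_moments (cell_law c n)"
proof -
  have fin: "(\<integral>\<^sup>+x. ennreal (exp (v * x)) \<partial>cell_law c n) < \<infinity>" for v
  proof (rule ccontr)
    assume "\<not> ?thesis"
    then have "(\<integral>\<^sup>+x. ennreal (exp (v * x)) \<partial>cell_law c n) = top" by (simp add: not_less top_unique)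
    then show False
      using cell_law_exp_power[where v = v and c = c and n = n] cell_law_0_exp_finite[OF c, of v] by (simp add: power_eq_top_ennreal)
  qed
  have "finite_measure (cell_law c n)"
    using fin[of 0] by (intro finite_measureI) (auto simp: less_top)
  then show ?thesis
    unfolding finite_exp_moments_def finite_exp_moments_axioms_def using fin by auto
qed

end

section \<open>Convergence of means; entropy of a density\<close>

text \<open>
  Clipping at height \<open>K\<close> changes each mean by at most \<open>D / K\<close>, uniformly in \<open>n\<close>, and the clipped
  functions converge by dominated convergence.
\<close>

lemma L2_bounded_tendsto:
  fixes f :: "nat \<Rightarrow> 'a \<Rightarrow> real" and g :: "'a \<Rightarrow> real"
  assumes "finite_measure M"
    and f [measurable]: "\<And>n. f n \<in> borel_measurable M" and g [measurable]: "g \<in> borel_measurable M"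
    and lim: "AE x in M. (\<lambda>n. f n x) \<longlonglongrightarrow> g x"
    and bound: "\<And>n. (\<integral>\<^sup>+x. ennreal ((f n x)\<^sup>2) \<partial>M) \<le> ennreal D"
  shows "integrable M g \<and> (\<lambda>n. \<integral>x. f n x \<partial>M) \<longlonglongrightarrow> (\<integral>x. g x \<partial>M)"
proof -
  interpret finite_measure M by fact
  define D' where "D' = max 1 D"
  have "ennreal D \<le> ennreal D'" by (intro ennreal_leI) (simp add: D'_def)
  then have D': "D' > 0" "\<And>n. (\<integral>\<^sup>+x. ennreal ((f n x)\<^sup>2) \<partial>M) \<le> ennreal D'"
    using order_trans[OF bound] by (simp_all add: D'_def)
  have g2: "(\<integral>\<^sup>+x. ennreal ((g x)\<^sup>2) \<partial>M) \<le> ennreal D'"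
  proof -
    have "(\<integral>\<^sup>+x. ennreal ((g x)\<^sup>2) \<partial>M) = (\<integral>\<^sup>+x. liminf (\<lambda>n. ennreal ((f n x)\<^sup>2)) \<partial>M)"
      using lim
      by (intro nn_integral_cong_AE, elim AE_mp, intro AE_I2 impI)
         (auto intro!: lim_imp_Liminf[symmetric] tendsto_intros)
    also have "\<dots> \<le> liminf (\<lambda>n. \<integral>\<^sup>+x. ennreal ((f n x)\<^sup>2) \<partial>M)"
      by (intro nn_integral_liminf) simp
    also have "\<dots> \<le> limsup (\<lambda>n. \<integral>\<^sup>+x. ennreal ((f n x)\<^sup>2) \<partial>M)"
      by (rule Liminf_le_Limsup) simp
    also have "\<dots> \<le> ennreal D'"
      by (intro Limsup_bounded always_eventually allI D'(2))
    finally show ?thesis .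
  qed
  have L2: "integrable M h \<and> integrable M (\<lambda>x. (h x)\<^sup>2) \<and> (\<integral>x. (h x)\<^sup>2 \<partial>M) \<le> D'"
    if [measurable]: "h \<in> borel_measurable M" and h: "(\<integral>\<^sup>+x. ennreal ((h x)\<^sup>2) \<partial>M) \<le> ennreal D'" for h
  proof -
    have i2: "integrable M (\<lambda>x. (h x)\<^sup>2)"
      using h by (intro integrableI_nonneg) (auto simp: order_le_less_trans)
    have "norm (h x) \<le> norm (1 + (h x)\<^sup>2)" for x
    proof -
      have "0 \<le> (\<bar>h x\<bar> - 1)\<^sup>2" by simp
      then have "2 * \<bar>h x\<bar> \<le> 1 + (h x)\<^sup>2" by (simp add: power2_eq_square algebra_simps)
      then show ?thesis by simp
    qed
    then have bd: "AE x in M. norm (h x) \<le> norm (1 + (h x)\<^sup>2)" by simp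
    have "integrable M h"
    proof (rule Bochner_Integration.integrable_bound[OF _ _ bd])
      show "integrable M (\<lambda>x. 1 + (h x)\<^sup>2)" using i2 by simp
    qed measurable
    moreover have "(\<integral>x. (h x)\<^sup>2 \<partial>M) \<le> D'"
      using h D'(1) nn_integral_eq_integral[OF i2] by simp
    ultimately show ?thesis using i2 by simp
  qed
  note Lf = L2[OF f D'(2)] and Lg = L2[OF g g2]
  define cl where "cl K x = max (- K) (min K x)" for K x :: real
  have [measurable]: "cl K \<in> borel_measurable borel" for K unfolding cl_def by measurable
  have cl_bd: "\<bar>cl K x\<bar> \<le> K" if "K > 0" for K x using that by (auto simp: cl_def)
  have trunc: "\<bar>(\<integral>x. h x \<partial>M) - (\<integral>x. cl K (h x) \<partial>M)\<bar> \<le> D' / K"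
    if K: "K > 0" and [measurable]: "h \<in> borel_measurable M" and h: "integrable M h" "integrable M (\<lambda>x. (h x)\<^sup>2)" "(\<integral>x. (h x)\<^sup>2 \<partial>M) \<le> D'" for h K
  proof -
    have ic: "integrable M (\<lambda>x. cl K (h x))"
      using cl_bd[OF K] by (intro integrable_const_bound[where B = K]) auto
    have pt: "\<bar>y - cl K y\<bar> \<le> y\<^sup>2 / K" for y
    proof (cases "\<bar>y\<bar> \<le> K")
      case True
      then show ?thesis using K by (auto simp: cl_def abs_le_iff max_def min_def)
    next
      case False
      have "\<bar>y - cl K y\<bar> \<le> \<bar>y\<bar>" using K by (auto simp: cl_def)
      also have "\<bar>y\<bar> \<le> y\<^sup>2 / K"
        using False K mult_right_mono[of K "\<bar>y\<bar>" "\<bar>y\<bar>"] by (simp add: field_simps power2_eq_square)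
      finally show ?thesis .
    qed
    have "\<bar>(\<integral>x. h x \<partial>M) - (\<integral>x. cl K (h x) \<partial>M)\<bar> = \<bar>\<integral>x. h x - cl K (h x) \<partial>M\<bar>"
      using h ic by simp
    also have "\<dots> \<le> (\<integral>x. \<bar>h x - cl K (h x)\<bar> \<partial>M)" by (rule integral_abs_bound)
    also have "\<dots> \<le> (\<integral>x. (h x)\<^sup>2 / K \<partial>M)"
      using h ic by (intro integral_mono pt) auto
    also have "\<dots> \<le> D' / K" using h K by (simp add: divide_right_mono)
    finally show ?thesis .
  qed
  have "(\<lambda>n. \<integral>x. f n x \<partial>M) \<longlonglongrightarrow> (\<integral>x. g x \<partial>M)"
  proof (rule LIMSEQ_I)
    fix e :: real assume e: "0 < e"
    \<comment> \<open>Clipping \<open>f n\<close> and \<open>g\<close> costs \<open>e / 4\<close> each and leaves \<open>e / 2\<close> for the clipped functions.\<close>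
    define K where "K = 4 * D' / e"
    have K: "K > 0" "D' / K = e / 4" using e D' by (auto simp: K_def)
    have "(\<lambda>n. \<integral>x. cl K (f n x) \<partial>M) \<longlonglongrightarrow> (\<integral>x. cl K (g x) \<partial>M)"
    proof (rule integral_dominated_convergence[where w = "\<lambda>_. K"])
      show "AE x in M. (\<lambda>n. cl K (f n x)) \<longlonglongrightarrow> cl K (g x)"
        using lim unfolding cl_def by (elim AE_mp, intro AE_I2 impI tendsto_intros)
    qed (use cl_bd[OF K(1)] in auto)
    then obtain N where N: "\<And>n. n \<ge> N \<Longrightarrow> \<bar>(\<integral>x. cl K (f n x) \<partial>M) - (\<integral>x. cl K (g x) \<partial>M)\<bar> < e / 2"
      using e LIMSEQ_D[of _ _ "e / 2"] by (metis half_gt_zero real_norm_def)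
    have "norm ((\<integral>x. f n x \<partial>M) - (\<integral>x. g x \<partial>M)) < e" if "n \<ge> N" for n
    proof -
      have "\<bar>(\<integral>x. f n x \<partial>M) - (\<integral>x. cl K (f n x) \<partial>M)\<bar> \<le> e / 4"
        using trunc[OF K(1) f[of n]] Lf[of n] K(2) by simp
      moreover have "\<bar>(\<integral>x. g x \<partial>M) - (\<integral>x. cl K (g x) \<partial>M)\<bar> \<le> e / 4"
        using trunc[OF K(1) g] Lg K(2) by simp
      ultimately show ?thesis using N[OF that] unfolding real_norm_def by linarith
    qed
    then show "\<exists>N. \<forall>n\<ge>N. norm ((\<integral>x. f n x \<partial>M) - (\<integral>x. g x \<partial>M)) < e" by blast
  qed
  then show ?thesis using Lg by simp
qed

lemma relative_entropy_density:
  assumes "sigma_finite_measure R" and Z: "Z \<in> borel_measurable R" "\<And>x. 0 \<le> Z x"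
    and int: "integrable R (\<lambda>x. Z x * ln (Z x))"
  shows "relative_entropy (density R (\<lambda>x. ennreal (Z x))) R = ereal (\<integral>x. Z x * ln (Z x) \<partial>R)"
proof -
  interpret sigma_finite_measure R by fact
  let ?Q = "density R (\<lambda>x. ennreal (Z x))"
  have ac: "absolutely_continuous R ?Q"
    using Z by (intro absolutely_continuousI_density) simp
  have "AE x in R. ennreal (Z x) = RN_deriv R ?Q x"
    using Z by (intro RN_deriv_unique) auto
  then have ae: "AE x in R. enn2real (RN_deriv R ?Q x) = Z x"
    by (elim AE_mp, intro AE_I2 impI) (metis Z(2) enn2real_ennreal)
  have p: "(\<integral>\<^sup>+x. ennreal (enn2real (RN_deriv R ?Q x) * ln (enn2real (RN_deriv R ?Q x))) \<partial>R) = (\<integral>\<^sup>+x. ennreal (Z x * ln (Z x)) \<partial>R)"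
    using ae by (intro nn_integral_cong_AE) (elim AE_mp, intro AE_I2 impI, simp)
  have n: "(\<integral>\<^sup>+x. ennreal (- (enn2real (RN_deriv R ?Q x) * ln (enn2real (RN_deriv R ?Q x)))) \<partial>R) = (\<integral>\<^sup>+x. ennreal (- (Z x * ln (Z x))) \<partial>R)"
    using ae by (intro nn_integral_cong_AE) (elim AE_mp, intro AE_I2 impI, simp)
  have fin: "(\<integral>\<^sup>+x. ennreal (Z x * ln (Z x)) \<partial>R) < \<infinity>" "(\<integral>\<^sup>+x. ennreal (- (Z x * ln (Z x))) \<partial>R) < \<infinity>"
    using int by (auto elim!: integrableE simp: less_top[symmetric])
  define a b where "a = enn2real (\<integral>\<^sup>+x. ennreal (Z x * ln (Z x)) \<partial>R)"
    and "b = enn2real (\<integral>\<^sup>+x. ennreal (- (Z x * ln (Z x))) \<partial>R)"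
  then have a: "(\<integral>\<^sup>+x. ennreal (Z x * ln (Z x)) \<partial>R) = ennreal a" "a \<ge> 0"
    and b: "(\<integral>\<^sup>+x. ennreal (- (Z x * ln (Z x))) \<partial>R) = ennreal b" "b \<ge> 0"
    using fin by simp_all
  have "(\<integral>x. Z x * ln (Z x) \<partial>R) = a - b"
    using real_lebesgue_integral_def[OF int] a b by simp
  then show ?thesis
    unfolding relative_entropy_def Let_def p n a b using ac a b by simp
qed

section \<open>Rounding times up to the grid\<close>

context levy_basis
begin

text \<open>
  The index of the first grid point of level \<open>n\<close> that is not before \<open>s\<close>. Rounding upwards is what
  fits right continuous paths and turns stopping times into grid-valued stopping times.
\<close>

definition up :: "nat \<Rightarrow> real \<Rightarrow> nat" where
  "up n s = nat \<lceil>s * 2 ^ n / T\<rceil>"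

lemma up_le_iff: "up n s \<le> k \<longleftrightarrow> s \<le> grid n k"
proof -
  have "up n s \<le> k \<longleftrightarrow> \<lceil>s * 2 ^ n / T\<rceil> \<le> int k" by (simp add: up_def nat_le_iff)
  also have "\<dots> \<longleftrightarrow> s * 2 ^ n / T \<le> real k" by (simp add: ceiling_le_iff)
  also have "\<dots> \<longleftrightarrow> s \<le> grid n k" using T_pos by (simp add: grid_def field_simps)
  finally show ?thesis .
qed

lemma up_le: "s \<le> T \<Longrightarrow> up n s \<le> 2 ^ n"
  by (simp add: up_le_iff)

lemma grid_up_ge: "s \<le> grid n (up n s)"
  using up_le_iff by blast

lemma grid_up_T: "grid n (up n T) = T"
  using up_le[of T n] grid_up_ge[of T n] grid_le_T[of "up n T" n] by simp

lemma grid_up_tendsto: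
  assumes "0 \<le> s"
  shows "(\<lambda>n. grid n (up n s)) \<longlonglongrightarrow> s"
proof (rule tendsto_sandwich)
  show "(\<lambda>n. s) \<longlonglongrightarrow> s" by simp
  show "(\<lambda>n. s + grid n 1) \<longlonglongrightarrow> s" using tendsto_add[OF tendsto_const grid_one_tendsto, of s] by simp
  have "grid n (up n s) \<le> s + grid n 1" for n
  proof -
    have "real (up n s) = of_int \<lceil>s * 2 ^ n / T\<rceil>" using assms T_pos by (simp add: up_def)
    then have "real (up n s) \<le> s * 2 ^ n / T + 1" by linarith
    then have "T * real (up n s) / 2 ^ n \<le> T * (s * 2 ^ n / T + 1) / 2 ^ n"
      using T_pos by (intro divide_right_mono mult_left_mono) auto
    also have "T * (s * 2 ^ n / T + 1) / 2 ^ n = s + grid n 1"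
      using T_pos by (simp add: grid_def field_simps)
    finally show ?thesis by (simp add: grid_def)
  qed
  then show "\<forall>\<^sub>F n in sequentially. grid n (up n s) \<le> s + grid n 1" by simp
qed (simp add: grid_up_ge)

lemma L_grid_up_tendsto:
  assumes "\<omega> \<in> space P" "0 \<le> s" "s \<le> T"
  shows "(\<lambda>n. L (grid n (up n s)) \<omega>) \<longlonglongrightarrow> L s \<omega>"
proof (cases "s = T")
  case True
  then show ?thesis by (simp add: grid_up_T)
next
  case False
  then show ?thesis using assms by (intro L_right_tendsto grid_up_ge grid_up_tendsto) auto
qed

abbreviation P_T :: "'a measure" where "P_T \<equiv> restr_to_subalg P (F T)"

lemma T_in: "T \<in> {0..T}" using T_pos by simp

lemma prob_space_P_T: "prob_space P_T"
  by (rule prob_space_restr_to_subalg[OF subalg[OF T_in] prob_space_axioms])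

lemma sets_P_T [measurable_cong]: "sets P_T = sets (F T)"
  by (rule sets_restr_to_subalg[OF subalg[OF T_in]])

lemma space_P_T: "space P_T = space P"
  by (rule space_restr_to_subalg)

lemma borel_measurable_P_T: "borel_measurable P_T = borel_measurable (F T)"
  by (rule measurable_cong_sets[OF sets_P_T refl])

lemma nn_integral_P_T: "f \<in> borel_measurable (F T) \<Longrightarrow> (\<integral>\<^sup>+\<omega>. f \<omega> \<partial>P_T) = (\<integral>\<^sup>+\<omega>. f \<omega> \<partial>P)"
  by (rule nn_integral_subalgebra2[OF subalg[OF T_in]])

end

section \<open>The Esscher transform at a minimiser\<close>

text \<open>
  The Esscher transform of \<open>P\<close> conditioned on \<open>good c 0 0\<close>, at a minimiser \<open>u\<close> of the truncated moment
  generating function.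
\<close>

locale esscher = levy_basis +
  fixes c u :: real
  assumes c_pos: "c > 0" and minimal: "\<And>v. mgf (cell_law c 0) u \<le> mgf (cell_law c 0) v"
    and mgf_pos: "0 < mgf (cell_law c 0) u"
begin

abbreviation m :: "nat \<Rightarrow> real \<Rightarrow> real" where "m n v \<equiv> mgf (cell_law c n) v"

lemma cell_moments: "finite_exp_moments (cell_law c n)"
  by (rule cell_law_exp_moments[OF c_pos])

lemma nn_integral_cell_exp: "(\<integral>\<^sup>+x. ennreal (exp (v * x)) \<partial>cell_law c n) = ennreal (m n v)"
  by (rule finite_exp_moments.nn_integral_exp_eq[OF cell_moments])

lemma m_nonneg: "0 \<le> m n v"
  by (rule finite_exp_moments.mgf_nonneg[OF cell_moments])

lemma m_power: "m n v ^ (2 ^ n) = m 0 v"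
  using cell_law_exp_power[where v = v and c = c and n = n] m_nonneg
  by (simp add: nn_integral_cell_exp ennreal_power)

text \<open>
  The moment generating function of the whole interval is the power \<open>2\<^sup>n\<close> of that of a cell, so
  \<open>u\<close> minimises both. One and the same tilt therefore centres the increments of every level.
\<close>

lemma m_minimal: "m n u \<le> m n v"
proof (rule power_le_imp_le_base[of _ "2 ^ n - 1"])
  show "m n u ^ Suc (2 ^ n - 1) \<le> m n v ^ Suc (2 ^ n - 1)"
    using minimal[of v] m_power by simp
qed (rule m_nonneg)

lemma cell_mean_zero: "(\<integral>x. x * exp (u * x) \<partial>cell_law c n) = 0"
  by (rule finite_exp_moments.mgf_minimum_mean_zero[OF cell_moments m_minimal])

definition Z :: "'a \<Rightarrow> real" where
  "Z \<omega> = indicator (good c 0 0) \<omega> * exp (u * L T \<omega>) / m 0 u"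

definition Q :: "'a measure" where
  "Q = density P_T (\<lambda>\<omega>. ennreal (Z \<omega>))"

lemma Z_nonneg: "0 \<le> Z \<omega>"
  using mgf_pos by (simp add: Z_def)

lemma Z_measurable [measurable]: "Z \<in> borel_measurable (F T)"
proof -
  have [measurable]: "L T \<in> borel_measurable (F T)" "good c 0 0 \<in> sets (F T)"
    using L_measurable_F[of T T] T_pos good_sets_F[of 0 0 c] grid_top[of 0] by auto
  show ?thesis unfolding Z_def[abs_def] by measurable
qed

lemma sets_Q [measurable_cong]: "sets Q = sets (F T)"
  by (simp add: Q_def sets_P_T)

lemma space_Q: "space Q = space P"
  by (simp add: Q_def space_P_T)

lemma nn_integral_Q:
  assumes f: "f \<in> borel_measurable (F T)"
  shows "(\<integral>\<^sup>+\<omega>. f \<omega> \<partial>Q) = (\<integral>\<^sup>+\<omega>. f \<omega> * ennreal (Z \<omega>) \<partial>P)"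
proof -
  have "(\<integral>\<^sup>+\<omega>. f \<omega> \<partial>Q) = (\<integral>\<^sup>+\<omega>. ennreal (Z \<omega>) * f \<omega> \<partial>P_T)"
    unfolding Q_def by (rule nn_integral_density) (use f Z_measurable in \<open>auto simp: borel_measurable_P_T\<close>)
  also have "\<dots> = (\<integral>\<^sup>+\<omega>. ennreal (Z \<omega>) * f \<omega> \<partial>P)"
    by (rule nn_integral_P_T) (use f Z_measurable in auto)
  finally show ?thesis by (simp add: mult.commute)
qed

text \<open>
  The contribution of cell \<open>i\<close> of level \<open>n\<close> to the unnormalised density.
\<close>

definition H :: "nat \<Rightarrow> nat \<Rightarrow> 'a \<Rightarrow> ennreal" where
  "H n i \<omega> = indicator (good c n i) \<omega> * ennreal (exp (u * incr n i \<omega>))"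

lemma Z_eq_prod:
  assumes "\<omega> \<in> space P"
  shows "ennreal (Z \<omega>) = ennreal (1 / m 0 u) * (\<Prod>i<2 ^ n. H n i \<omega>)"
proof -
  have "(\<Prod>i<2 ^ n. indicator (good c n i) \<omega> :: ennreal) = indicator (good c 0 0) \<omega>"
    unfolding good_whole_eq[of c n] by (auto simp: indicator_def prod_eq_1_iff)
  then have "(\<Prod>i<2 ^ n. H n i \<omega>) = indicator (good c 0 0) \<omega> * ennreal (exp (u * L T \<omega>))"
    unfolding H_def prod.distrib prod_ennreal_exp_incr[OF assms] by simp
  then show ?thesis
    using mgf_pos by (auto simp: Z_def indicator_def ennreal_mult'[symmetric])
qed

lemma H_measurable: "i < k \<Longrightarrow> k \<le> 2 ^ n \<Longrightarrow> H n i \<in> borel_measurable (F (grid n k))"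
proof -
  assume *: "i < k" "k \<le> 2 ^ n"
  then have i: "i < 2 ^ n" by simp
  have [measurable]: "incr n i \<in> borel_measurable (F (grid n (Suc i)))" "good c n i \<in> sets (F (grid n (Suc i)))"
    using incr_measurable_F[OF i] good_sets_F[OF i] by auto
  have "H n i \<in> borel_measurable (F (grid n (Suc i)))"
    unfolding H_def[abs_def] by measurable
  then show ?thesis by (rule measurable_F_mono) (use * in \<open>auto intro!: grid_mono grid_le_T\<close>)
qed

text \<open>
  The cells after time \<open>grid n k\<close> are independent of \<open>Y\<close> and integrate to a power of \<open>m n u\<close>.
\<close>

lemma nn_integral_Q_past:
  assumes Y: "Y \<in> borel_measurable (F (grid n k))" and k: "k \<le> 2 ^ n"
  shows "(\<integral>\<^sup>+\<omega>. Y \<omega> \<partial>Q) = ennreal (m n u ^ (2 ^ n - k) / m 0 u) * (\<integral>\<^sup>+\<omega>. Y \<omega> * (\<Prod>i<k. H n i \<omega>) \<partial>P)"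
proof -
  let ?A = "\<lambda>\<omega>. Y \<omega> * (\<Prod>i<k. H n i \<omega>)"
  let ?B = "\<lambda>\<omega>. \<Prod>i\<in>{k..<2 ^ n}. H n i \<omega>"
  have YT: "Y \<in> borel_measurable (F T)"
    using Y by (rule measurable_F_mono) (use k in \<open>auto intro!: grid_le_T\<close>)
  have [measurable]: "(\<lambda>\<omega>. \<Prod>i<k. H n i \<omega>) \<in> borel_measurable (F (grid n k))"
    using k by (intro borel_measurable_prod_ennreal H_measurable) auto
  have Gm: "?A \<in> borel_measurable (F (grid n k))"
    using Y by measurable
  have "(\<integral>\<^sup>+\<omega>. Y \<omega> \<partial>Q) = (\<integral>\<^sup>+\<omega>. Y \<omega> * ennreal (Z \<omega>) \<partial>P)"
    by (rule nn_integral_Q[OF YT])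
  also have "\<dots> = (\<integral>\<^sup>+\<omega>. ennreal (1 / m 0 u) * (?A \<omega> * ?B \<omega>) \<partial>P)"
  proof (rule nn_integral_cong)
    fix \<omega> assume \<omega>: "\<omega> \<in> space P"
    have 0: "{..<2 ^ n} = {..<k} \<union> {k..<2 ^ n}" using k by auto
    have 1: "(\<Prod>i<2 ^ n. H n i \<omega>) = (\<Prod>i<k. H n i \<omega>) * ?B \<omega>"
      unfolding 0 by (rule prod.union_disjoint) auto
    show "Y \<omega> * ennreal (Z \<omega>) = ennreal (1 / m 0 u) * (?A \<omega> * ?B \<omega>)"
      unfolding Z_eq_prod[OF \<omega>, of n] 1 by (simp only: mult_ac)
  qed
  also have "\<dots> = ennreal (1 / m 0 u) * (\<integral>\<^sup>+\<omega>. ?A \<omega> * ?B \<omega> \<partial>P)"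
  proof (rule nn_integral_cmult[OF borel_measurable_times_ennreal])
    show "?A \<in> borel_measurable P"
      by (rule measurable_F_P[OF grid_in[OF k] Gm])
    show "?B \<in> borel_measurable P"
      using measurable_F_P[OF T_in] H_measurable[of _ "2 ^ n" n] by (intro borel_measurable_prod_ennreal) auto
  qed
  also have "(\<integral>\<^sup>+\<omega>. ?A \<omega> * ?B \<omega> \<partial>P)
      = (\<integral>\<^sup>+\<omega>. ?A \<omega> \<partial>P) * ennreal (m n u) ^ (2 ^ n - k)"
    using nn_integral_cell_prod[OF _ Gm k order_refl, of "\<lambda>x. ennreal (exp (u * x))" c]
    unfolding nn_integral_cell_exp H_def by simp
  also have "ennreal (1 / m 0 u) * ((\<integral>\<^sup>+\<omega>. ?A \<omega> \<partial>P) * ennreal (m n u) ^ (2 ^ n - k))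
      = (ennreal (1 / m 0 u) * ennreal (m n u ^ (2 ^ n - k))) * (\<integral>\<^sup>+\<omega>. ?A \<omega> \<partial>P)"
    by (simp only: ennreal_power m_nonneg mult_ac)
  also have "ennreal (1 / m 0 u) * ennreal (m n u ^ (2 ^ n - k)) = ennreal (m n u ^ (2 ^ n - k) / m 0 u)"
    using mgf_pos m_nonneg by (simp add: ennreal_mult[symmetric])
  finally show ?thesis .
qed

text \<open>
  The cells before and after \<open>j\<close> contribute only the factor \<open>C\<close>: in law, the increment is the tilted
  cell law, independently of the past.
\<close>

lemma nn_integral_incr_Q:
  assumes B: "B \<in> sets (F (grid n j))" and j: "j < 2 ^ n"
  shows "\<exists>C<\<infinity>. \<forall>h\<in>borel_measurable borel. (\<integral>\<^sup>+\<omega>. indicator B \<omega> * h (incr n j \<omega>) \<partial>Q)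
           = C * (\<integral>\<^sup>+x. h x * ennreal (exp (u * x)) \<partial>cell_law c n)"
proof -
  define Y where "Y \<omega> = indicator B \<omega> * (\<Prod>i<j. H n i \<omega>)" for \<omega>
  have Ym: "Y \<in> borel_measurable (F (grid n j))"
  proof -
    have [measurable]: "(\<lambda>\<omega>. \<Prod>i<j. H n i \<omega>) \<in> borel_measurable (F (grid n j))"
      using j by (intro borel_measurable_prod_ennreal H_measurable) auto
    show ?thesis unfolding Y_def[abs_def] using B by measurable
  qed
  define C where "C = ennreal (m n u ^ (2 ^ n - Suc j) / m 0 u) * (\<integral>\<^sup>+\<omega>. Y \<omega> \<partial>P)"
  have "(\<integral>\<^sup>+\<omega>. Y \<omega> \<partial>P) \<le> (\<integral>\<^sup>+\<omega>. 1 * (\<Prod>i\<in>{0..<j}. H n i \<omega>) \<partial>P)"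
    by (intro nn_integral_mono) (auto simp: Y_def indicator_def atLeast0LessThan)
  also have "\<dots> = (\<integral>\<^sup>+\<omega>. 1 \<partial>P) * (\<integral>\<^sup>+x. ennreal (exp (u * x)) \<partial>cell_law c n) ^ (j - 0)"
    unfolding H_def by (rule nn_integral_cell_prod) (use j in auto)
  also have "\<dots> < \<infinity>"
    by (simp add: emeasure_space_1 nn_integral_cell_exp ennreal_power m_nonneg)
  finally have "C < \<infinity>"
    by (simp add: C_def ennreal_mult_less_top)
  moreover have "(\<integral>\<^sup>+\<omega>. indicator B \<omega> * h (incr n j \<omega>) \<partial>Q)
           = C * (\<integral>\<^sup>+x. h x * ennreal (exp (u * x)) \<partial>cell_law c n)"
    if h [measurable]: "h \<in> borel_measurable borel" for h
  proof -
    let ?hj = "\<lambda>\<omega>. indicator (good c n j) \<omega> * (h (incr n j \<omega>) * ennreal (exp (u * incr n j \<omega>)))"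
    have "B \<in> sets (F (grid n (Suc j)))"
      using B sets_F_mono[of "grid n j" "grid n (Suc j)"] grid_mono[of j "Suc j" n] grid_le_T[of "Suc j" n] j by auto
    moreover have "incr n j \<in> borel_measurable (F (grid n (Suc j)))" by (rule incr_measurable_F[OF j])
    ultimately have "(\<lambda>\<omega>. indicator B \<omega> * h (incr n j \<omega>)) \<in> borel_measurable (F (grid n (Suc j)))"
      by measurable
    then have "(\<integral>\<^sup>+\<omega>. indicator B \<omega> * h (incr n j \<omega>) \<partial>Q) = ennreal (m n u ^ (2 ^ n - Suc j) / m 0 u)
        * (\<integral>\<^sup>+\<omega>. (indicator B \<omega> * h (incr n j \<omega>)) * (\<Prod>i<Suc j. H n i \<omega>) \<partial>P)"
      using j by (intro nn_integral_Q_past) auto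
    also have "(\<integral>\<^sup>+\<omega>. (indicator B \<omega> * h (incr n j \<omega>)) * (\<Prod>i<Suc j. H n i \<omega>) \<partial>P) = (\<integral>\<^sup>+\<omega>. Y \<omega> * ?hj \<omega> \<partial>P)"
      by (intro nn_integral_cong) (simp only: Y_def H_def[of n j] prod.lessThan_Suc mult_ac)
    also have "\<dots> = (\<integral>\<^sup>+\<omega>. Y \<omega> \<partial>P) * (\<integral>\<^sup>+x. h x * ennreal (exp (u * x)) \<partial>cell_law c n)"
      using nn_integral_cell_prod[of "\<lambda>x. h x * ennreal (exp (u * x))" Y n j "Suc j" c] Ym j by simp
    finally show ?thesis by (simp only: C_def mult.assoc)
  qed
  ultimately show ?thesis by blast
qed

text \<open>
  The integral is, up to the normalisation, a product of \<open>2\<^sup>n\<close> values of the moment generating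
  function of a cell, whose power \<open>2\<^sup>n\<close> does not depend on \<open>n\<close>. This makes the bound uniform over all dyadic times.
\<close>

lemma exp_grid_Q_bound: "\<exists>D. \<forall>n. \<forall>j\<le>2 ^ n. (\<integral>\<^sup>+\<omega>. ennreal (exp (s * L (grid n j) \<omega>)) \<partial>Q) \<le> ennreal D"
proof -
  define D where "D = max 1 (m 0 u) / m 0 u * max 1 (m 0 (u + s))"
  have pw: "m n v ^ k \<le> max 1 (m 0 v)" if "k \<le> 2 ^ n" for n k v
  proof (cases "m n v \<le> 1")
    case True
    then show ?thesis using m_nonneg by (simp add: le_max_iff_disj power_le_one)
  next
    case False
    then have "m n v ^ k \<le> m n v ^ (2 ^ n)" using that by (intro power_increasing) auto
    then show ?thesis by (simp add: m_power)
  qed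
  have "(\<integral>\<^sup>+\<omega>. ennreal (exp (s * L (grid n j) \<omega>)) \<partial>Q) \<le> ennreal D" if j: "j \<le> 2 ^ n" for n j
  proof -
    let ?G = "\<lambda>i \<omega>. indicator (good c n i) \<omega> * ennreal (exp ((u + s) * incr n i \<omega>))"
    have "L (grid n j) \<in> borel_measurable (F (grid n j))"
      using grid_le_T[OF j] by (intro L_measurable_F) auto
    then have "(\<integral>\<^sup>+\<omega>. ennreal (exp (s * L (grid n j) \<omega>)) \<partial>Q) = ennreal (m n u ^ (2 ^ n - j) / m 0 u)
        * (\<integral>\<^sup>+\<omega>. ennreal (exp (s * L (grid n j) \<omega>)) * (\<Prod>i<j. H n i \<omega>) \<partial>P)"
      by (intro nn_integral_Q_past j) measurable
    also have "(\<integral>\<^sup>+\<omega>. ennreal (exp (s * L (grid n j) \<omega>)) * (\<Prod>i<j. H n i \<omega>) \<partial>P) = (\<integral>\<^sup>+\<omega>. 1 * (\<Prod>i\<in>{0..<j}. ?G i \<omega>) \<partial>P)"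
    proof (rule nn_integral_cong)
      fix \<omega> assume \<omega>: "\<omega> \<in> space P"
      have "ennreal (exp (s * L (grid n j) \<omega>)) * (\<Prod>i<j. H n i \<omega>)
          = (\<Prod>i<j. ennreal (exp (s * incr n i \<omega>)) * H n i \<omega>)"
        unfolding prod.distrib prod_ennreal_exp_incr[OF \<omega>] ..
      also have "\<dots> = (\<Prod>i<j. ?G i \<omega>)"
        by (intro prod.cong refl) (simp add: H_def distrib_right exp_add ennreal_mult mult_ac)
      finally show "ennreal (exp (s * L (grid n j) \<omega>)) * (\<Prod>i<j. H n i \<omega>) = 1 * (\<Prod>i\<in>{0..<j}. ?G i \<omega>)"
        unfolding atLeast0LessThan mult_1 .
    qed
    also have "\<dots> = ennreal (m n (u + s)) ^ j"
      using nn_integral_cell_prod[of "\<lambda>x. ennreal (exp ((u + s) * x))" "\<lambda>_. 1" n 0 j c] j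
      by (simp add: emeasure_space_1 nn_integral_cell_exp)
    also have "ennreal (m n u ^ (2 ^ n - j) / m 0 u) * ennreal (m n (u + s)) ^ j
        = ennreal (m n u ^ (2 ^ n - j) / m 0 u * m n (u + s) ^ j)"
      using mgf_pos m_nonneg by (simp add: ennreal_power ennreal_mult[symmetric])
    also have "\<dots> \<le> ennreal D"
      unfolding D_def using mgf_pos j m_nonneg by (intro ennreal_leI mult_mono divide_right_mono pw) auto
    finally show ?thesis .
  qed
  then show ?thesis by blast
qed

lemma second_moment_Q_bound: "\<exists>D. \<forall>n. \<forall>j\<le>2 ^ n. (\<integral>\<^sup>+\<omega>. ennreal ((L (grid n j) \<omega>)\<^sup>2) \<partial>Q) \<le> ennreal D"
proof -
  obtain D1 where D1: "\<And>n j. j \<le> 2 ^ n \<Longrightarrow> (\<integral>\<^sup>+\<omega>. ennreal (exp (1 * L (grid n j) \<omega>)) \<partial>Q) \<le> ennreal D1"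
    using exp_grid_Q_bound[of 1] by blast
  obtain D2 where D2: "\<And>n j. j \<le> 2 ^ n \<Longrightarrow> (\<integral>\<^sup>+\<omega>. ennreal (exp (- 1 * L (grid n j) \<omega>)) \<partial>Q) \<le> ennreal D2"
    using exp_grid_Q_bound[of "-1"] by blast
  have "(\<integral>\<^sup>+\<omega>. ennreal ((L (grid n j) \<omega>)\<^sup>2) \<partial>Q) \<le> ennreal (2 * max 0 D1 + 2 * max 0 D2)" if j: "j \<le> 2 ^ n" for n j
  proof -
    have [measurable]: "L (grid n j) \<in> borel_measurable (F T)"
      using grid_le_T[OF j] by (intro L_measurable_F) auto
    have sq: "x\<^sup>2 \<le> 2 * exp (1 * x) + 2 * exp (- 1 * x)" for x :: real
    proof -
      have "1 + \<bar>x\<bar> + \<bar>x\<bar>\<^sup>2 / 2 \<le> exp \<bar>x\<bar>" by (rule exp_lower_Taylor_quadratic) simp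
      then have "x\<^sup>2 \<le> 2 * exp \<bar>x\<bar>" by simp
      then show ?thesis using exp_abs_le_sum[of x] by simp
    qed
    have "(\<integral>\<^sup>+\<omega>. ennreal ((L (grid n j) \<omega>)\<^sup>2) \<partial>Q)
        \<le> (\<integral>\<^sup>+\<omega>. 2 * ennreal (exp (1 * L (grid n j) \<omega>)) + 2 * ennreal (exp (- 1 * L (grid n j) \<omega>)) \<partial>Q)"
    proof (rule nn_integral_mono)
      fix \<omega>
      have "ennreal ((L (grid n j) \<omega>)\<^sup>2) \<le> ennreal (2 * exp (1 * L (grid n j) \<omega>) + 2 * exp (- 1 * L (grid n j) \<omega>))"
        by (intro ennreal_leI sq)
      also have "\<dots> = 2 * ennreal (exp (1 * L (grid n j) \<omega>)) + 2 * ennreal (exp (- 1 * L (grid n j) \<omega>))"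
        by (simp add: ennreal_plus ennreal_mult)
      finally show "ennreal ((L (grid n j) \<omega>)\<^sup>2) \<le> 2 * ennreal (exp (1 * L (grid n j) \<omega>)) + 2 * ennreal (exp (- 1 * L (grid n j) \<omega>))" .
    qed
    also have "\<dots> = 2 * (\<integral>\<^sup>+\<omega>. ennreal (exp (1 * L (grid n j) \<omega>)) \<partial>Q) + 2 * (\<integral>\<^sup>+\<omega>. ennreal (exp (- 1 * L (grid n j) \<omega>)) \<partial>Q)"
      by (simp add: nn_integral_add nn_integral_cmult)
    also have "\<dots> \<le> 2 * ennreal (max 0 D1) + 2 * ennreal (max 0 D2)"
      using D1[OF j] D2[OF j] by (intro add_mono mult_left_mono) (auto simp: max_def ennreal_neg)
    also have "\<dots> = ennreal (2 * max 0 D1 + 2 * max 0 D2)" by (simp add: ennreal_plus ennreal_mult)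
    finally show ?thesis .
  qed
  then show ?thesis by blast
qed

text \<open>
  The integrals of the positive and the negative part over \<open>B\<close> are the same finite multiple of those
  under the tilted cell law, where they coincide.
\<close>

lemma incr_Q_mean_zero:
  assumes B: "B \<in> sets (F (grid n j))" and j: "j < 2 ^ n"
  shows "integrable Q (\<lambda>\<omega>. indicator B \<omega> * incr n j \<omega>) \<and> (\<integral>\<omega>. indicator B \<omega> * incr n j \<omega> \<partial>Q) = 0"
proof -
  obtain C where C: "C < \<infinity>" and eq: "\<And>h. h \<in> borel_measurable borel \<Longrightarrow> (\<integral>\<^sup>+\<omega>. indicator B \<omega> * h (incr n j \<omega>) \<partial>Q)
           = C * (\<integral>\<^sup>+x. h x * ennreal (exp (u * x)) \<partial>cell_law c n)"
    using nn_integral_incr_Q[OF B j] by blast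
  have int: "integrable (cell_law c n) (\<lambda>x. x * exp (u * x))"
    by (rule finite_exp_moments.mult_exp_integrable[OF cell_moments])
  let ?p = "\<integral>\<^sup>+x. ennreal (x * exp (u * x)) \<partial>cell_law c n"
  let ?q = "\<integral>\<^sup>+x. ennreal (- (x * exp (u * x))) \<partial>cell_law c n"
  have fin: "?p \<noteq> \<infinity>" "?q \<noteq> \<infinity>" using int by (auto elim: integrableE)
  have "enn2real ?p = enn2real ?q"
    using real_lebesgue_integral_def[OF int] cell_mean_zero by simp
  moreover have "?p = ennreal (enn2real ?p)" "?q = ennreal (enn2real ?q)"
    using fin by (simp_all add: less_top)
  ultimately have pq: "?p = ?q" by metis
  have [measurable]: "B \<in> sets (F T)" using B sets_F_mono[of "grid n j" T] grid_le_T[of j n] j by auto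
  have [measurable]: "incr n j \<in> borel_measurable (F T)"
    using incr_measurable_F[OF j] by (rule measurable_F_mono) (use j in \<open>auto intro!: grid_le_T\<close>)
  have p: "(\<integral>\<^sup>+\<omega>. ennreal (indicator B \<omega> * incr n j \<omega>) \<partial>Q) = C * ?p"
  proof -
    have "(\<integral>\<^sup>+\<omega>. ennreal (indicator B \<omega> * incr n j \<omega>) \<partial>Q) = (\<integral>\<^sup>+\<omega>. indicator B \<omega> * ennreal (incr n j \<omega>) \<partial>Q)"
      by (intro nn_integral_cong) (auto simp: indicator_def)
    also have "\<dots> = C * (\<integral>\<^sup>+x. ennreal x * ennreal (exp (u * x)) \<partial>cell_law c n)"
      by (rule eq) simp
    finally show ?thesis by (simp add: ennreal_mult''[symmetric])
  qed
  have q: "(\<integral>\<^sup>+\<omega>. ennreal (- (indicator B \<omega> * incr n j \<omega>)) \<partial>Q) = C * ?q"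
  proof -
    have "(\<integral>\<^sup>+\<omega>. ennreal (- (indicator B \<omega> * incr n j \<omega>)) \<partial>Q) = (\<integral>\<^sup>+\<omega>. indicator B \<omega> * ennreal (- incr n j \<omega>) \<partial>Q)"
      by (intro nn_integral_cong) (auto simp: indicator_def)
    also have "\<dots> = C * (\<integral>\<^sup>+x. ennreal (- x) * ennreal (exp (u * x)) \<partial>cell_law c n)"
      by (rule eq) simp
    finally show ?thesis by (simp add: ennreal_mult''[symmetric])
  qed
  have int_Q: "integrable Q (\<lambda>\<omega>. indicator B \<omega> * incr n j \<omega>)"
    unfolding real_integrable_def p q using C fin by (auto simp: ennreal_mult_eq_top_iff)
  have "(\<integral>\<omega>. indicator B \<omega> * incr n j \<omega> \<partial>Q) = enn2real (C * ?p) - enn2real (C * ?q)"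
    unfolding real_lebesgue_integral_def[OF int_Q] p q ..
  then show ?thesis using int_Q unfolding pq by (intro conjI) (simp_all only: diff_self)
qed

lemma prob_space_Q: "prob_space Q"
proof
  have "emeasure Q (space Q) = (\<integral>\<^sup>+\<omega>. 1 \<partial>Q)" by simp
  also have "\<dots> = (\<integral>\<^sup>+\<omega>. 1 * ennreal (Z \<omega>) \<partial>P)" by (rule nn_integral_Q) simp
  also have "\<dots> = (\<integral>\<^sup>+\<omega>. ennreal (1 / m 0 u) * (indicator (good c 0 0) \<omega> * ennreal (exp (u * L T \<omega>))) \<partial>P)"
    using mgf_pos by (intro nn_integral_cong) (auto simp: Z_def indicator_def ennreal_mult'[symmetric])
  also have "\<dots> = ennreal (1 / m 0 u) * (\<integral>\<^sup>+x. ennreal (exp (u * x)) \<partial>cell_law c 0)"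
  proof -
    have [measurable]: "L T \<in> borel_measurable P" "good c 0 0 \<in> sets P"
      using L_measurable[OF T_in] good_sets[of 0 0] by auto
    show ?thesis by (subst nn_integral_cmult) (auto simp: nn_integral_cell_law)
  qed
  also have "\<dots> = 1"
    using mgf_pos by (simp add: nn_integral_cell_exp flip: ennreal_mult)
  finally show "emeasure Q (space Q) = 1" .
qed

lemma grid_Q_martingale:
  assumes B: "B \<in> sets (F (grid n k))" and k: "k \<le> 2 ^ n"
  shows "integrable Q (L (grid n k)) \<and> (\<integral>\<omega>. indicator B \<omega> * L T \<omega> \<partial>Q) = (\<integral>\<omega>. indicator B \<omega> * L (grid n k) \<omega> \<partial>Q)"
proof -
  have incr_int: "integrable Q (incr n i)" if i: "i < 2 ^ n" for i
  proof -
    have "space P \<in> sets (F (grid n i))" using sets.top[of "F (grid n i)"] space_F[OF grid_in[of i n]] i by simp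
    then have "integrable Q (\<lambda>\<omega>. indicator (space P) \<omega> * incr n i \<omega>)" using incr_Q_mean_zero i by blast
    then show ?thesis by (rule Bochner_Integration.integrable_cong[THEN iffD1, rotated -1]) (auto simp: space_Q)
  qed
  have L_int: "integrable Q (L (grid n j))" if j: "j \<le> 2 ^ n" for j
  proof -
    have "integrable Q (\<lambda>\<omega>. \<Sum>i<j. incr n i \<omega>)" using j by (intro Bochner_Integration.integrable_sum incr_int) simp
    then show ?thesis by (rule Bochner_Integration.integrable_cong[THEN iffD1, rotated -1]) (auto simp: space_Q sum_incr)
  qed
  have BQ: "B \<in> sets Q"
    using B sets_F_mono[of "grid n k" T] grid_le_T[OF k] by (auto simp: sets_Q)
  have iB: "integrable Q (\<lambda>\<omega>. indicator B \<omega> * f \<omega>)" if "integrable Q f" for f :: "'a \<Rightarrow> real"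
    using integrable_real_mult_indicator[OF BQ that] by (simp only: mult.commute)
  have z: "integrable Q (\<lambda>\<omega>. indicator B \<omega> * incr n i \<omega>) \<and> (\<integral>\<omega>. indicator B \<omega> * incr n i \<omega> \<partial>Q) = 0" if "i \<in> {k..<2 ^ n}" for i
  proof (rule incr_Q_mean_zero)
    have "sets (F (grid n k)) \<subseteq> sets (F (grid n i))"
      using that by (intro sets_F_mono grid_mono grid_le_T) auto
    then show "B \<in> sets (F (grid n i))" using B by blast
  qed (use that in simp)
  have "(\<integral>\<omega>. indicator B \<omega> * L T \<omega> \<partial>Q) - (\<integral>\<omega>. indicator B \<omega> * L (grid n k) \<omega> \<partial>Q)
      = (\<integral>\<omega>. indicator B \<omega> * L T \<omega> - indicator B \<omega> * L (grid n k) \<omega> \<partial>Q)"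
    using iB[OF L_int[OF k]] iB[OF L_int[of "2 ^ n"]] by simp
  also have "\<dots> = (\<integral>\<omega>. (\<Sum>i\<in>{k..<2 ^ n}. indicator B \<omega> * incr n i \<omega>) \<partial>Q)"
  proof (rule Bochner_Integration.integral_cong[OF refl])
    fix \<omega>
    have "(\<Sum>i\<in>{k..<2 ^ n}. incr n i \<omega>) = L (grid n (2 ^ n)) \<omega> - L (grid n k) \<omega>"
      unfolding incr_def using k by (rule sum_Suc_diff')
    then show "indicator B \<omega> * L T \<omega> - indicator B \<omega> * L (grid n k) \<omega> = (\<Sum>i\<in>{k..<2 ^ n}. indicator B \<omega> * incr n i \<omega>)"
      by (simp add: sum_distrib_left[symmetric] right_diff_distrib)
  qed
  also have "\<dots> = (\<Sum>i\<in>{k..<2 ^ n}. \<integral>\<omega>. indicator B \<omega> * incr n i \<omega> \<partial>Q)"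
    using z by (intro Bochner_Integration.integral_sum) auto
  also have "\<dots> = 0" using z by (intro sum.neutral) auto
  finally show ?thesis using L_int[OF k] by simp
qed

text \<open>
  Dyadic times decreasing to \<open>s\<close> carry the martingale property at dyadic times over to \<open>s\<close>: paths are
  right continuous, \<open>B\<close> belongs to the \<open>\<sigma>\<close>-algebras of all later times, and the second moments are
  uniformly bounded.
\<close>

lemma Q_martingale_terminal:
  assumes s: "s \<in> {0..T}" and B: "B \<in> sets (F s)"
  shows "integrable Q (\<lambda>\<omega>. indicator B \<omega> * L s \<omega>) \<and> (\<integral>\<omega>. indicator B \<omega> * L T \<omega> \<partial>Q) = (\<integral>\<omega>. indicator B \<omega> * L s \<omega> \<partial>Q)"
proof -
  obtain D where D: "\<And>n j. j \<le> 2 ^ n \<Longrightarrow> (\<integral>\<^sup>+\<omega>. ennreal ((L (grid n j) \<omega>)\<^sup>2) \<partial>Q) \<le> ennreal D"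
    using second_moment_Q_bound by blast
  let ?t = "\<lambda>n. grid n (up n s)"
  have t: "0 \<le> ?t n" "s \<le> ?t n" "?t n \<le> T" for n
    using s grid_up_ge[of s n] grid_le_T[OF up_le[of s n]] by auto
  have Bt: "B \<in> sets (F (?t n))" "B \<in> sets (F T)" for n
    using B sets_F_mono[of s "?t n"] sets_F_mono[of s T] s t[of n] by auto
  interpret Q: prob_space Q by (rule prob_space_Q)
  have [measurable]: "B \<in> sets (F T)" "L s \<in> borel_measurable (F T)" "L (?t n) \<in> borel_measurable (F T)" for n
    using Bt s t[of n] by (auto intro!: L_measurable_F)
  have lim: "integrable Q (\<lambda>\<omega>. indicator B \<omega> * L s \<omega>) \<and>
      (\<lambda>n. \<integral>\<omega>. indicator B \<omega> * L (?t n) \<omega> \<partial>Q) \<longlonglongrightarrow> (\<integral>\<omega>. indicator B \<omega> * L s \<omega> \<partial>Q)"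
  proof (rule L2_bounded_tendsto)
    show "AE \<omega> in Q. (\<lambda>n. indicator B \<omega> * L (?t n) \<omega>) \<longlonglongrightarrow> indicator B \<omega> * L s \<omega>"
      using L_grid_up_tendsto[of _ s] s by (intro AE_I2 tendsto_mult_left) (auto simp: space_Q)
    fix n
    have "(\<integral>\<^sup>+\<omega>. ennreal ((indicator B \<omega> * L (?t n) \<omega>)\<^sup>2) \<partial>Q) \<le> (\<integral>\<^sup>+\<omega>. ennreal ((L (?t n) \<omega>)\<^sup>2) \<partial>Q)"
      by (intro nn_integral_mono ennreal_leI) (auto simp: indicator_def)
    also have "\<dots> \<le> ennreal D" using s by (intro D up_le) simp
    finally show "(\<integral>\<^sup>+\<omega>. ennreal ((indicator B \<omega> * L (?t n) \<omega>)\<^sup>2) \<partial>Q) \<le> ennreal D" .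
  qed (rule Q.finite_measure_axioms, measurable, measurable)
  have "(\<integral>\<omega>. indicator B \<omega> * L (?t n) \<omega> \<partial>Q) = (\<integral>\<omega>. indicator B \<omega> * L T \<omega> \<partial>Q)" for n
    using grid_Q_martingale[OF Bt(1), of n] up_le[of s n] s by simp
  then show ?thesis using lim by (simp add: LIMSEQ_const_iff)
qed

lemma subalgebra_Q: "t \<in> {0..T} \<Longrightarrow> subalgebra Q (F t)"
  using sets_F_mono[of t T] space_F[of t] by (auto simp: subalgebra_def sets_Q space_Q)

lemma martingale_Q: "martingale_on T F Q L"
proof -
  interpret Q: prob_space Q by (rule prob_space_Q)
  have int: "integrable Q (L t)" if t: "t \<in> {0..T}" for t
  proof -
    have "integrable Q (\<lambda>\<omega>. indicator (space P) \<omega> * L t \<omega>)"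
      using Q_martingale_terminal[OF t, of "space P"] sets.top[of "F t"] space_F[OF t] by simp
    then show ?thesis by (rule Bochner_Integration.integrable_cong[THEN iffD1, rotated -1]) (auto simp: space_Q)
  qed
  have "AE \<omega> in Q. real_cond_exp Q (F s) (L t) \<omega> = L s \<omega>" if st: "s \<in> {0..T}" "t \<in> {0..T}" "s \<le> t" for s t
  proof -
    interpret fs: finite_measure_subalgebra Q "F s"
      by unfold_locales (rule subalgebra_Q[OF st(1)])
    show ?thesis
    proof (rule fs.real_cond_exp_charact)
      fix B assume B: "B \<in> sets (F s)"
      then have Bt: "B \<in> sets (F t)" using sets_F_mono[of s t] st by auto
      show "(\<integral>\<omega>\<in>B. L t \<omega> \<partial>Q) = (\<integral>\<omega>\<in>B. L s \<omega> \<partial>Q)"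
        using Q_martingale_terminal[OF st(1) B] Q_martingale_terminal[OF st(2) Bt]
        by (simp add: set_lebesgue_integral_def)
    qed (use int st L_measurable_F in auto)
  qed
  then show ?thesis
    using int L_measurable_F by (auto simp: martingale_on_def adapted_on_def)
qed

lemma integral_cell_law_0:
  fixes h :: "real \<Rightarrow> real"
  assumes h [measurable]: "h \<in> borel_measurable borel"
  shows "integrable (cell_law c 0) h \<longleftrightarrow> integrable P (\<lambda>\<omega>. indicator (good c 0 0) \<omega> * h (L T \<omega>))"
    and "(\<integral>x. h x \<partial>cell_law c 0) = (\<integral>\<omega>. indicator (good c 0 0) \<omega> * h (L T \<omega>) \<partial>P)"
proof -
  have [measurable]: "incr 0 0 \<in> borel_measurable P" "good c 0 0 \<in> sets P"
    using incr_measurable[of 0 0] good_sets[of 0 0] by auto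
  have d: "density P (indicator (good c 0 0)) = density P (\<lambda>\<omega>. ennreal (indicator (good c 0 0) \<omega>))"
    by (simp add: ennreal_indicator)
  have "integrable (cell_law c 0) h \<longleftrightarrow> integrable P (\<lambda>\<omega>. indicator (good c 0 0) \<omega> * h (incr 0 0 \<omega>))"
    unfolding cell_law_def d by (subst integrable_distr_eq) (auto simp: integrable_density)
  also have "\<dots> \<longleftrightarrow> integrable P (\<lambda>\<omega>. indicator (good c 0 0) \<omega> * h (L T \<omega>))"
    by (intro Bochner_Integration.integrable_cong refl) (simp add: incr_whole)
  finally show "integrable (cell_law c 0) h \<longleftrightarrow> integrable P (\<lambda>\<omega>. indicator (good c 0 0) \<omega> * h (L T \<omega>))" .
  have "(\<integral>x. h x \<partial>cell_law c 0) = (\<integral>\<omega>. indicator (good c 0 0) \<omega> * h (incr 0 0 \<omega>) \<partial>P)"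
    unfolding cell_law_def d by (subst integral_distr) (auto simp: integral_density)
  also have "\<dots> = (\<integral>\<omega>. indicator (good c 0 0) \<omega> * h (L T \<omega>) \<partial>P)"
    by (intro Bochner_Integration.integral_cong refl) (simp add: incr_whole)
  finally show "(\<integral>x. h x \<partial>cell_law c 0) = (\<integral>\<omega>. indicator (good c 0 0) \<omega> * h (L T \<omega>) \<partial>P)" .
qed

lemma restr_Q: "restr_to_subalg Q (F T) = Q"
  by (intro measure_eqI)
     (auto simp: sets_restr_to_subalg[OF subalgebra_Q[OF T_in]] emeasure_restr_to_subalg[OF subalgebra_Q[OF T_in]] sets_Q)

text \<open>
  On the good event the log-density is \<open>u L\<^sub>T - ln (m 0 u)\<close>, and \<open>L\<^sub>T\<close> has mean zero under \<open>Q\<close>.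
\<close>

lemma entropy_Q: "entropy_at T F Q P = ereal (- ln (m 0 u))"
proof -
  let ?G = "\<lambda>\<omega>. indicator (good c 0 0) \<omega> :: real"
  interpret R: prob_space P_T by (rule prob_space_P_T)
  define g where "g \<omega> = u / m 0 u * (?G \<omega> * (L T \<omega> * exp (u * L T \<omega>))) - ln (m 0 u) / m 0 u * (?G \<omega> * exp (u * L T \<omega>))" for \<omega>
  have eq: "Z \<omega> * ln (Z \<omega>) = g \<omega>" for \<omega>
    using mgf_pos by (auto simp: Z_def g_def indicator_def ln_div field_simps)
  have i1: "integrable P (\<lambda>\<omega>. ?G \<omega> * (L T \<omega> * exp (u * L T \<omega>)))"
    using integral_cell_law_0(1)[of "\<lambda>x. x * exp (u * x)"] finite_exp_moments.mult_exp_integrable[OF cell_moments] by simp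
  have i2: "integrable P (\<lambda>\<omega>. ?G \<omega> * exp (u * L T \<omega>))"
    using integral_cell_law_0(1)[of "\<lambda>x. exp (u * x)"] finite_exp_moments.exp_integrable[OF cell_moments] by simp
  have v1: "(\<integral>\<omega>. ?G \<omega> * (L T \<omega> * exp (u * L T \<omega>)) \<partial>P) = 0"
    using integral_cell_law_0(2)[of "\<lambda>x. x * exp (u * x)"] cell_mean_zero by simp
  have v2: "(\<integral>\<omega>. ?G \<omega> * exp (u * L T \<omega>) \<partial>P) = m 0 u"
    using integral_cell_law_0(2)[of "\<lambda>x. exp (u * x)"] by (simp add: mgf_def)
  have gint: "integrable P g" unfolding g_def[abs_def] using i1 i2 by simp
  have gm: "g \<in> borel_measurable (F T)"
    using borel_measurable_times[OF Z_measurable borel_measurable_ln[OF Z_measurable]] by (simp add: eq)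
  have "(\<integral>\<omega>. g \<omega> \<partial>P_T) = (\<integral>\<omega>. g \<omega> \<partial>P)"
    by (rule integral_subalgebra2[OF subalg[OF T_in] gm])
  also have "\<dots> = - ln (m 0 u)"
    unfolding g_def[abs_def] using i1 i2 mgf_pos by (simp add: v1 v2)
  finally have val: "(\<integral>\<omega>. Z \<omega> * ln (Z \<omega>) \<partial>P_T) = - ln (m 0 u)" by (simp add: eq)
  have "integrable P_T (\<lambda>\<omega>. Z \<omega> * ln (Z \<omega>))"
    unfolding eq by (rule integrable_in_subalg[OF subalg[OF T_in] gm gint])
  then have "relative_entropy (density P_T (\<lambda>\<omega>. ennreal (Z \<omega>))) P_T = ereal (\<integral>\<omega>. Z \<omega> * ln (Z \<omega>) \<partial>P_T)"
    using Z_measurable Z_nonneg by (intro relative_entropy_density R.sigma_finite_measure_axioms) (auto simp: borel_measurable_P_T)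
  then show ?thesis unfolding entropy_at_def restr_Q val by (simp add: Q_def)
qed

lemma Q_in_M_a: "Q \<in> M_a P T F L"
proof -
  have "absolutely_continuous P_T Q"
    unfolding Q_def using Z_measurable by (intro absolutely_continuousI_density) (simp add: borel_measurable_P_T)
  then show ?thesis
    using prob_space_Q martingale_Q by (simp add: M_a_def ac_measures_def sets_Q)
qed

end

section \<open>The Gibbs variational inequality\<close>

text \<open>
  Young's inequality \<open>z ln z - z y - z + exp y \<ge> 0\<close> is integrated with \<open>z\<close> the density of \<open>Q\<close> and
  \<open>y = Y\<close>. Since \<open>z ln z \<ge> - 1\<close>, the entropy is well defined, and only the case of infinite positive
  part has to be treated apart.
\<close>

lemma Gibbs_variational_inequality:
  assumes R: "prob_space R" and Q: "prob_space Q" and sets: "sets Q = sets R"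
    and ac: "absolutely_continuous R Q"
    and Y: "integrable Q Y" and exp_Y: "(\<integral>\<^sup>+x. ennreal (exp (Y x)) \<partial>R) \<le> 1"
  shows "ereal (\<integral>x. Y x \<partial>Q) \<le> relative_entropy Q R"
proof -
  interpret R: prob_space R by fact
  interpret Q: prob_space Q by fact
  define Z where "Z x = enn2real (RN_deriv R Q x)" for x
  have Zm [measurable]: "Z \<in> borel_measurable R" unfolding Z_def by measurable
  have Z0: "0 \<le> Z x" for x by (simp add: Z_def)
  have Ym [measurable]: "Y \<in> borel_measurable R"
    using Y measurable_cong_sets[OF sets refl, of borel] by auto
  have "AE x in R. RN_deriv R Q x \<noteq> \<infinity>"
    by (rule R.RN_deriv_finite[OF Q.sigma_finite_measure_axioms ac sets])
  then have "AE x in R. RN_deriv R Q x = ennreal (Z x)"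
    by (elim AE_mp, intro AE_I2 impI) (simp add: Z_def less_top)
  then have Qd: "Q = density R (\<lambda>x. ennreal (Z x))"
    using R.density_RN_deriv[OF ac sets] density_cong[of "RN_deriv R Q" R "\<lambda>x. ennreal (Z x)"] by simp
  let ?p = "\<integral>\<^sup>+x. ennreal (Z x * ln (Z x)) \<partial>R"
  let ?q = "\<integral>\<^sup>+x. ennreal (- (Z x * ln (Z x))) \<partial>R"
  have re: "relative_entropy Q R = enn2ereal ?p - enn2ereal ?q"
    using ac by (simp add: relative_entropy_def Let_def Z_def)
  have q: "?q < \<infinity>"
  proof -
    have pt: "- (z * ln z) \<le> 1" if z: "0 \<le> z" for z :: real
    proof (cases "z = 0")
      case False
      then have "ln (1 / z) \<le> 1 / z - 1" using z by (intro ln_le_minus_one) simp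
      then have "z * ln (1 / z) \<le> z * (1 / z - 1)" using z by (rule mult_left_mono)
      then show ?thesis using z False by (simp add: ln_div right_diff_distrib)
    qed simp
    have "?q \<le> (\<integral>\<^sup>+x. ennreal 1 \<partial>R)"
      by (intro nn_integral_mono ennreal_leI pt Z0)
    also have "\<dots> < \<infinity>" by (simp add: R.emeasure_space_1)
    finally show ?thesis .
  qed
  show ?thesis
  proof (cases "?p = \<infinity>")
    case True
    obtain b where "?q = ennreal b" "b \<ge> 0" using q by (metis ennreal_cases infinity_ennreal_def less_irrefl)
    then show ?thesis unfolding re True by (simp add: top_ereal_def)
  next
    case False
    have iZ: "integrable R (\<lambda>x. Z x * ln (Z x))"
      using False q by (intro real_integrable_def[THEN iffD2] conjI) (auto simp: less_top)
    have iZ1: "integrable R Z" and Z1: "(\<integral>x. Z x \<partial>R) = 1"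
    proof -
      have "(\<integral>\<^sup>+x. ennreal (Z x) \<partial>R) = emeasure (density R (\<lambda>x. ennreal (Z x))) (space R)"
        by (simp add: emeasure_density cong: nn_integral_cong)
      also have "\<dots> = 1" using Q.emeasure_space_1 sets_eq_imp_space_eq[OF sets] Qd by simp
      finally have e: "(\<integral>\<^sup>+x. ennreal (Z x) \<partial>R) = 1" .
      then show "integrable R Z" by (intro integrableI_nonneg) (auto simp: Z0)
      then show "(\<integral>x. Z x \<partial>R) = 1" using e by (simp add: nn_integral_eq_integral Z0)
    qed
    have iE: "integrable R (\<lambda>x. exp (Y x))"
      using exp_Y by (intro integrableI_nonneg) (auto simp: order_le_less_trans)
    have E1: "(\<integral>x. exp (Y x) \<partial>R) \<le> 1"
      using exp_Y nn_integral_eq_integral[OF iE] by simp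
    have iZY: "integrable R (\<lambda>x. Z x * Y x)"
      using Y unfolding Qd by (simp add: integrable_density Z0)
    have YQ: "(\<integral>x. Y x \<partial>Q) = (\<integral>x. Z x * Y x \<partial>R)"
      unfolding Qd by (simp add: integral_density Z0)
    have "0 \<le> (\<integral>x. (Z x * ln (Z x) - Z x * Y x - Z x) + exp (Y x) \<partial>R)"
    proof (rule Bochner_Integration.integral_nonneg)
      fix x
      show "0 \<le> (Z x * ln (Z x) - Z x * Y x - Z x) + exp (Y x)"
      proof (cases "Z x = 0")
        case False
        then have z: "Z x > 0" using Z0[of x] by simp
        have "ln (exp (Y x) / Z x) \<le> exp (Y x) / Z x - 1"
          using z by (intro ln_le_minus_one) simp
        then have "Y x - ln (Z x) \<le> exp (Y x) / Z x - 1" using z by (simp add: ln_div)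
        then have "Z x * (Y x - ln (Z x)) \<le> Z x * (exp (Y x) / Z x - 1)"
          using z by (intro mult_left_mono) auto
        also have "\<dots> = exp (Y x) - Z x" using z by (simp add: right_diff_distrib)
        finally show ?thesis by (simp add: algebra_simps)
      qed simp
    qed
    also have "\<dots> = (\<integral>x. Z x * ln (Z x) \<partial>R) - (\<integral>x. Z x * Y x \<partial>R) - 1 + (\<integral>x. exp (Y x) \<partial>R)"
      using iZ iZ1 iE iZY by (simp add: Z1)
    finally have "(\<integral>x. Y x \<partial>Q) \<le> (\<integral>x. Z x * ln (Z x) \<partial>R)" using E1 YQ by simp
    moreover have "relative_entropy Q R = ereal (\<integral>x. Z x * ln (Z x) \<partial>R)"
      using relative_entropy_density[OF R.sigma_finite_measure_axioms Zm Z0 iZ] Qd by simp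
    ultimately show ?thesis by simp
  qed
qed

section \<open>Bounded and monotone paths\<close>

text \<open>
  One-sided limits make \<open>f\<close> bounded near every point; Bolzano's bisection principle turns the local
  bounds into a global one.
\<close>

lemma cadlag_on_bounded:
  assumes "cadlag_on T f" and T: "0 < T"
  shows "\<exists>C. \<forall>t\<in>{0..T}. \<bar>f t\<bar> \<le> C"
proof -
  define D where "D = {0..T}"
  have "\<exists>C. \<forall>t\<in>{0..T} \<inter> D. \<bar>f t\<bar> \<le> C"
    using less_imp_le[OF T]
  proof (induction rule: Bolzano)
    case (trans a b c)
    then obtain C1 C2 where C: "\<forall>t\<in>{a..b} \<inter> D. \<bar>f t\<bar> \<le> C1" "\<forall>t\<in>{b..c} \<inter> D. \<bar>f t\<bar> \<le> C2" by blast
    have "\<bar>f t\<bar> \<le> max C1 C2" if "t \<in> {a..c} \<inter> D" for t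
      using C that by (cases "t \<le> b") (auto simp: le_max_iff_disj)
    then show ?case by (intro exI[of _ "max C1 C2"] ballI)
  next
    case (local x)
    have bdd: "\<exists>K. eventually (\<lambda>y. \<bar>f y\<bar> \<le> K) G" if "(f \<longlongrightarrow> l) G" for l and G :: "real filter"
    proof -
      have "eventually (\<lambda>y. dist (f y) l < 1) G" using that by (rule tendstoD) simp
      moreover have "\<bar>y\<bar> \<le> \<bar>l\<bar> + 1" if "dist y l < 1" for y
        using that unfolding dist_real_def by linarith
      ultimately have "eventually (\<lambda>y. \<bar>f y\<bar> \<le> \<bar>l\<bar> + 1) G"
        by (rule eventually_mono)
      then show ?thesis by blast
    qed
    have "\<exists>d>0. \<exists>K. \<forall>y\<in>D. x < y \<and> y < x + d \<longrightarrow> \<bar>f y\<bar> \<le> K"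
    proof (cases "x < T")
      case True
      then have "(f \<longlongrightarrow> f x) (at_right x)" using assms(1) local by (simp add: cadlag_on_def)
      then obtain K where "eventually (\<lambda>y. \<bar>f y\<bar> \<le> K) (at_right x)" using bdd by blast
      then obtain b where "b > x" "\<And>y. x < y \<Longrightarrow> y < b \<Longrightarrow> \<bar>f y\<bar> \<le> K"
        unfolding eventually_at_right_field by blast
      then show ?thesis by (intro exI[of _ "b - x"]) auto
    next
      case False
      then show ?thesis using local by (intro exI[of _ 1]) (auto simp: D_def)
    qed
    then obtain d1 K1 where d1: "d1 > 0" "\<And>y. y \<in> D \<Longrightarrow> x < y \<Longrightarrow> y < x + d1 \<Longrightarrow> \<bar>f y\<bar> \<le> K1" by blast
    have "\<exists>d>0. \<exists>K. \<forall>y\<in>D. y < x \<and> x - d < y \<longrightarrow> \<bar>f y\<bar> \<le> K"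
    proof (cases "0 < x")
      case True
      then obtain l where "(f \<longlongrightarrow> l) (at_left x)" using assms(1) local unfolding cadlag_on_def by fastforce
      then obtain K where "eventually (\<lambda>y. \<bar>f y\<bar> \<le> K) (at_left x)" using bdd by blast
      then obtain b where "b < x" "\<And>y. b < y \<Longrightarrow> y < x \<Longrightarrow> \<bar>f y\<bar> \<le> K"
        unfolding eventually_at_left_field by blast
      then show ?thesis by (intro exI[of _ "x - b"]) auto
    next
      case False
      then show ?thesis using local by (intro exI[of _ 1]) (auto simp: D_def)
    qed
    then obtain d2 K2 where d2: "d2 > 0" "\<And>y. y \<in> D \<Longrightarrow> y < x \<Longrightarrow> x - d2 < y \<Longrightarrow> \<bar>f y\<bar> \<le> K2" by blast
    show ?case
    proof (rule exI[of _ "min d1 d2"], intro conjI allI impI)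
      fix a b assume ab: "a \<le> x \<and> x \<le> b \<and> b - a < min d1 d2"
      have "\<bar>f y\<bar> \<le> max \<bar>f x\<bar> (max K1 K2)" if y: "y \<in> {a..b} \<inter> D" for y
      proof -
        consider "y = x" | "x < y" | "y < x" by linarith
        then show ?thesis
        proof cases
          case 2
          then show ?thesis using d1(2)[of y] y ab by (auto simp: le_max_iff_disj)
        next
          case 3
          then show ?thesis using d2(2)[of y] y ab by (auto simp: le_max_iff_disj)
        qed simp
      qed
      then show "\<exists>C. \<forall>t\<in>{a..b} \<inter> D. \<bar>f t\<bar> \<le> C" by blast
    qed (use d1 d2 in simp)
  qed
  then show ?thesis by (simp add: D_def)
qed

context levy_basis
begin

lemma good_mono: "c \<le> c' \<Longrightarrow> good c 0 0 \<subseteq> good c' 0 0"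
  unfolding good_def by (auto intro: order_trans)

lemma UN_good: "(\<Union>n. good (real n) 0 0) = space P"
proof (intro equalityI subsetI)
  fix \<omega> assume "\<omega> \<in> space P"
  then obtain C where C: "\<And>t. t \<in> {0..T} \<Longrightarrow> \<bar>L t \<omega>\<bar> \<le> C"
    using cadlag_on_bounded[OF L_cadlag T_pos] by blast
  obtain n :: nat where n: "2 * C \<le> real n" using real_arch_simple by blast
  have "\<bar>incr N r \<omega>\<bar> \<le> real n" if "r < 2 ^ N" for N r
    using C[OF grid_in[of r N]] C[OF grid_in[of "Suc r" N]] that n by (simp add: incr_def)
  then have "\<omega> \<in> good (real n) 0 0" using \<open>\<omega> \<in> space P\<close> by (simp add: good_def)
  then show "\<omega> \<in> (\<Union>n. good (real n) 0 0)" by blast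
qed (auto simp: good_def)

lemma up_mono: "s \<le> t \<Longrightarrow> up n s \<le> up n t"
  unfolding up_le_iff by (rule order_trans[OF _ grid_up_ge])

text \<open>
  If one dyadic increment were negative with positive probability, then, by independence and
  stationarity, all increments of that level would be negative simultaneously with positive
  probability, and \<open>L\<^sub>T\<close> would be negative. So dyadic increments are almost surely nonnegative, and
  right continuity extends monotonicity to all times.
\<close>

lemma AE_mono_of_terminal_nonneg:
  assumes nonneg: "AE \<omega> in P. 0 \<le> L T \<omega>"
  shows "AE \<omega> in P. mono_on {0..T} (\<lambda>t. L t \<omega>)"
proof -
  have "AE \<omega> in P. 0 \<le> incr n k \<omega>" if k: "k < 2 ^ n" for n k
  proof -
    let ?p = "emeasure (incr_law n) {..<0}"
    have sp: "space P \<in> sets (F (grid n j))" if "j \<le> 2 ^ n" for j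
      using sets.top[of "F (grid n j)"] space_F[OF grid_in[OF that]] by simp
    have eq: "emeasure P {\<omega>\<in>space P. \<forall>r<2 ^ n. incr n (0 + r) \<omega> \<in> {..<0}} = emeasure P (space P) * (\<Prod>r<(2::nat) ^ n. ?p)"
      by (rule conjunct1[OF incr_box]) (use sp[of 0] in auto)
    have LTm [measurable]: "L T \<in> borel_measurable P" by (rule L_measurable[OF T_in])
    have "emeasure P {\<omega>\<in>space P. \<forall>r<2 ^ n. incr n (0 + r) \<omega> \<in> {..<0}} \<le> emeasure P {\<omega>\<in>space P. L T \<omega> < 0}"
    proof (rule emeasure_mono)
      show "{\<omega>\<in>space P. \<forall>r<2 ^ n. incr n (0 + r) \<omega> \<in> {..<0}} \<subseteq> {\<omega>\<in>space P. L T \<omega> < 0}"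
      proof (intro subsetI CollectI conjI)
        fix \<omega> assume *: "\<omega> \<in> {\<omega>\<in>space P. \<forall>r<2 ^ n. incr n (0 + r) \<omega> \<in> {..<0}}"
        then show \<omega>: "\<omega> \<in> space P" by simp
        have "L T \<omega> = (\<Sum>i<2 ^ n. incr n i \<omega>)" using sum_incr[OF \<omega>, where n = n and k = "2 ^ n"] by simp
        also have "\<dots> < (\<Sum>i<(2::nat) ^ n. 0)" using * by (intro sum_strict_mono) (auto simp: lessThan_empty_iff)
        also have "\<dots> = 0" by simp
        finally show "L T \<omega> < 0" .
      qed
    qed measurable
    also have "\<dots> = 0"
    proof -
      have "{\<omega>\<in>space P. L T \<omega> < 0} \<in> sets P" by measurable
      then show ?thesis using nonneg AE_iff_measurable[of _ P "\<lambda>\<omega>. 0 \<le> L T \<omega>"] by (auto simp: not_le)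
    qed
    finally have "?p ^ (2 ^ n) = 0" using eq by (simp add: emeasure_space_1)
    then have p0: "?p = 0" by simp
    have "emeasure P {\<omega>\<in>space P. incr n k \<omega> \<in> {..<0}} = emeasure P (space P) * ?p"
      by (rule incr_indep[OF k]) (use sp[of k] k in auto)
    then have "{\<omega>\<in>space P. incr n k \<omega> \<in> {..<0}} \<in> null_sets P"
      using p0 incr_measurable[OF k] by (intro null_setsI) auto
    then show ?thesis by (rule AE_I') auto
  qed
  then have "AE \<omega> in P. \<forall>n. \<forall>k\<in>{..<2 ^ n}. 0 \<le> incr n k \<omega>"
    by (subst AE_all_countable, intro allI AE_finite_allI) auto
  then show ?thesis
  proof (elim AE_mp, intro AE_I2 impI)
    fix \<omega> assume \<omega>: "\<omega> \<in> space P" and pos: "\<forall>n. \<forall>k\<in>{..<2 ^ n}. 0 \<le> incr n k \<omega>"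
    show "mono_on {0..T} (\<lambda>t. L t \<omega>)"
    proof (rule mono_onI)
      fix s t assume st: "s \<in> {0..T}" "t \<in> {0..T}" "s \<le> t"
      have "L (grid n (up n s)) \<omega> \<le> L (grid n (up n t)) \<omega>" for n
      proof -
        have "0 \<le> (\<Sum>i\<in>{up n s..<up n t}. incr n i \<omega>)"
          using pos up_le[of t n] st by (intro sum_nonneg) auto
        also have "\<dots> = L (grid n (up n t)) \<omega> - L (grid n (up n s)) \<omega>"
          unfolding incr_def by (rule sum_Suc_diff'[OF up_mono[OF st(3)]])
        finally show ?thesis by simp
      qed
      then show "L s \<omega> \<le> L t \<omega>"
        using L_grid_up_tendsto[OF \<omega>] st by (intro LIMSEQ_le[of "\<lambda>n. L (grid n (up n s)) \<omega>" _ "\<lambda>n. L (grid n (up n t)) \<omega>"]) auto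
    qed
  qed
qed

lemma terminal_negative_of_not_subordinator:
  assumes "\<not> subordinator P T F L"
  shows "emeasure P {\<omega>\<in>space P. L T \<omega> < 0} > 0"
proof (rule ccontr)
  assume "\<not> ?thesis"
  then have "{\<omega>\<in>space P. L T \<omega> < 0} \<in> null_sets P"
    using L_measurable[OF T_in] by (intro null_setsI) (auto simp: not_less)
  then have "AE \<omega> in P. 0 \<le> L T \<omega>" by (rule AE_I') auto
  then show False
    using AE_mono_of_terminal_nonneg levy assms by (auto simp: subordinator_def)
qed

text \<open>
  Gives access to the second half of the hypothesis that \<open>L\<close> is not monotone.
\<close>

lemma levy_process_uminus: "levy_process P T F (\<lambda>t \<omega>. - L t \<omega>)"
proof -
  let ?D = "\<lambda>t s \<omega>. L t \<omega> - L s \<omega>"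
  let ?D' = "\<lambda>t s \<omega>. - L t \<omega> - - L s \<omega>"
  let ?V = "\<lambda>f. sets (vimage_algebra (space P) f borel)"
  have m: "?D t s \<in> borel_measurable P" if "0 \<le> s" "0 \<le> t" "s \<le> T" "t \<le> T" for s t
    using that by (intro borel_measurable_diff L_measurable) auto
  have d: "distr P borel (?D' t s) = distr (distr P borel (?D t s)) borel uminus"
    if "0 \<le> s" "0 \<le> t" "s \<le> T" "t \<le> T" for s t
    using m[OF that] by (subst distr_distr) (auto simp: comp_def)
  have v: "?V (?D' t s) \<subseteq> ?V (?D t s)" for s t
  proof
    fix X assume "X \<in> ?V (?D' t s)"
    then obtain A where A: "A \<in> sets borel" "X = ?D' t s -` A \<inter> space P"
      by (auto simp: sets_vimage_algebra2)
    have "X = ?D t s -` (uminus -` A) \<inter> space P" unfolding A(2) by auto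
    moreover have "uminus -` A \<in> sets borel"
      using measurable_sets[of uminus borel borel A] A(1) by simp
    ultimately show "X \<in> ?V (?D t s)"
      by (simp only: in_vimage_algebra)
  qed
  have ind: "indep_set (sets (F s)) (?V (?D' t s))"
    if "0 \<le> s" "s \<le> t" "t \<le> T" for s t
  proof (rule indep_setI)
    have i: "indep_set (sets (F s)) (?V (?D t s))"
      using levy that by (auto simp: levy_process_def)
    show "sets (F s) \<subseteq> events" using i by (rule indep_setD_ev1)
    show "?V (?D' t s) \<subseteq> events"
      using v indep_setD_ev2[OF i] by blast
    show "prob (a \<inter> b) = prob a * prob b" if "a \<in> sets (F s)" "b \<in> ?V (?D' t s)" for a b
      using that v by (intro indep_setD[OF i]) auto
  qed
  have c: "cadlag_on T (\<lambda>t. - L t \<omega>)" if \<omega>: "\<omega> \<in> space P" for \<omega>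
    unfolding cadlag_on_def
  proof (intro conjI ballI)
    fix t assume t: "t \<in> {0..<T}"
    show "((\<lambda>t. - L t \<omega>) \<longlongrightarrow> - L t \<omega>) (at_right t)"
      using L_cadlag[OF \<omega>] t by (intro tendsto_minus) (auto simp: cadlag_on_def)
  next
    fix t assume "t \<in> {0<..T}"
    then obtain l where "((\<lambda>t. L t \<omega>) \<longlongrightarrow> l) (at_left t)"
      using L_cadlag[OF \<omega>] unfolding cadlag_on_def by blast
    then show "\<exists>l. ((\<lambda>t. - L t \<omega>) \<longlongrightarrow> l) (at_left t)"
      by (intro exI[of _ "- l"] tendsto_minus)
  qed
  have st: "distr P borel (?D' (t + h) (s + h)) = distr P borel (?D' t s)"
    if "0 \<le> s" "s \<le> t" "0 \<le> h" "t + h \<le> T" for s t h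
  proof -
    have "distr P borel (?D (t + h) (s + h)) = distr P borel (?D t s)"
      using levy that unfolding levy_process_def by blast
    then show ?thesis using d[of "s + h" "t + h"] d[of s t] that by simp
  qed
  have a: "adapted_on T F (\<lambda>t \<omega>. - L t \<omega>)"
    using levy unfolding levy_process_def adapted_on_def by (blast intro: borel_measurable_uminus)
  show ?thesis unfolding levy_process_def
    by (intro conjI ballI allI impI a c st ind) (simp_all add: L_0)
qed

lemma levy_basis_uminus: "levy_basis P T F (\<lambda>t \<omega>. - L t \<omega>)"
  by (intro levy_basis.intro levy_basis_axioms.intro prob_space_axioms T_pos filtration levy_process_uminus)

section \<open>The entropy lower bound\<close>

lemma stopping_time_sets:
  assumes \<tau>: "stopping_time_on T F \<tau>" and t: "t \<in> {0..T}"
  shows "{\<omega>\<in>space P. min (\<tau> \<omega>) T \<le> t} \<in> sets (F t)"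
proof (cases "t = T")
  case True
  then have "{\<omega>\<in>space P. min (\<tau> \<omega>) T \<le> t} = space (F t)" using space_F[OF t] by auto
  then show ?thesis by (simp only: sets.top)
next
  case False
  then have "{\<omega>\<in>space P. min (\<tau> \<omega>) T \<le> t} = {\<omega>\<in>space (F t). \<tau> \<omega> \<le> t}"
    using t space_F[OF t] by (auto simp: min_le_iff_disj)
  also have "\<dots> \<in> sets (F t)"
    using \<tau> t unfolding stopping_time_on_def pred_def by blast
  finally show ?thesis .
qed

lemma stopping_time_measurable:
  assumes \<tau>: "stopping_time_on T F \<tau>"
  shows "(\<lambda>\<omega>. min (\<tau> \<omega>) T) \<in> borel_measurable (F T)"
proof (rule borel_measurableI_le)
  fix a :: real
  consider "a < 0" | "a \<in> {0..T}" | "a > T" by fastforce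
  then show "{\<omega>\<in>space (F T). min (\<tau> \<omega>) T \<le> a} \<in> sets (F T)"
  proof cases
    case 1
    have "{\<omega>\<in>space (F T). min (\<tau> \<omega>) T \<le> a} = {}"
      using \<tau> 1 T_pos by (force simp: stopping_time_on_def min_le_iff_disj)
    then show ?thesis by (simp only: sets.empty_sets)
  next
    case 2
    then show ?thesis
      using stopping_time_sets[OF \<tau> 2] sets_F_mono[of a T] space_F[OF T_in] by auto
  next
    case 3
    then have "{\<omega>\<in>space (F T). min (\<tau> \<omega>) T \<le> a} = space (F T)" by auto
    then show ?thesis by (simp only: sets.top)
  qed
qed

text \<open>
  Optional stopping for the exponential martingale \<open>exp (v L\<^sub>t - \<kappa> t)\<close>. For the stopping time rounded
  up to the grid, independence allows \<open>L\<close> to be continued from the stopped grid point to \<open>T\<close>, so that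
  the expectation is exactly one. The rounded times decrease to the given one, paths are right
  continuous, and Fatou's lemma yields the inequality.
\<close>

lemma stopped_exp_supermartingale:
  assumes \<tau>: "stopping_time_on T F \<tau>"
    and \<kappa>: "(\<integral>\<^sup>+\<omega>. ennreal (exp (v * L T \<omega>)) \<partial>P) = ennreal (exp (\<kappa> * T))"
  shows "(\<integral>\<^sup>+\<omega>. ennreal (exp (v * L (min (\<tau> \<omega>) T) \<omega> - \<kappa> * min (\<tau> \<omega>) T)) \<partial>P) \<le> 1"
proof -
  let ?t = "\<lambda>\<omega>. min (\<tau> \<omega>) T"
  define S where "S n k \<omega> = ennreal (exp (v * L (grid n k) \<omega> - \<kappa> * grid n k))" for n k \<omega>
  have t_in: "?t \<omega> \<in> {0..T}" if "\<omega> \<in> space P" for \<omega>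
    using \<tau> that space_F[OF T_in] T_pos by (auto simp: stopping_time_on_def)
  define B where "B n j = {\<omega>\<in>space P. up n (?t \<omega>) = j}" for n j
  have Bm: "B n j \<in> sets (F (grid n j))" if j: "j \<le> 2 ^ n" for n j
  proof -
    have le: "{\<omega>\<in>space P. up n (?t \<omega>) \<le> i} \<in> sets (F (grid n j))" if i: "i \<le> j" for i
    proof -
      have "{\<omega>\<in>space P. up n (?t \<omega>) \<le> i} \<in> sets (F (grid n i))"
        unfolding up_le_iff using i j by (intro stopping_time_sets[OF \<tau>] grid_in) simp
      then show ?thesis
        using sets_F_mono[of "grid n i" "grid n j"] grid_mono[OF i] grid_le_T[OF j] by auto
    qed
    show ?thesis
    proof (cases j)
      case 0
      then show ?thesis using le[of 0] by (simp add: B_def)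
    next
      case (Suc i)
      have "B n j = {\<omega>\<in>space P. up n (?t \<omega>) \<le> j} - {\<omega>\<in>space P. up n (?t \<omega>) \<le> i}"
        unfolding B_def Suc by auto
      then show ?thesis using le[of j] le[of i] Suc by simp
    qed
  qed
  have cell: "(\<integral>\<^sup>+\<omega>. indicator (B n j) \<omega> * S n j \<omega> \<partial>P)
      = ennreal (exp (- \<kappa> * T)) * (\<integral>\<^sup>+\<omega>. indicator (B n j) \<omega> * ennreal (exp (v * L T \<omega>)) \<partial>P)" if j: "j \<le> 2 ^ n" for n j
  proof -
    let ?h = "\<lambda>x. ennreal (exp (v * x))"
    let ?Y = "\<lambda>\<omega>. indicator (B n j) \<omega> * ennreal (exp (v * L (grid n j) \<omega>))"
    have [measurable]: "L (grid n j) \<in> borel_measurable (F (grid n j))" "B n j \<in> sets (F (grid n j))"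
      using Bm[OF j] grid_le_T[OF j] by (auto intro: L_measurable_F)
    have Ym: "?Y \<in> borel_measurable (F (grid n j))" by measurable
    have YP: "?Y \<in> borel_measurable P" by (rule measurable_F_P[OF grid_in[OF j] Ym])
    have "(\<integral>\<^sup>+x. ?h x \<partial>incr_law n) ^ (2 ^ n) = ennreal (exp (\<kappa> * T))"
      unfolding incr_law_exp_power \<kappa> ..
    moreover have "ennreal (exp (\<kappa> * T)) = ennreal (exp (\<kappa> * grid n 1)) ^ (2 ^ n)"
      by (simp add: ennreal_power exp_of_nat_mult[symmetric] grid_def)
    ultimately have p: "(\<integral>\<^sup>+x. ?h x \<partial>incr_law n) = ennreal (exp (\<kappa> * grid n 1))"
    proof -
      assume e: "(\<integral>\<^sup>+x. ?h x \<partial>incr_law n) ^ (2 ^ n) = ennreal (exp (\<kappa> * T))" "ennreal (exp (\<kappa> * T)) = ennreal (exp (\<kappa> * grid n 1)) ^ (2 ^ n)"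
      then have "(\<integral>\<^sup>+x. ?h x \<partial>incr_law n) \<noteq> top" by (metis ennreal_neq_top power_eq_top_ennreal power_not_zero zero_neq_numeral)
      then obtain r where r: "(\<integral>\<^sup>+x. ?h x \<partial>incr_law n) = ennreal r" "r \<ge> 0" by (metis ennreal_cases)
      then have "r ^ (2 ^ n) = exp (\<kappa> * grid n 1) ^ (2 ^ n)"
        using e by (simp add: ennreal_power)
      then have "r = exp (\<kappa> * grid n 1)" using r by (intro power_eq_imp_eq_base[of r "2 ^ n"]) auto
      then show ?thesis using r by simp
    qed
    have "(\<integral>\<^sup>+\<omega>. indicator (B n j) \<omega> * ennreal (exp (v * L T \<omega>)) \<partial>P)
        = (\<integral>\<^sup>+\<omega>. ?Y \<omega> * (\<Prod>i\<in>{j..<2 ^ n}. ?h (incr n i \<omega>)) \<partial>P)"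
    proof (rule nn_integral_cong)
      fix \<omega> assume \<omega>: "\<omega> \<in> space P"
      have 0: "{..<2 ^ n} = {..<j} \<union> {j..<2 ^ n}" using j by auto
      have "ennreal (exp (v * L T \<omega>)) = (\<Prod>i<2 ^ n. ?h (incr n i \<omega>))"
        using prod_ennreal_exp_incr[OF \<omega>, of v n "2 ^ n"] by simp
      also have "\<dots> = (\<Prod>i<j. ?h (incr n i \<omega>)) * (\<Prod>i\<in>{j..<2 ^ n}. ?h (incr n i \<omega>))"
        unfolding 0 by (rule prod.union_disjoint) auto
      finally show "indicator (B n j) \<omega> * ennreal (exp (v * L T \<omega>)) = ?Y \<omega> * (\<Prod>i\<in>{j..<2 ^ n}. ?h (incr n i \<omega>))"
        by (simp only: prod_ennreal_exp_incr[OF \<omega>] mult.assoc)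
    qed
    also have "\<dots> = (\<integral>\<^sup>+\<omega>. ?Y \<omega> \<partial>P) * ennreal (exp (\<kappa> * grid n 1)) ^ (2 ^ n - j)"
      unfolding p[symmetric] by (rule nn_integral_grid_prod) (use Ym j in auto)
    also have "ennreal (exp (\<kappa> * grid n 1)) ^ (2 ^ n - j) = ennreal (exp (\<kappa> * (T - grid n j)))"
    proof -
      have "real (2 ^ n - j) * (\<kappa> * grid n 1) = \<kappa> * (T - grid n j)"
        using j by (simp add: of_nat_diff grid_def field_simps)
      then show ?thesis by (simp add: ennreal_power exp_of_nat_mult[symmetric])
    qed
    finally have "ennreal (exp (- \<kappa> * T)) * (\<integral>\<^sup>+\<omega>. indicator (B n j) \<omega> * ennreal (exp (v * L T \<omega>)) \<partial>P)
        = (\<integral>\<^sup>+\<omega>. ?Y \<omega> \<partial>P) * (ennreal (exp (- \<kappa> * T)) * ennreal (exp (\<kappa> * (T - grid n j))))"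
      by (simp only: mult_ac)
    also have "ennreal (exp (- \<kappa> * T)) * ennreal (exp (\<kappa> * (T - grid n j))) = ennreal (exp (- \<kappa> * grid n j))"
      by (simp add: ennreal_mult[symmetric] exp_add[symmetric] algebra_simps)
    also have "(\<integral>\<^sup>+\<omega>. ?Y \<omega> \<partial>P) * ennreal (exp (- \<kappa> * grid n j)) = (\<integral>\<^sup>+\<omega>. ?Y \<omega> * ennreal (exp (- \<kappa> * grid n j)) \<partial>P)"
      by (rule nn_integral_multc[OF YP, symmetric])
    also have "\<dots> = (\<integral>\<^sup>+\<omega>. indicator (B n j) \<omega> * S n j \<omega> \<partial>P)"
      by (intro nn_integral_cong) (simp add: S_def mult.assoc ennreal_mult[symmetric] exp_add[symmetric])
    finally show ?thesis by simp
  qed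
  have Sm: "(\<lambda>\<omega>. indicator (B n j) \<omega> * S n j \<omega>) \<in> borel_measurable P"
    and Sm': "(\<lambda>\<omega>. indicator (B n j) \<omega> * ennreal (exp (v * L T \<omega>))) \<in> borel_measurable P" if j: "j \<le> 2 ^ n" for n j
  proof -
    have [measurable]: "L (grid n j) \<in> borel_measurable P" "L T \<in> borel_measurable P" "B n j \<in> sets P"
      using L_measurable[OF grid_in[OF j]] L_measurable[OF T_in] sets_F_P[OF grid_in[OF j] Bm[OF j]] by auto
    show "(\<lambda>\<omega>. indicator (B n j) \<omega> * S n j \<omega>) \<in> borel_measurable P" unfolding S_def by measurable
    show "(\<lambda>\<omega>. indicator (B n j) \<omega> * ennreal (exp (v * L T \<omega>))) \<in> borel_measurable P" by measurable
  qed
  have part: "(\<Sum>j\<le>2 ^ n. indicator (B n j) \<omega> * g j) = g (up n (?t \<omega>))" if "\<omega> \<in> space P" for \<omega> n and g :: "nat \<Rightarrow> ennreal"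
  proof -
    have "up n (?t \<omega>) \<in> {..2 ^ n}" using up_le[of "?t \<omega>" n] by simp
    moreover have "indicator (B n j) \<omega> * g j = (if up n (?t \<omega>) = j then g j else 0)" for j
      using that by (simp add: B_def indicator_def)
    ultimately show ?thesis by simp
  qed
  have one: "(\<integral>\<^sup>+\<omega>. S n (up n (?t \<omega>)) \<omega> \<partial>P) = 1" for n
  proof -
    have "(\<integral>\<^sup>+\<omega>. S n (up n (?t \<omega>)) \<omega> \<partial>P) = (\<integral>\<^sup>+\<omega>. (\<Sum>j\<le>2 ^ n. indicator (B n j) \<omega> * S n j \<omega>) \<partial>P)"
      by (intro nn_integral_cong) (simp only: part)
    also have "\<dots> = (\<Sum>j\<le>2 ^ n. \<integral>\<^sup>+\<omega>. indicator (B n j) \<omega> * S n j \<omega> \<partial>P)"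
      by (intro nn_integral_sum Sm) simp
    also have "\<dots> = (\<Sum>j\<le>2 ^ n. ennreal (exp (- \<kappa> * T)) * (\<integral>\<^sup>+\<omega>. indicator (B n j) \<omega> * ennreal (exp (v * L T \<omega>)) \<partial>P))"
      by (intro sum.cong refl cell) simp
    also have "\<dots> = ennreal (exp (- \<kappa> * T)) * (\<integral>\<^sup>+\<omega>. (\<Sum>j\<le>2 ^ n. indicator (B n j) \<omega> * ennreal (exp (v * L T \<omega>))) \<partial>P)"
      unfolding sum_distrib_left[symmetric] by (subst nn_integral_sum) (auto intro: Sm')
    also have "(\<integral>\<^sup>+\<omega>. (\<Sum>j\<le>2 ^ n. indicator (B n j) \<omega> * ennreal (exp (v * L T \<omega>))) \<partial>P) = ennreal (exp (\<kappa> * T))"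
      unfolding \<kappa>[symmetric] by (intro nn_integral_cong) (simp only: part)
    also have "ennreal (exp (- \<kappa> * T)) * ennreal (exp (\<kappa> * T)) = 1"
      by (simp add: ennreal_mult[symmetric] exp_add[symmetric])
    finally show ?thesis .
  qed
  have SPm: "(\<lambda>\<omega>. S n (up n (?t \<omega>)) \<omega>) \<in> borel_measurable P" for n
  proof -
    have "(\<lambda>\<omega>. \<Sum>j\<le>2 ^ n. indicator (B n j) \<omega> * S n j \<omega>) \<in> borel_measurable P"
      by (intro borel_measurable_sum Sm) simp
    then show ?thesis by (rule measurable_cong[THEN iffD1, rotated]) (simp only: part)
  qed
  have "(\<integral>\<^sup>+\<omega>. ennreal (exp (v * L (?t \<omega>) \<omega> - \<kappa> * ?t \<omega>)) \<partial>P) = (\<integral>\<^sup>+\<omega>. liminf (\<lambda>n. S n (up n (?t \<omega>)) \<omega>) \<partial>P)"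
  proof (rule nn_integral_cong)
    fix \<omega> assume \<omega>: "\<omega> \<in> space P"
    have "(\<lambda>n. S n (up n (?t \<omega>)) \<omega>) \<longlonglongrightarrow> ennreal (exp (v * L (?t \<omega>) \<omega> - \<kappa> * ?t \<omega>))"
      unfolding S_def using t_in[OF \<omega>]
      by (intro tendsto_ennrealI tendsto_exp tendsto_diff tendsto_mult_left L_grid_up_tendsto[OF \<omega>] grid_up_tendsto) auto
    then show "ennreal (exp (v * L (?t \<omega>) \<omega> - \<kappa> * ?t \<omega>)) = liminf (\<lambda>n. S n (up n (?t \<omega>)) \<omega>)"
      by (intro lim_imp_Liminf[symmetric]) auto
  qed
  also have "\<dots> \<le> liminf (\<lambda>n. \<integral>\<^sup>+\<omega>. S n (up n (?t \<omega>)) \<omega> \<partial>P)"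
    by (rule nn_integral_liminf[OF SPm])
  also have "\<dots> = 1" by (simp add: one Liminf_const)
  finally show ?thesis .
qed

text \<open>
  The Gibbs inequality with \<open>Y = v L\<^sub>\<tau> - \<kappa> \<tau>\<close>, where \<open>\<tau>\<close> is a stopping time at which \<open>L\<close> has mean zero
  under \<open>Q\<close>, leaves \<open>- \<kappa> E\<^sub>Q[\<tau>]\<close>; and \<open>E\<^sub>Q[\<tau>]\<close> tends to \<open>T\<close> along the exhausting sequence.
\<close>

lemma entropy_lower_bound:
  assumes Q: "Q \<in> M_a_tilde_loc P T F L"
    and \<kappa>: "(\<integral>\<^sup>+\<omega>. ennreal (exp (v * L T \<omega>)) \<partial>P) = ennreal (exp (\<kappa> * T))"
  shows "ereal (- \<kappa> * T) \<le> entropy_at T F Q P"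
proof -
  from Q obtain \<tau> where \<tau>: "exhausting_stopping_times T F \<tau>"
    and int: "\<And>k. integrable Q (stopped (\<tau> k) L T)" and zero: "\<And>k. integral\<^sup>L Q (stopped (\<tau> k) L T) = 0"
    and ps: "prob_space Q" and sQ: "sets Q = sets (F T)" and ac: "absolutely_continuous P_T Q"
    by (auto simp: M_a_tilde_loc_def ac_measures_def)
  interpret Q: prob_space Q by (rule ps)
  let ?t = "\<lambda>k \<omega>. min (\<tau> k \<omega>) T"
  let ?Y = "\<lambda>k \<omega>. v * L (?t k \<omega>) \<omega> - \<kappa> * ?t k \<omega>"
  have spQ: "space Q = space P" using sets_eq_imp_space_eq[OF sQ] space_F[OF T_in] by simp
  have subQ: "subalgebra Q (F T)" using sQ spQ space_F[OF T_in] by (simp add: subalgebra_def)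
  have rQ: "restr_to_subalg Q (F T) = Q"
    by (intro measure_eqI) (auto simp: sets_restr_to_subalg[OF subQ] emeasure_restr_to_subalg[OF subQ] sQ)
  have st: "stopping_time_on T F (\<tau> k)" for k using \<tau> by (simp add: exhausting_stopping_times_def)
  have tm: "(?t k) \<in> borel_measurable Q" for k
    using stopping_time_measurable[OF st[of k]] measurable_cong_sets[OF sQ refl, of borel] by auto
  have t_in: "?t k \<omega> \<in> {0..T}" if "\<omega> \<in> space Q" for \<omega> k
    using st[of k] that spQ space_F[OF T_in] T_pos by (auto simp: stopping_time_on_def)
  have tint: "integrable Q (?t k)" for k
    using t_in[of _ k] tm[of k] by (intro Q.integrable_const_bound[where B = T]) (auto intro!: AE_I2)
  have "(\<integral>\<omega>. ?Y k \<omega> \<partial>Q) = - \<kappa> * (\<integral>\<omega>. ?t k \<omega> \<partial>Q)" for k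
    using int[of k] zero[of k] tint[of k] by (simp add: stopped_def[abs_def])
  moreover have "ereal (\<integral>\<omega>. ?Y k \<omega> \<partial>Q) \<le> relative_entropy Q P_T" for k
  proof (rule Gibbs_variational_inequality[OF prob_space_P_T ps _ ac])
    show "sets Q = sets P_T" by (simp add: sQ sets_P_T)
    show iY: "integrable Q (?Y k)"
      using int[of k] tint[of k] by (simp add: stopped_def[abs_def])
    have "(?Y k) \<in> borel_measurable (F T)"
      using borel_measurable_integrable[OF iY] measurable_cong_sets[OF sQ refl, of borel] by auto
    then have "(\<integral>\<^sup>+\<omega>. ennreal (exp (?Y k \<omega>)) \<partial>P_T)
        = (\<integral>\<^sup>+\<omega>. ennreal (exp (?Y k \<omega>)) \<partial>P)"
      by (intro nn_integral_P_T) simp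
    also have "\<dots> \<le> 1" by (rule stopped_exp_supermartingale[OF st \<kappa>])
    finally show "(\<integral>\<^sup>+\<omega>. ennreal (exp (?Y k \<omega>)) \<partial>P_T) \<le> 1" .
  qed
  ultimately have bound: "ereal (- \<kappa> * (\<integral>\<omega>. ?t k \<omega> \<partial>Q)) \<le> entropy_at T F Q P" for k
    by (simp add: entropy_at_def rQ)
  have "(\<lambda>k. \<integral>\<omega>. ?t k \<omega> \<partial>Q) \<longlonglongrightarrow> (\<integral>\<omega>. T \<partial>Q)"
  proof (rule integral_dominated_convergence[where w = "\<lambda>_. T"])
    show "AE \<omega> in Q. (\<lambda>k. ?t k \<omega>) \<longlonglongrightarrow> T"
    proof (rule AE_I2)
      fix \<omega> assume "\<omega> \<in> space Q"
      then have "\<omega> \<in> space (F T)" using spQ space_F[OF T_in] by simp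
      then obtain K where K: "\<omega> \<in> {\<omega>\<in>space (F T). \<tau> K \<omega> = T}"
        using \<tau> unfolding exhausting_stopping_times_def by blast
      have "incseq (\<lambda>k. {\<omega>\<in>space (F T). \<tau> k \<omega> = T})" using \<tau> by (simp add: exhausting_stopping_times_def)
      then have "\<tau> k \<omega> = T" if "k \<ge> K" for k
        using K monoD[of "\<lambda>k. {\<omega>\<in>space (F T). \<tau> k \<omega> = T}" K k] that by auto
      then show "(\<lambda>k. ?t k \<omega>) \<longlonglongrightarrow> T"
        by (intro tendsto_eventually) (auto simp: eventually_sequentially intro!: exI[of _ K])
    qed
  qed (use tm t_in in \<open>auto intro!: AE_I2\<close>)
  then have "(\<lambda>k. ereal (- \<kappa> * (\<integral>\<omega>. ?t k \<omega> \<partial>Q))) \<longlonglongrightarrow> ereal (- \<kappa> * T)"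
    by (intro tendsto_ereal tendsto_mult_left) (simp add: Q.prob_space)
  then show ?thesis by (rule LIMSEQ_le_const2) (use bound in blast)
qed

end

section \<open>Comparison of the infima\<close>

context levy_basis
begin

text \<open>
  Used with the two open half lines: when \<open>L\<^sub>T\<close> takes both signs, so does its restriction to a large
  good event, and the truncated moment generating function is coercive.
\<close>

lemma cell_law_positive:
  assumes S: "S \<in> sets borel" and pos: "emeasure P {\<omega>\<in>space P. L T \<omega> \<in> S} > 0"
  shows "\<exists>N. \<forall>n\<ge>N. emeasure (cell_law (real n) 0) S > 0"
proof -
  let ?A = "\<lambda>n. {\<omega>\<in>good (real n) 0 0. L T \<omega> \<in> S}"
  have eq: "emeasure (cell_law (real n) 0) S = emeasure P (?A n)" for n
    unfolding emeasure_cell_law[OF S]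
    by (intro arg_cong[where f = "emeasure P"]) (auto simp: good_def incr_whole)
  have m: "?A n \<in> sets P" for n
  proof -
    have g: "good (real n) 0 0 \<in> sets P" by (rule good_sets) simp
    have "?A n = good (real n) 0 0 \<inter> (L T -` S \<inter> space P)"
      using sets.sets_into_space[OF g] by auto
    also have "\<dots> \<in> sets P" by (intro sets.Int g measurable_sets[OF L_measurable[OF T_in] S])
    finally show ?thesis .
  qed
  have un: "{\<omega>\<in>space P. L T \<omega> \<in> S} = (\<Union>n. ?A n)"
    using UN_good by blast
  have "\<exists>N. emeasure P (?A N) \<noteq> 0"
  proof (rule ccontr)
    assume "\<not> ?thesis"
    then have "(\<Union>n. ?A n) \<in> null_sets P"
      using m by (intro null_sets_UN null_setsI) auto
    then show False using pos unfolding un by (simp add: null_setsD1)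
  qed
  then obtain N where N: "emeasure P (?A N) \<noteq> 0" by blast
  have "emeasure (cell_law (real n) 0) S > 0" if "n \<ge> N" for n
  proof -
    have "emeasure P (?A N) \<le> emeasure P (?A n)"
      using good_mono[of "real N" "real n"] that by (intro emeasure_mono m) auto
    moreover have "0 < emeasure P (?A N)"
      using N by (simp only: zero_less_iff_neq_zero not_False_eq_True)
    ultimately show ?thesis unfolding eq by (rule order_less_le_trans[rotated])
  qed
  then show ?thesis by blast
qed

lemma mgf_cell_law_eq:
  assumes "c > 0"
  shows "ennreal (mgf (cell_law c 0) v) = (\<integral>\<^sup>+\<omega>. indicator (good c 0 0) \<omega> * ennreal (exp (v * L T \<omega>)) \<partial>P)"
proof -
  have "(\<integral>\<^sup>+x. ennreal (exp (v * x)) \<partial>cell_law c 0) = ennreal (mgf (cell_law c 0) v)"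
    by (rule finite_exp_moments.nn_integral_exp_eq[OF cell_law_exp_moments[OF assms]])
  moreover have "(\<integral>\<^sup>+x. ennreal (exp (v * x)) \<partial>cell_law c 0) = (\<integral>\<^sup>+\<omega>. indicator (good c 0 0) \<omega> * ennreal (exp (v * L T \<omega>)) \<partial>P)"
    by (rule nn_integral_cell_law) simp
  ultimately show ?thesis by (simp only:)
qed

lemma mgf_cell_law_mono:
  assumes "0 < c" "c \<le> c'"
  shows "mgf (cell_law c 0) v \<le> mgf (cell_law c' 0) v"
proof -
  have "ennreal (mgf (cell_law c 0) v) \<le> ennreal (mgf (cell_law c' 0) v)"
    using assms good_mono[OF assms(2)]
    by (subst (1 2) mgf_cell_law_eq) (auto intro!: nn_integral_mono simp: indicator_def)
  moreover have "0 \<le> mgf (cell_law c' 0) v"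
    using assms by (intro finite_exp_moments.mgf_nonneg cell_law_exp_moments) simp
  ultimately show ?thesis by (simp add: ennreal_le_iff)
qed

lemma mgf_cell_law_0_le_1:
  assumes "0 < c"
  shows "mgf (cell_law c 0) 0 \<le> 1"
proof -
  have "ennreal (mgf (cell_law c 0) 0) \<le> (\<integral>\<^sup>+\<omega>. 1 \<partial>P)"
    unfolding mgf_cell_law_eq[OF assms] by (intro nn_integral_mono) (auto simp: indicator_def)
  then show ?thesis by (simp add: emeasure_space_1)
qed

text \<open>
  If the infimum is a real number \<open>r\<close>, the Esscher measures show that every truncated moment
  generating function comes down to \<open>exp (- r)\<close>. A point \<open>v\<close> where all of them are at most \<open>exp (- r)\<close>
  satisfies \<open>E[exp (v L\<^sub>T)] \<le> exp (- r)\<close> by monotone convergence, and the lower bound at this \<open>v\<close> says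
  that no measure of the larger class has entropy below \<open>r\<close>.
\<close>

lemma INF_entropy_M_a_le:
  assumes neg: "emeasure P {\<omega>\<in>space P. L T \<omega> < 0} > 0" and pos: "emeasure P {\<omega>\<in>space P. 0 < L T \<omega>} > 0"
    and Q: "Q \<in> M_a_tilde_loc P T F L"
  shows "(INF Q\<in>M_a P T F L. entropy_at T F Q P) \<le> entropy_at T F Q P"
proof -
  let ?I = "INF Q\<in>M_a P T F L. entropy_at T F Q P"
  let ?M = "\<lambda>n. mgf (cell_law (real n) 0)"
  obtain N1 N2 where N1: "\<And>n. n \<ge> N1 \<Longrightarrow> emeasure (cell_law (real n) 0) {..<0} > 0"
    and N2: "\<And>n. n \<ge> N2 \<Longrightarrow> emeasure (cell_law (real n) 0) {0<..} > 0"
    using cell_law_positive[of "{..<0}"] cell_law_positive[of "{0<..}"] neg pos by auto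
  define N where "N = max 1 (max N1 N2)"
  have N: "real n > 0" "emeasure (cell_law (real n) 0) {..<0} > 0" "emeasure (cell_law (real n) 0) {0<..} > 0" if "n \<ge> N" for n
    using that N1[of n] N2[of n] by (auto simp: N_def)
  have mom: "finite_exp_moments (cell_law (real n) 0)" if "n \<ge> N" for n
    by (rule cell_law_exp_moments[OF N(1)[OF that]])
  have cont: "continuous_on X (?M n)" if "n \<ge> N" for n X
    using finite_exp_moments.continuous_mgf[OF mom[OF that]] by (intro continuous_at_imp_continuous_on) auto
  obtain R where R: "R > 0" "\<And>v. \<bar>v\<bar> > R \<Longrightarrow> ?M N v > 1"
    using finite_exp_moments.mgf_coercive[OF mom[of N], of 1] N[of N] by auto
  have key: "\<exists>u\<in>{-R..R}. ?M n u > 0 \<and> ?I \<le> ereal (- ln (?M n u))" if n: "n \<ge> N" for n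
  proof -
    obtain u where u: "u \<in> {-R..R}" "\<And>v. v \<in> {-R..R} \<Longrightarrow> ?M n u \<le> ?M n v"
      using continuous_attains_inf[of "{-R..R}" "?M n"] cont[OF n] R by auto
    \<comment> \<open>Outside \<open>{-R..R}\<close> already the smaller function \<open>?M N\<close> exceeds \<open>1 \<ge> ?M n 0\<close>.\<close>
    have min: "?M n u \<le> ?M n v" for v
    proof (cases "\<bar>v\<bar> > R")
      case True
      have "?M n u \<le> ?M n 0" using u(2)[of 0] R by simp
      also have "\<dots> \<le> 1" by (rule mgf_cell_law_0_le_1[OF N(1)[OF n]])
      also have "\<dots> \<le> ?M N v" using R(2)[OF True] by simp
      also have "\<dots> \<le> ?M n v" using N(1)[of N] n by (intro mgf_cell_law_mono) auto
      finally show ?thesis .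
    next
      case False
      then show ?thesis by (intro u(2)) (auto simp: abs_le_iff)
    qed
    have p: "?M n u > 0" by (rule finite_exp_moments.mgf_positive[OF mom[OF n] N(2)[OF n]])
    interpret E: esscher P T F L "real n" u
      by (intro esscher.intro levy_basis_axioms esscher_axioms.intro N(1)[OF n] min p)
    have "?I \<le> entropy_at T F E.Q P" by (rule INF_lower[OF E.Q_in_M_a])
    then show ?thesis using u(1) p unfolding E.entropy_Q by blast
  qed
  show ?thesis
  proof (cases "?I = -\<infinity>")
    case True
    then show ?thesis by simp
  next
    case False
    moreover have "?I \<noteq> \<infinity>" using key[of N] by auto
    ultimately obtain r where r: "?I = ereal r" by (cases ?I) auto
    \<comment> \<open>The functions \<open>?M n\<close> increase with \<open>n\<close>, so their sublevel sets are nested compact sets.\<close>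
    define K where "K n = {-R..R} \<inter> {v. ?M (N + n) v \<le> exp (- r)}" for n
    have "\<Inter>(range K) \<noteq> {}"
    proof (rule compact_nest)
      fix n
      have "closed {v. ?M (N + n) v \<le> exp (- r)}"
        by (intro closed_Collect_le cont continuous_on_const) simp
      then show "compact (K n)" unfolding K_def by (intro compact_Int_closed) auto
      obtain u where u: "u \<in> {-R..R}" "?M (N + n) u > 0" "?I \<le> ereal (- ln (?M (N + n) u))"
        using key[of "N + n"] by auto
      then have "ln (?M (N + n) u) \<le> - r" unfolding r by simp
      then have "?M (N + n) u \<le> exp (- r)" using u(2) by (metis exp_le_cancel_iff exp_ln)
      then show "K n \<noteq> {}" using u(1) by (auto simp: K_def)
    next
      fix n n' :: nat assume "n \<le> n'"
      have "?M (N + n) v \<le> ?M (N + n') v" for v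
        using N(1)[of "N + n"] \<open>n \<le> n'\<close> by (intro mgf_cell_law_mono) auto
      then show "K n' \<subseteq> K n" by (auto simp: K_def intro: order_trans)
    qed
    then obtain v where v: "\<And>n. ?M (N + n) v \<le> exp (- r)" by (auto simp: K_def)
    let ?f = "\<lambda>\<omega>. ennreal (exp (v * L T \<omega>))"
    let ?g = "\<lambda>n \<omega>. indicator (good (real (N + n)) 0 0) \<omega> * ?f \<omega>"
    have fm [measurable]: "?f \<in> borel_measurable P" using L_measurable[OF T_in] by measurable
    have "(\<integral>\<^sup>+\<omega>. ?f \<omega> \<partial>P) \<le> (\<integral>\<^sup>+\<omega>. (SUP n. ?g n \<omega>) \<partial>P)"
    proof (rule nn_integral_mono)
      fix \<omega> assume "\<omega> \<in> space P"
      then obtain n where "\<omega> \<in> good (real n) 0 0" using UN_good by blast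
      then have "\<omega> \<in> good (real (N + n)) 0 0" using good_mono[of "real n" "real (N + n)"] by auto
      then show "?f \<omega> \<le> (SUP n. ?g n \<omega>)" by (intro SUP_upper2[of n]) auto
    qed
    also have "\<dots> = (SUP n. \<integral>\<^sup>+\<omega>. ?g n \<omega> \<partial>P)"
    proof (rule nn_integral_monotone_convergence_SUP)
      show "incseq ?g"
      proof (intro incseq_SucI le_funI)
        fix n \<omega>
        show "?g n \<omega> \<le> ?g (Suc n) \<omega>"
          using good_mono[of "real (N + n)" "real (N + Suc n)"] by (auto simp: indicator_def)
      qed
      fix n
      have [measurable]: "good (real (N + n)) 0 0 \<in> sets P" by (rule good_sets) simp
      show "?g n \<in> borel_measurable P" by measurable
    qed
    also have "\<dots> \<le> ennreal (exp (- r))"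
    proof (rule SUP_least)
      fix n
      have "(\<integral>\<^sup>+\<omega>. ?g n \<omega> \<partial>P) = ennreal (?M (N + n) v)"
        by (rule mgf_cell_law_eq[symmetric]) (use N(1)[of "N + n"] in simp)
      also have "\<dots> \<le> ennreal (exp (- r))" by (intro ennreal_leI v)
      finally show "(\<integral>\<^sup>+\<omega>. ?g n \<omega> \<partial>P) \<le> ennreal (exp (- r))" .
    qed
    finally have le: "(\<integral>\<^sup>+\<omega>. ?f \<omega> \<partial>P) \<le> ennreal (exp (- r))" .
    then have "(\<integral>\<^sup>+\<omega>. ?f \<omega> \<partial>P) \<noteq> top" by (metis ennreal_neq_top top_unique)
    then obtain f where f: "(\<integral>\<^sup>+\<omega>. ?f \<omega> \<partial>P) = ennreal f" "f \<ge> 0" by (metis ennreal_cases)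
    have "f \<noteq> 0"
    proof
      assume "f = 0"
      then have "AE \<omega> in P. ?f \<omega> = 0" using f nn_integral_0_iff_AE[OF fm] by simp
      then have "AE \<omega> in P. False" by (simp add: ennreal_eq_0_iff not_le)
      then show False by simp
    qed
    then have f0: "f > 0" using f by simp
    define \<kappa> where "\<kappa> = ln f / T"
    have \<kappa>T: "\<kappa> * T = ln f" using T_pos by (simp add: \<kappa>_def)
    then have "exp (\<kappa> * T) = f" using f0 by simp
    then have "ereal (- \<kappa> * T) \<le> entropy_at T F Q P"
      using f by (intro entropy_lower_bound[OF Q, of v]) simp
    moreover have "r \<le> - \<kappa> * T"
    proof -
      have "f \<le> exp (- r)" using le f by simp
      then have "ln f \<le> - r" using f0 by (metis ln_exp ln_le_cancel_iff exp_gt_zero)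
      then show ?thesis using \<kappa>T by simp
    qed
    ultimately show ?thesis unfolding r by (meson ereal_less_eq(3) order_trans)
  qed
qed

section \<open>Inclusions between the classes\<close>

lemma ac_measures_space:
  assumes "Q \<in> ac_measures P T F"
  shows "space Q = space P"
proof -
  have "sets Q = sets (F T)" using assms by (simp add: ac_measures_def)
  then have "space Q = space (F T)" by (rule sets_eq_imp_space_eq)
  also have "\<dots> = space P" by (rule space_F[OF T_in])
  finally show ?thesis .
qed

lemma ac_measures_finite_subalgebra:
  assumes "Q \<in> ac_measures P T F" "t \<in> {0..T}"
  shows "finite_measure_subalgebra Q (F t)"
proof -
  interpret Q: prob_space Q using assms by (simp add: ac_measures_def)
  have "subalgebra Q (F t)"
    using assms sets_F_mono[of t T] space_F[of t] ac_measures_space[OF assms(1)]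
    by (auto simp: ac_measures_def subalgebra_def)
  then show ?thesis by unfold_locales
qed

lemma martingale_mean_zero:
  assumes Q: "Q \<in> ac_measures P T F" and X: "martingale_on T F Q X"
    and X0: "\<And>\<omega>. \<omega> \<in> space P \<Longrightarrow> X 0 \<omega> = 0"
  shows "integrable Q (X T) \<and> integral\<^sup>L Q (X T) = 0"
proof -
  have z: "(0::real) \<in> {0..T}" using T_pos by simp
  interpret finite_measure_subalgebra Q "F 0" by (rule ac_measures_finite_subalgebra[OF Q z])
  have int: "integrable Q (X T)" using X T_in by (auto simp: martingale_on_def)
  have "AE \<omega> in Q. real_cond_exp Q (F 0) (X T) \<omega> = X 0 \<omega>"
    using X T_in z by (auto simp: martingale_on_def)
  moreover have "AE \<omega> in Q. X 0 \<omega> = 0" using X0 ac_measures_space[OF Q] by (intro AE_I2) auto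
  ultimately have "AE \<omega> in Q. real_cond_exp Q (F 0) (X T) \<omega> = 0" by (elim AE_mp) (intro AE_I2, simp)
  then have "(\<integral>\<omega>. real_cond_exp Q (F 0) (X T) \<omega> \<partial>Q) = (\<integral>\<omega>. 0 \<partial>Q)"
    by (intro integral_cong_AE) auto
  then show ?thesis using int real_cond_exp_int(2)[OF int] by simp
qed

lemma exhausting_constant: "exhausting_stopping_times T F (\<lambda>_ _. T)"
proof -
  have "stopping_time_on T F (\<lambda>_. T)"
    unfolding stopping_time_on_def using T_pos by simp
  then show ?thesis unfolding exhausting_stopping_times_def by simp
qed

lemma M_a_subset_M_a_tilde: "M_a P T F L \<subseteq> M_a_tilde P T F L"
proof
  fix Q assume "Q \<in> M_a P T F L"
  then have Q: "Q \<in> ac_measures P T F" "martingale_on T F Q L" by (simp_all add: M_a_def)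
  from martingale_mean_zero[OF this L_0] Q(1) show "Q \<in> M_a_tilde P T F L"
    by (simp add: M_a_tilde_def)
qed

lemma M_a_tilde_subset: "M_a_tilde P T F L \<subseteq> M_a_tilde_loc P T F L"
proof
  fix Q assume "Q \<in> M_a_tilde P T F L"
  moreover have "stopped (\<lambda>_. T) L T = L T" by (simp add: stopped_def fun_eq_iff)
  ultimately show "Q \<in> M_a_tilde_loc P T F L"
    using exhausting_constant unfolding M_a_tilde_def M_a_tilde_loc_def
    by (intro CollectI conjI exI[of _ "\<lambda>_ _. T"]) auto
qed

lemma M_a_loc_subset: "M_a_loc P T F L \<subseteq> M_a_tilde_loc P T F L"
proof
  fix Q assume "Q \<in> M_a_loc P T F L"
  then obtain \<tau> where Q: "Q \<in> ac_measures P T F" and \<tau>: "exhausting_stopping_times T F \<tau>"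
    and m: "\<And>k. martingale_on T F Q (\<lambda>t \<omega>. stopped (\<tau> k) L t \<omega> - L 0 \<omega>)"
    by (auto simp: M_a_loc_def local_martingale_on_def)
  have "integrable Q (stopped (\<tau> k) L T) \<and> integral\<^sup>L Q (stopped (\<tau> k) L T) = 0" for k
  proof -
    have t0: "0 \<le> \<tau> k \<omega>" if "\<omega> \<in> space P" for \<omega>
      using \<tau> that space_F[OF T_in] by (auto simp: exhausting_stopping_times_def stopping_time_on_def)
    have "integrable Q (\<lambda>\<omega>. stopped (\<tau> k) L T \<omega> - L 0 \<omega>) \<and> integral\<^sup>L Q (\<lambda>\<omega>. stopped (\<tau> k) L T \<omega> - L 0 \<omega>) = 0"
      using t0 by (intro martingale_mean_zero[OF Q m]) (simp add: stopped_def min_absorb2)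
    moreover have eq: "stopped (\<tau> k) L T \<omega> - L 0 \<omega> = stopped (\<tau> k) L T \<omega>" if "\<omega> \<in> space Q" for \<omega>
      using that L_0 ac_measures_space[OF Q] by simp
    ultimately show ?thesis
      using Bochner_Integration.integrable_cong[OF refl eq, of Q "\<lambda>x. x"] Bochner_Integration.integral_cong[OF refl eq, of Q "\<lambda>x. x"] by simp
  qed
  then show "Q \<in> M_a_tilde_loc P T F L" using Q \<tau> by (auto simp: M_a_tilde_loc_def)
qed

lemma M_a_subset_M_a_loc: "M_a P T F L \<subseteq> M_a_loc P T F L"
proof
  fix Q assume "Q \<in> M_a P T F L"
  then have Q: "Q \<in> ac_measures P T F" and m: "martingale_on T F Q L" by (auto simp: M_a_def)
  let ?X = "\<lambda>t \<omega>. stopped (\<lambda>_. T) L t \<omega> - L 0 \<omega>"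
  have eq: "?X t \<omega> = L t \<omega>" if "\<omega> \<in> space P" "t \<in> {0..T}" for t \<omega>
    using that L_0 by (simp add: stopped_def min_absorb2)
  note sp = ac_measures_space[OF Q]
  have a: "?X t \<in> borel_measurable (F t)" if t: "t \<in> {0..T}" for t
    using L_measurable_F[of t t] t measurable_cong[of "F t" "?X t" "L t" borel] eq[OF _ t] space_F[OF t] by simp
  have i: "integrable Q (?X t)" if t: "t \<in> {0..T}" for t
    using m t Bochner_Integration.integrable_cong[OF refl, of Q "?X t" "L t"] eq[OF _ t] sp by (simp add: martingale_on_def)
  have ce: "AE \<omega> in Q. real_cond_exp Q (F s) (?X t) \<omega> = ?X s \<omega>" if st: "s \<in> {0..T}" "t \<in> {0..T}" "s \<le> t" for s t
  proof -
    interpret finite_measure_subalgebra Q "F s" by (rule ac_measures_finite_subalgebra[OF Q st(1)])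
    have "AE \<omega> in Q. real_cond_exp Q (F s) (L t) \<omega> = L s \<omega>" using m st by (simp add: martingale_on_def)
    moreover have "AE \<omega> in Q. real_cond_exp Q (F s) (?X t) \<omega> = real_cond_exp Q (F s) (L t) \<omega>"
      using i[OF st(2)] m st eq[OF _ st(2)] sp by (intro real_cond_exp_cong AE_I2) (auto simp: martingale_on_def)
    moreover have "AE \<omega> in Q. ?X s \<omega> = L s \<omega>" using eq[OF _ st(1)] sp by (intro AE_I2) auto
    ultimately show ?thesis by (elim AE_mp) (intro AE_I2, simp)
  qed
  have "martingale_on T F Q ?X" using a i ce by (simp add: martingale_on_def adapted_on_def)
  then have "local_martingale_on T F Q L"
    using m exhausting_constant unfolding local_martingale_on_def martingale_on_def[of T F Q L]
    by (intro conjI exI[of _ "\<lambda>_ _. T"]) (auto simp: incseq_def)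
  then show "Q \<in> M_a_loc P T F L" using Q by (simp add: M_a_loc_def)
qed

end

theorem corollary4p4:
  fixes P :: "'a measure" and T :: real
    and F :: "real \<Rightarrow> 'a measure" and L :: "real \<Rightarrow> 'a \<Rightarrow> real"
  assumes "prob_space P"
    and "0 < T"
    and "filtration_on P T F"
    and "levy_process P T F L"
    and "\<not> subordinator P T F L"
    and "\<not> subordinator P T F (\<lambda>t \<omega>. - L t \<omega>)"
  shows "(INF Q\<in>M_a P T F L. entropy_at T F Q P) = (INF Q\<in>M_a_tilde P T F L. entropy_at T F Q P)
       \<and> (INF Q\<in>M_a_loc P T F L. entropy_at T F Q P) = (INF Q\<in>M_a_tilde_loc P T F L. entropy_at T F Q P)"
proof -
  interpret levy_basis P T F L
    by (intro levy_basis.intro levy_basis_axioms.intro assms)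
  interpret minus: levy_basis P T F "\<lambda>t \<omega>. - L t \<omega>" by (rule levy_basis_uminus)
  let ?I = "\<lambda>\<M>. INF Q\<in>\<M>. entropy_at T F Q P"
  have neg: "emeasure P {\<omega>\<in>space P. L T \<omega> < 0} > 0"
    by (rule terminal_negative_of_not_subordinator[OF assms(5)])
  have pos: "emeasure P {\<omega>\<in>space P. 0 < L T \<omega>} > 0"
    using minus.terminal_negative_of_not_subordinator[OF assms(6)] by simp
  have "?I (M_a P T F L) \<le> ?I (M_a_tilde_loc P T F L)"
    by (intro INF_greatest INF_entropy_M_a_le[OF neg pos])
  moreover have "?I (M_a_tilde_loc P T F L) \<le> ?I (M_a_tilde P T F L)" "?I (M_a_tilde P T F L) \<le> ?I (M_a P T F L)"
      "?I (M_a_tilde_loc P T F L) \<le> ?I (M_a_loc P T F L)" "?I (M_a_loc P T F L) \<le> ?I (M_a P T F L)"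
    using M_a_tilde_subset M_a_subset_M_a_tilde M_a_loc_subset M_a_subset_M_a_loc by (auto intro!: INF_superset_mono)
  ultimately show ?thesis by (intro conjI antisym) (meson order_trans)+
qed

end
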